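(* Let $K$ be a field of characteristic zero. Let $2\leq d_1<d_2<d_3$ be integers such that $d_1+d_2>d_3+1$, and let $\alpha=d_1+d_2-d_3$. Let $f_1,f_2,f_3\in S=K[x_1,x_2,x_3]$ be a regular sequence of homogeneous polynomials of degrees $d_1,d_2,d_3$, let $I=(f_1,f_2,f_3)$ and let $J=\operatorname{Gin}(I)$ be the generic initial ideal with respect to the reverse lexicographic order. Suppose $S/I$ has the strong Lefschetz property. If $\alpha$ is even, then $J$ is the ideal generated by - $x_1^{d_1},\ x_1^{d_1-1}x_2^{d_2-d_1+1},\ x_1^{d_1-2}x_2^{d_2-d_1+3},\ldots,\ x_1^{d_1+d_2-d_3}x_2^{2d_3-d_1-d_2-1}$ (that is, $x_1^{d_1}$ and $x_1^{d_1-j}x_2^{d_2-d_1+2j-1}$ for $1\leq j\leq d_3-d_2$); - $x_1^{d_1+d_2-d_3-2j}x_2^{2d_3-d_1-d_2+3j-1}$ and $x_1^{d_1+d_2-d_3-2j+1}x_2^{2d_3-d_1-d_2+3j-2}$ for $j=1,\ldots,\frac{\alpha-2}{2}$; - $x_2^{\frac{d_1+d_2+d_3-2}{2}}$; $x_1x_2^{\frac{d_1+d_2+d_3-4}{2}}$; $x_3^{2j}x_2^{\frac{d_1+d_2+d_3}{2}-3j}\{x_1,x_2\}^{2j-1}$ for $j=1,\ldots,\frac{\alpha-2}{2}$; - $x_1^{d_1+d_2-d_3+j-2}x_2^{2d_3-d_1-d_2-2j+2}x_3^{d_1+d_2-d_3+2j-2},\ldots,x_2^{d_3-j}x_3^{d_1+d_2-d_3+2j-2}$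 for $j=1,\ldots,d_3-d_2$; - $x_1^{d_1-1}x_3^{d_1+d_3-d_2+2j-2}x_2^{d_2-d_1-j+1},\ldots,x_3^{d_1+d_3-d_2+2j-2}x_2^{d_2-j}$ for $j=1,\ldots,d_2-d_1$; - $\{x_1,x_2\}^{d_1-j}x_3^{d_2+d_3-d_1-2+2j}$ for $j=1,\ldots,d_1$. If $\alpha$ is odd, then $J$ is the ideal generated by - $x_1^{d_1},\ x_1^{d_1-1}x_2^{d_2-d_1+1},\ x_1^{d_1-2}x_2^{d_2-d_1+3},\ldots,\ x_1^{d_1+d_2-d_3}x_2^{2d_3-d_1-d_2-1}$ (same meaning as in the even case); - $x_1^{d_1+d_2-d_3-2j}x_2^{2d_3-d_1-d_2+3j-1}$ and $x_1^{d_1+d_2-d_3-2j+1}x_2^{2d_3-d_1-d_2+3j-2}$ for $j=1,\ldots,\frac{\alpha-1}{2}$; - $x_2^{\frac{d_1+d_2+d_3-1}{2}}$; $x_3x_2^{\frac{d_1+d_2+d_3-3}{2}}$; $x_1^{2j}x_3^{2j+1}x_2^{\frac{d_1+d_2+d_3-3}{2}-3j},\ldots,x_3^{2j+1}x_2^{\frac{d_1+d_2+d_3-3}{2}-j}$ for $j=1,\ldots,\frac{\alpha-3}{2}$; - $x_1^{d_1+d_2-d_3+j-2}x_2^{2d_3-d_1-d_2-2j+2}x_3^{d_1+d_2-d_3+2j-2},\ldots,x_2^{d_3-j}x_3^{d_1+d_2-d_3+2j-2}$ for $j=1,\ldots,d_3-d_2$; - $x_1^{d_1-1}x_3^{d_1+d_3-d_2+2j-2}x_2^{d_2-d_1-j+1},\ldots,x_3^{d_1+d_3-d_2+2j-2}x_2^{d_2-j}$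 for $j=1,\ldots,d_2-d_1$; - $\{x_1,x_2\}^{d_1-j}x_3^{d_2+d_3-d_1-2+2j}$ for $j=1,\ldots,d_1$.
   Context: $\{x_1,x_2\}^j$ denotes the set of all monomials of degree $j$ in $x_1,x_2$ (with $\{x_1,x_2\}^0=\{1\}$), and $m\{x_1,x_2\}^j$ is the set of products of the monomial $m$ with elements of it. A list $x_1^{a}x_2^{b}x_3^{c},\ldots,x_2^{a+b}x_3^{c}$ with constant $x_3$-exponent $c$ means all monomials $x_1^{a-i}x_2^{b+i}x_3^{c}$ with $0\leq i\leq a$. $S/I$ has the strong Lefschetz property (SLP) if there is a linear form $\ell\in S$ such that for all integers $b\geq 1$ and $t\geq 0$ the multiplication map $\ell^b:(S/I)_t\to(S/I)_{t+b}$ is injective or surjective. $\operatorname{Gin}(I)$ is the common initial ideal, with respect to the graded reverse lexicographic order with $x_1>x_2>x_3$, of $\alpha' I$ for all $\alpha'$ in a nonempty Zariski open subset of $GL_3(K)$ acting by linear changes of coordinates. *)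

theory Defs
  imports "HOL-Analysis.Determinants" "HOL-Library.Poly_Mapping"
begin

text \<open>
  A polynomial with coefficients in \<open>'a\<close> and variables indexed by \<open>'v\<close> is a finitely supported
  map from exponent vectors to coefficients. For \<open>S = K[x\<^sub>1, x\<^sub>2, x\<^sub>3]\<close> the variables
  are indexed by the three-element type \<open>3\<close>, whose elements are \<open>1\<close>, \<open>2\<close> and \<open>3\<close> (\<open>= 0\<close>).
\<close>

type_synonym ('v, 'a) mpol = "('v \<Rightarrow>\<^sub>0 nat) \<Rightarrow>\<^sub>0 'a"
type_synonym 'a poly3 = "(3, 'a) mpol"

definition Const :: "'a \<Rightarrow> ('v, 'a::zero) mpol" where
  "Const c = Poly_Mapping.single 0 c"

definition X :: "'v \<Rightarrow> ('v, 'a::zero_neq_one) mpol" where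
  "X i = Poly_Mapping.single (Poly_Mapping.single i 1) 1"

definition eval_mpol ::
    "('a::zero \<Rightarrow> 'b::comm_semiring_1) \<Rightarrow> ('v \<Rightarrow> 'b) \<Rightarrow> ('v, 'a) mpol \<Rightarrow> 'b" where
  "eval_mpol h s p =
     (\<Sum>m\<in>Poly_Mapping.keys p. h (Poly_Mapping.lookup p m) *
        (\<Prod>i\<in>Poly_Mapping.keys m. s i ^ Poly_Mapping.lookup m i))"

definition mdeg :: "(3 \<Rightarrow>\<^sub>0 nat) \<Rightarrow> nat" where
  "mdeg m = (\<Sum>i\<in>UNIV. Poly_Mapping.lookup m i)"

text \<open>The zero polynomial is homogeneous of every degree.\<close>

definition homogeneous :: "nat \<Rightarrow> 'a::zero poly3 \<Rightarrow> bool" where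
  "homogeneous d f \<longleftrightarrow> (\<forall>m\<in>Poly_Mapping.keys f. mdeg m = d)"

text \<open>
  The ideal generated by a subset of a commutative ring is its span in the ring regarded as a
  module over itself. The locale is deliberately not interpreted globally, because its
  simplification rules would clash with those for multiplication.
\<close>

lemma module_times: "module ((*) :: 'r::comm_ring_1 \<Rightarrow> 'r \<Rightarrow> 'r)"
  by standard (simp_all add: algebra_simps)

abbreviation ideal_gen :: "'r::comm_ring_1 set \<Rightarrow> 'r set" where
  "ideal_gen G \<equiv> module.span (*) G"

definition regular_sequence :: "'r::comm_ring_1 list \<Rightarrow> bool" where
  "regular_sequence fs \<longleftrightarrow>
     (\<forall>i<length fs. \<forall>g. fs ! i * g \<in> ideal_gen (set (take i fs)) \<longrightarrow>
        g \<in> ideal_gen (set (take i fs))) \<and>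
     ideal_gen (set fs) \<noteq> UNIV"

text \<open>
  Elements of \<open>S/I\<close> are cosets; \<open>quot_component I t\<close> is \<open>(S/I)\<^sub>t\<close> (for homogeneous \<open>I\<close>), and
  \<open>quot_mult I p\<close> sends \<open>f + I\<close> to \<open>p * f + I\<close>.
\<close>

definition coset :: "'r::comm_ring_1 set \<Rightarrow> 'r \<Rightarrow> 'r set" where
  "coset I f = {g. g - f \<in> I}"

definition quot_component :: "'a::comm_ring_1 poly3 set \<Rightarrow> nat \<Rightarrow> 'a poly3 set set" where
  "quot_component I t = coset I ` {f. homogeneous t f}"

definition quot_mult :: "'r::comm_ring_1 set \<Rightarrow> 'r \<Rightarrow> 'r set \<Rightarrow> 'r set" where
  "quot_mult I p C = (\<Union>f\<in>C. coset I (p * f))"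

definition strong_lefschetz :: "'a::comm_ring_1 poly3 set \<Rightarrow> bool" where
  "strong_lefschetz I \<longleftrightarrow>
     (\<exists>l. homogeneous 1 l \<and>
       (\<forall>b\<ge>1. \<forall>t.
          inj_on (quot_mult I (l ^ b)) (quot_component I t) \<or>
          quot_mult I (l ^ b) ` quot_component I t = quot_component I (t + b)))"

text \<open>
  The graded reverse lexicographic order with \<open>x\<^sub>1 > x\<^sub>2 > x\<^sub>3\<close>: in equal degrees, the monomial
  with the smaller exponent at the last variable where they differ is the larger one. (In equal
  degrees, monomials cannot differ in the exponent of \<open>x\<^sub>1\<close> alone.)
\<close>

definition revlex_less :: "(3 \<Rightarrow>\<^sub>0 nat) \<Rightarrow> (3 \<Rightarrow>\<^sub>0 nat) \<Rightarrow> bool" where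
  "revlex_less m n \<longleftrightarrow>
     mdeg m < mdeg n \<or>
     mdeg m = mdeg n \<and>
       (Poly_Mapping.lookup m 3 > Poly_Mapping.lookup n 3 \<or>
        Poly_Mapping.lookup m 3 = Poly_Mapping.lookup n 3 \<and>
        Poly_Mapping.lookup m 2 > Poly_Mapping.lookup n 2)"

definition is_leading_monomial :: "(3 \<Rightarrow>\<^sub>0 nat) \<Rightarrow> 'a::zero poly3 \<Rightarrow> bool" where
  "is_leading_monomial m f \<longleftrightarrow>
     m \<in> Poly_Mapping.keys f \<and> (\<forall>n\<in>Poly_Mapping.keys f. n \<noteq> m \<longrightarrow> revlex_less n m)"

definition initial_ideal :: "'a::comm_ring_1 poly3 set \<Rightarrow> 'a poly3 set" where
  "initial_ideal I =
     ideal_gen {Poly_Mapping.single m 1 | m. \<exists>f\<in>I. is_leading_monomial m f}"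

text \<open>The matrix \<open>g\<close> acts by the algebra endomorphism \<open>x\<^sub>j \<mapsto> \<Sum>\<^sub>i g\<^sub>i\<^sub>j x\<^sub>i\<close>.\<close>

definition lin_act :: "'a::comm_ring_1 ^ 3 ^ 3 \<Rightarrow> 'a poly3 \<Rightarrow> 'a poly3" where
  "lin_act g = eval_mpol Const (\<lambda>j. \<Sum>i\<in>UNIV. Const (g $ i $ j) * X i)"

text \<open>
  Zariski open subsets of \<open>GL\<^sub>3(K)\<close>: non-vanishing loci of sets of polynomials in the nine matrix
  entries. Allowing \<open>1/det\<close> as well would give the same sets.
\<close>

definition zariski_open_GL3 :: "('a::field ^ 3 ^ 3) set \<Rightarrow> bool" where
  "zariski_open_GL3 U \<longleftrightarrow>
     (\<exists>P :: (3 \<times> 3, 'a) mpol set.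
        U = {g. invertible g \<and> (\<exists>p\<in>P. eval_mpol id (\<lambda>(i, j). g $ i $ j) p \<noteq> 0)})"

definition is_gin :: "'a::field poly3 set \<Rightarrow> 'a poly3 set \<Rightarrow> bool" where
  "is_gin I J \<longleftrightarrow>
     (\<exists>U. zariski_open_GL3 U \<and> U \<noteq> {} \<and> (\<forall>g\<in>U. initial_ideal (lin_act g ` I) = J))"

text \<open>
  Over an infinite field any two nonempty Zariski open subsets of \<open>GL\<^sub>3(K)\<close> meet, so there is at
  most one such \<open>J\<close>; for homogeneous \<open>I\<close> it exists by Galligo's theorem.
\<close>

definition gin :: "'a::field poly3 set \<Rightarrow> 'a poly3 set" where
  "gin I = (THE J. is_gin I J)"

definition mono3 :: "nat \<Rightarrow> nat \<Rightarrow> nat \<Rightarrow> 'a::comm_ring_1 poly3" where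
  "mono3 a b c = X 1 ^ a * X 2 ^ b * X 3 ^ c"

text \<open>The list \<open>x\<^sub>1\<^sup>a x\<^sub>2\<^sup>b x\<^sub>3\<^sup>c, \<dots>, x\<^sub>2\<^sup>a\<^sup>+\<^sup>b x\<^sub>3\<^sup>c\<close> with constant \<open>x\<^sub>3\<close>-exponent.\<close>

definition mono_list :: "nat \<Rightarrow> nat \<Rightarrow> nat \<Rightarrow> 'a::comm_ring_1 poly3 set" where
  "mono_list a b c = {mono3 (a - i) (b + i) c | i. i \<le> a}"

text \<open>\<open>m {x\<^sub>1, x\<^sub>2}\<^sup>j\<close>: the products of \<open>m\<close> with the monomials of degree \<open>j\<close> in \<open>x\<^sub>1, x\<^sub>2\<close>.\<close>

definition mono12_times :: "'a::comm_ring_1 poly3 \<Rightarrow> nat \<Rightarrow> 'a poly3 set" where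
  "mono12_times m j = {m * mono3 a b 0 | a b. a + b = j}"

end

theory Submission
  imports Defs "HOL-Computational_Algebra.Polynomial"
begin

text \<open>
  Let \<open>A = g I\<close> for a general \<open>g\<close>, let \<open>\<sigma> = d\<^sub>1 + d\<^sub>2 + d\<^sub>3 - 3\<close> be the socle degree of \<open>S/I\<close>, and let
  \<open>e t = max 0 (h\<^sub>t - h\<^sub>t\<^sub>-\<^sub>1)\<close> for the (symmetric, unimodal) Hilbert function \<open>h\<close> of the complete
  intersection. By the strong Lefschetz property \<open>x\<^sub>3\<close> induces bijections from degree \<open>s\<close> to degree
  \<open>\<sigma> - s\<close> of \<open>S/A\<close>, so a monomial \<open>x\<^sub>1\<^sup>a x\<^sub>2\<^sup>b x\<^sub>3\<^sup>c\<close> is initial if and only if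
  \<open>x\<^sub>1\<^sup>a x\<^sub>2\<^sup>b\<close> is, or \<open>c > \<sigma> - 2 (a + b)\<close>. Modulo \<open>x\<^sub>3\<close> one is left with a space of binary forms of
  degree \<open>t\<close> and codimension \<open>e t\<close>, no nonzero element of which is divisible by the power \<open>t + 1 - e t\<close> of a general linear form
  (a Wronskian argument in characteristic zero); hence its initial monomials are those with \<open>a \<ge> e t\<close>.
  The listed generators are the minimal monomials satisfying one of the two conditions.
\<close>

subsection \<open>Dimensions of subspaces\<close>

text \<open>The Lefschetz form is given in unknown position, whereas a generic initial ideal
  requires an open condition on \<open>g\<close> under which the answer is constant. One good
  \<open>g1\<close> is therefore built explicitly: a substitution carrying the Lefschetz form to
  \<open>X 3\<close>, followed by a shear that moves only \<open>X 2\<close> and so keeps the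
  Lefschetz condition. Each property used at \<open>g1\<close> is put into the single shape
  \<open>separated\<close>, which amounts to linear independence of a fixed finite family of vectors
  depending polynomially on \<open>g\<close>. Hence the same computation works on a nonempty open
  set. Powers of a linear form enter for this reason: a binary form of degree \<open>t\<close> whose
  leading monomial has x1-exponent below \<open>e t\<close> has only terms of x2-exponent at least
  \<open>t + 1 - e t\<close>, so it is divisible by that power of x2. Once such forms are excluded,
  exactly \<open>t + 1 - e t\<close> monomials are left, as many as the dimension of the space. The
  shear makes x2 general enough for the exclusion.\<close>

lemma (in vector_space) dim_insert_notin_span:
  assumes "a \<notin> span S" "S \<subseteq> span F" "finite F"
  shows "dim (insert a S) = Suc (dim S)"
proof -
  obtain B where B: "B \<subseteq> S" "independent B" "S \<subseteq> span B"
    using maximal_independent_subset by blast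
  have fin: "finite B"
    using independent_span_bound[OF assms(3) B(2)] B(1) assms(2) by blast
  have sp: "span B = span S"
    using B span_mono span_minimal subspace_span by (metis subset_antisym)
  have ind: "independent (insert a B)"
    using B(2) assms(1) sp by (simp add: independent_insertI)
  have "span (insert a B) = span (insert a S)"
    using sp by (metis (no_types) span_Un span_insert sup_commute insert_is_Un)
  then have "dim (insert a S) = card (insert a B)"
    using dim_eq_card[OF _ ind] by simp
  also have "\<dots> = Suc (card B)"
    using fin assms(1) sp B(1) span_base by (metis card_insert_disjoint)
  also have "card B = dim S"
    using B basis_card_eq_dim by blast
  finally show ?thesis .
qed

text \<open>The polynomial ring is infinite-dimensional, so finiteness always enters through an
  explicit finite set \<open>F\<close> whose span contains the subspace at hand.\<close>

lemma (in vector_space) finite_basis: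
  assumes "V \<subseteq> span F" "finite F"
  obtains B where "B \<subseteq> V" "finite B" "independent B" "V \<subseteq> span B" "card B = dim V"
proof -
  obtain B where B: "B \<subseteq> V" "independent B" "V \<subseteq> span B" "card B = dim V"
    using basis_exists by blast
  moreover have "finite B"
    using independent_span_bound[OF assms(2) B(2)] B(1) assms(1) by blast
  ultimately show thesis using that by blast
qed

lemma (in vector_space) finite_basis_extend:
  assumes "V \<subseteq> span F" "finite F" "K \<subseteq> V" "subspace K" "subspace V"
  obtains B C where "finite B" "finite C" "B \<inter> C = {}" "independent (B \<union> C)"
    "span B = K" "span (B \<union> C) = V" "card B = dim K" "card C = dim V - dim K" "dim K \<le> dim V"
proof -
  obtain B where B: "B \<subseteq> K" "finite B" "independent B" "K \<subseteq> span B" "card B = dim K"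
    using finite_basis[of K F] assms by blast
  obtain B' where B': "B \<subseteq> B'" "B' \<subseteq> V" "independent B'" "V \<subseteq> span B'"
    using maximal_independent_subset_extend[of B V] B assms by blast
  have fin: "finite B'"
    using independent_span_bound[OF assms(2) B'(3)] B'(2) assms(1) by blast
  have *: "card B' = dim V" using B' basis_card_eq_dim by blast
  show thesis
  proof (rule that[of B "B' - B"])
    show "span B = K" using B assms(4) span_minimal by blast
    have sV: "span B' = V"
      by (rule subset_antisym[OF span_minimal[OF B'(2) assms(5)] B'(4)])
    have eq: "B \<union> (B' - B) = B'" using B' by blast
    show "span (B \<union> (B' - B)) = V" "independent (B \<union> (B' - B))"
      unfolding eq by (fact sV, fact B'(3))
    show "card (B' - B) = dim V - dim K"
      using fin B'(1) B(2,5) * by (simp add: card_Diff_subset)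
    show "dim K \<le> dim V" using fin B'(1) B(5) * by (metis card_mono)
  qed (use B fin in auto)
qed

lemma (in vector_space) subspace_eq_of_dim_eq:
  assumes "A \<subseteq> V" "V \<subseteq> span F" "finite F" "subspace A" "subspace V" "dim V \<le> dim A"
  shows "A = V"
proof -
  obtain B C where BC: "finite B" "finite C" "span B = A" "span (B \<union> C) = V" "card C = dim V - dim A"
    using finite_basis_extend[of V F A] assms by metis
  then have "C = {}" using assms by simp
  then show ?thesis using BC by simp
qed

text \<open>Rank-nullity for the map from \<open>V\<close> to the ambient space modulo
  \<open>B\<close>, with the quotient avoided: the image is replaced by its preimage, the sum of
  \<open>T\<close> applied to \<open>V\<close> with \<open>B\<close>.\<close>

lemma (in vector_space) dim_linear_image_sum:
  assumes T: "module_hom scale scale T" and V: "subspace V" "V \<subseteq> span F" "finite F"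
    and B: "subspace B" "B \<subseteq> span G" "finite G"
  shows "dim {T v + b |v b. v \<in> V \<and> b \<in> B} + dim {v \<in> V. T v \<in> B} = dim V + dim B"
proof -
  interpret T: module_hom scale scale T by fact
  have spB: "span B = B" using B(1) by (simp add: span_eq_iff)
  let ?K = "{v \<in> V. T v \<in> B}"
  have subK: "subspace ?K"
    using V(1) B(1) by (auto simp: subspace_def T.add T.scale T.zero)
  obtain C0 C1 where C: "finite C0" "finite C1" "C0 \<inter> C1 = {}" "independent (C0 \<union> C1)"
    "span C0 = ?K" "span (C0 \<union> C1) = V" "card C0 = dim ?K" "card C1 = dim V - dim ?K"
    "dim ?K \<le> dim V"
    using finite_basis_extend[OF V(2,3) _ subK V(1)] by blast
  \<comment> \<open>Vectors of \<open>C1\<close> are added one at a time. If an image were already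
    in the span, some \<open>c - y\<close> with \<open>y\<close> in the span of the earlier vectors
    would lie in the kernel, against independence of \<open>C0 \<union> C1\<close>.\<close>
  have *: "dim (T ` C \<union> B) = card C + dim B" if "C \<subseteq> C1" for C
    using finite_subset[OF that C(2)] that
  proof (induction C rule: finite_induct)
    case (insert c C)
    have nin: "T c \<notin> span (T ` C \<union> B)"
    proof
      assume "T c \<in> span (T ` C \<union> B)"
      then obtain x b where xb: "T c = x + b" "x \<in> span (T ` C)" "b \<in> B"
        unfolding span_Un spB by blast
      then obtain y where y: "y \<in> span C" "x = T y" 
        using T.span_image by (metis imageE)
      have "C \<subseteq> V" using insert.prems C(6) span_superset by blast
      then have "y \<in> V" using y V(1) span_minimal by blast
      have "c \<in> V" using insert.prems C(6) span_superset by blast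
      have "T (c - y) \<in> B" using xb y by (simp add: T.diff)
      then have "c - y \<in> span C0"
        using C(5) \<open>y \<in> V\<close> \<open>c \<in> V\<close> V(1) subspace_diff by auto
      then have "c - y \<in> span (C0 \<union> C)" "y \<in> span (C0 \<union> C)"
        using y(1) span_mono by blast+
      then have "c \<in> span (C0 \<union> C)" using span_add by fastforce
      moreover have "C0 \<union> C \<subseteq> (C0 \<union> C1) - {c}"
        using insert C(3) by blast
      ultimately have "c \<in> span ((C0 \<union> C1) - {c})" using span_mono by blast
      then show False using C(4) insert.prems by (auto simp: dependent_def)
    qed
    have "T ` C \<union> B \<subseteq> span (T ` C \<union> G)"
      using B(2) span_mono[of G "T ` C \<union> G"] span_superset[of "T ` C \<union> G"] by blast
    then have "dim (insert (T c) (T ` C \<union> B)) = Suc (dim (T ` C \<union> B))"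
      using dim_insert_notin_span[OF nin] insert.hyps(1) B(3) by blast
    then show ?case using insert by simp
  qed simp
  have "span (T ` C1 \<union> B) = {T v + b |v b. v \<in> V \<and> b \<in> B}" (is "_ = ?R")
  proof
    have sub: "span C1 \<subseteq> V" using C(6) span_mono by blast
    show "span (T ` C1 \<union> B) \<subseteq> ?R"
    proof
      fix z assume "z \<in> span (T ` C1 \<union> B)"
      then obtain x b where "z = x + b" "x \<in> T ` span C1" "b \<in> B"
        unfolding span_Un T.span_image spB by blast
      then show "z \<in> ?R" using sub by blast
    qed
    show "?R \<subseteq> span (T ` C1 \<union> B)"
    proof
      fix z assume "z \<in> ?R"
      then obtain v b where vb: "z = T v + b" "v \<in> V" "b \<in> B" by blast
      have "V = {x + y |x y. x \<in> span C0 \<and> y \<in> span C1}"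
        using span_Un[of C0 C1] by (simp only: C(6))
      then obtain x y where xy: "v = x + y" "x \<in> span C0" "y \<in> span C1"
        using vb(2) by blast
      have Tx: "T x \<in> B" using xy(2) unfolding C(5) by simp
      have "z = T y + (T x + b)" "T y \<in> span (T ` C1)" "T x + b \<in> B"
        using vb xy subspace_add[OF B(1) Tx] by (simp_all add: T.add T.span_image)
      moreover have "T y \<in> span (T ` C1 \<union> B)"
        using \<open>T y \<in> span (T ` C1)\<close> span_mono[of "T ` C1" "T ` C1 \<union> B"] by blast
      ultimately show "z \<in> span (T ` C1 \<union> B)"
        using span_add[of "T y" _ "T x + b"] span_base[of "T x + b" "T ` C1 \<union> B"] by simp
    qed
  qed
  then have "dim ?R = card C1 + dim B" using *[of C1] by (metis dim_span order_refl)
  then show ?thesis using C(8,9) by simp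
qed

subsection \<open>Polynomials and forms in three variables\<close>

lemma poly_mapping_sum_single: "p = (\<Sum>m\<in>Poly_Mapping.keys p. Poly_Mapping.single m (Poly_Mapping.lookup p m))"
  by (rule poly_mapping_eqI)
    (auto simp: lookup_sum lookup_single when_def in_keys_iff intro!: sum.neutral)

lemma mpol_induct [case_names single add]:
  fixes p :: "'m \<Rightarrow>\<^sub>0 'a::comm_monoid_add"
  assumes "\<And>m c. P (Poly_Mapping.single m c)" "\<And>p q. P p \<Longrightarrow> P q \<Longrightarrow> P (p + q)"
  shows "P p"
proof -
  have *: "P (\<Sum>m\<in>M. Poly_Mapping.single m (Poly_Mapping.lookup p m))" if "finite M" for M
    using that
  proof induction
    case empty
    then show ?case using assms(1)[of undefined 0] by simp
  qed (simp add: assms)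
  show ?thesis
    by (subst poly_mapping_sum_single[of p]) (rule *, simp)
qed

lemma lookup_Const_mult: "Poly_Mapping.lookup (Const c * p) m = c * Poly_Mapping.lookup p m"
  for p :: "('v, 'a::comm_ring_1) mpol"
proof (induction p rule: mpol_induct)
  case (single k d)
  then show ?case by (simp add: Const_def mult_single lookup_single when_def)
qed (simp add: distrib_left lookup_add)

lemma Const_hom [simp]: "Const 0 = 0" "Const 1 = 1" "Const (a + b) = Const a + Const b"
    "Const (a * b) = Const a * Const b"
  for a :: "'a::comm_ring_1"
  by (simp_all add: Const_def single_add mult_single)

section \<open>Evaluation of polynomials\<close>

definition mon_eval :: "('v \<Rightarrow> 'b::comm_semiring_1) \<Rightarrow> ('v \<Rightarrow>\<^sub>0 nat) \<Rightarrow> 'b" where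
  "mon_eval s m = (\<Prod>i\<in>Poly_Mapping.keys m. s i ^ Poly_Mapping.lookup m i)"

lemma mon_eval_superset:
  assumes "finite A" "Poly_Mapping.keys m \<subseteq> A"
  shows "mon_eval s m = (\<Prod>i\<in>A. s i ^ Poly_Mapping.lookup m i)"
  unfolding mon_eval_def using assms
  by (intro prod.mono_neutral_left) (auto simp: in_keys_iff)

lemma mon_eval_add: "mon_eval s (m + n) = mon_eval s m * mon_eval s n"
proof -
  let ?A = "Poly_Mapping.keys m \<union> Poly_Mapping.keys n"
  have "Poly_Mapping.keys (m + n) \<subseteq> ?A" by (rule Poly_Mapping.keys_add)
  then show ?thesis
    by (simp add: mon_eval_superset[of ?A] lookup_add power_add prod.distrib)
qed

lemma mon_eval_zero [simp]: "mon_eval s 0 = 1"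
  by (simp add: mon_eval_def)

lemma mon_eval_single: "mon_eval s (Poly_Mapping.single i k) = s i ^ k"
  by (simp add: mon_eval_superset[of "{i}"])

text \<open>Three instances are used: \<open>Const\<close> for substitution of polynomials,
  \<open>id\<close> for evaluation at matrix entries, and constant univariate polynomials for
  restriction to a line and for dehomogenization.\<close>

locale coeff_hom =
  fixes h :: "'a::comm_ring_1 \<Rightarrow> 'b::comm_ring_1"
  assumes h_add: "h (a + b) = h a + h b" and h_mult: "h (a * b) = h a * h b"
    and h_zero: "h 0 = 0" and h_one: "h 1 = 1"
begin

lemma eval_mpol_superset:
  assumes "finite M" "Poly_Mapping.keys p \<subseteq> M"
  shows "eval_mpol h s p = (\<Sum>m\<in>M. h (Poly_Mapping.lookup p m) * mon_eval s m)"
  unfolding eval_mpol_def mon_eval_def[symmetric] using assms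
  by (intro sum.mono_neutral_left) (auto simp: in_keys_iff h_zero)

lemma eval_mpol_zero [simp]: "eval_mpol h s 0 = 0"
  by (simp add: eval_mpol_def)

lemma eval_mpol_add: "eval_mpol h s (p + q) = eval_mpol h s p + eval_mpol h s q"
proof -
  let ?A = "Poly_Mapping.keys p \<union> Poly_Mapping.keys q"
  have "Poly_Mapping.keys (p + q) \<subseteq> ?A" by (rule Poly_Mapping.keys_add)
  then show ?thesis
    by (simp add: eval_mpol_superset[of ?A] lookup_add h_add sum.distrib distrib_right)
qed

lemma eval_mpol_single: "eval_mpol h s (Poly_Mapping.single m c) = h c * mon_eval s m"
  by (simp add: eval_mpol_superset[of "{m}"])

lemma eval_mpol_mult: "eval_mpol h s (p * q) = eval_mpol h s p * eval_mpol h s q"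
proof (induction p rule: mpol_induct)
  case (single m c)
  then show ?case
  proof (induction q rule: mpol_induct)
    case (single n d)
    then show ?case by (simp add: mult_single eval_mpol_single h_mult mon_eval_add mult_ac)
  qed (simp add: distrib_left eval_mpol_add)
qed (simp add: distrib_right eval_mpol_add)

lemma eval_mpol_Const [simp]: "eval_mpol h s (Const c) = h c"
  by (simp add: Const_def eval_mpol_single)

lemma eval_mpol_X [simp]: "eval_mpol h s (X i) = s i"
  by (simp add: X_def eval_mpol_single h_one mon_eval_single)

lemma eval_mpol_one [simp]: "eval_mpol h s 1 = 1"
  using eval_mpol_Const[of s 1] by (simp add: h_one)

lemma eval_mpol_uminus: "eval_mpol h s (- p) = - eval_mpol h s p"
  using eval_mpol_add[of s p "- p"] by (simp add: eq_neg_iff_add_eq_0 add.commute)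

lemma eval_mpol_diff: "eval_mpol h s (p - q) = eval_mpol h s p - eval_mpol h s q"
  using eval_mpol_add[of s p "- q"] by (simp add: eval_mpol_uminus)

lemma eval_mpol_sum: "eval_mpol h s (sum f A) = (\<Sum>i\<in>A. eval_mpol h s (f i))"
  by (induction A rule: infinite_finite_induct) (simp_all add: eval_mpol_add)

lemma eval_mpol_power: "eval_mpol h s (p ^ n) = eval_mpol h s p ^ n"
  by (induction n) (simp_all add: eval_mpol_mult)

end

section \<open>Polynomials as a vector space\<close>

definition smul :: "'a::comm_ring_1 \<Rightarrow> ('v, 'a) mpol \<Rightarrow> ('v, 'a) mpol" where
  "smul c p = Const c * p"

interpretation mp: vector_space "smul :: 'a::field \<Rightarrow> ('v, 'a) mpol \<Rightarrow> ('v, 'a) mpol"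
  by standard (simp_all add: smul_def algebra_simps)

lemma lookup_smul [simp]: "Poly_Mapping.lookup (smul c p) m = c * Poly_Mapping.lookup p m"
  by (simp add: smul_def lookup_Const_mult)

definition supported :: "('v \<Rightarrow>\<^sub>0 nat) set \<Rightarrow> ('v, 'a::zero) mpol set" where
  "supported M = {p. Poly_Mapping.keys p \<subseteq> M}"

lemma supported_iff: "p \<in> supported M \<longleftrightarrow> (\<forall>m. m \<notin> M \<longrightarrow> Poly_Mapping.lookup p m = 0)"
  by (auto simp: supported_def in_keys_iff)

lemma subspace_supported [simp]: "mp.subspace (supported M :: ('v, 'a::field) mpol set)"
  by (auto simp: mp.subspace_def supported_iff lookup_add)

lemma single_mult_eq_smul: "Poly_Mapping.single m c = smul c (Poly_Mapping.single m 1)"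
  by (simp add: smul_def Const_def mult_single)

lemma supported_eq_span:
  fixes M :: "('v \<Rightarrow>\<^sub>0 nat) set"
  shows "(supported M :: ('v, 'a::field) mpol set) = mp.span ((\<lambda>m. Poly_Mapping.single m 1) ` M)"
proof
  show "supported M \<subseteq> mp.span ((\<lambda>m. Poly_Mapping.single m (1::'a)) ` M)"
  proof
    fix p :: "('v, 'a) mpol" assume "p \<in> supported M"
    then have "(\<Sum>m\<in>Poly_Mapping.keys p. smul (Poly_Mapping.lookup p m) (Poly_Mapping.single m 1))
        \<in> mp.span ((\<lambda>m. Poly_Mapping.single m 1) ` M)"
      by (intro mp.span_sum mp.span_scale mp.span_base) (auto simp: supported_def)
    then show "p \<in> mp.span ((\<lambda>m. Poly_Mapping.single m 1) ` M)"
      unfolding single_mult_eq_smul[symmetric] poly_mapping_sum_single[symmetric] .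
  qed
  show "mp.span ((\<lambda>m. Poly_Mapping.single m (1::'a)) ` M) \<subseteq> supported M"
    by (rule mp.span_minimal[OF _ subspace_supported]) (auto simp: supported_def)
qed

lemma dim_supported:
  assumes "finite M"
  shows "mp.dim (supported M :: ('v, 'a::field) mpol set) = card M"
proof -
  let ?f = "\<lambda>m. Poly_Mapping.single m (1::'a)"
  have inj: "inj_on ?f M"
    by (auto simp: inj_on_def) (metis keys_single singleton_inject zero_neq_one)
  have "mp.independent (?f ` M)"
    unfolding mp.dependent_def
  proof safe
    fix m assume m: "m \<in> M" "?f m \<in> mp.span (?f ` M - {?f m})"
    moreover have "?f ` M - {?f m} \<subseteq> ?f ` (M - {m})" by auto
    ultimately have "?f m \<in> mp.span (?f ` (M - {m}))" using mp.span_mono by blast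
    then have "?f m \<in> supported (M - {m})" by (simp add: supported_eq_span)
    then show False by (auto simp: supported_def)
  qed
  then show ?thesis
    using inj by (simp add: supported_eq_span mp.dim_eq_card_independent card_image)
qed

section \<open>Monomials, forms and homogeneous components\<close>

definition mon :: "nat \<Rightarrow> nat \<Rightarrow> nat \<Rightarrow> (3 \<Rightarrow>\<^sub>0 nat)" where
  "mon a b c = Poly_Mapping.single 1 a + Poly_Mapping.single 2 b + Poly_Mapping.single 3 c"

lemma three_distinct [simp]: "(1::3) \<noteq> 2" "(2::3) \<noteq> 1" "(1::3) \<noteq> 3" "(3::3) \<noteq> 1" "(2::3) \<noteq> 3" "(3::3) \<noteq> 2"
  by simp_all

lemma lookup_mon [simp]:
  "Poly_Mapping.lookup (mon a b c) 1 = a"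
  "Poly_Mapping.lookup (mon a b c) 2 = b"
  "Poly_Mapping.lookup (mon a b c) 3 = c"
  by (simp_all add: mon_def lookup_add lookup_single when_def)

lemma mon_eq_iff: "m = n \<longleftrightarrow> Poly_Mapping.lookup m 1 = Poly_Mapping.lookup n 1 \<and>
    Poly_Mapping.lookup m 2 = Poly_Mapping.lookup n 2 \<and> Poly_Mapping.lookup m 3 = Poly_Mapping.lookup n 3"
  for m n :: "3 \<Rightarrow>\<^sub>0 nat"
proof safe
  assume *: "Poly_Mapping.lookup m 1 = Poly_Mapping.lookup n 1"
    "Poly_Mapping.lookup m 2 = Poly_Mapping.lookup n 2" "Poly_Mapping.lookup m 3 = Poly_Mapping.lookup n 3"
  have "Poly_Mapping.lookup m i = Poly_Mapping.lookup n i" for i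
    using exhaust_3[of i] * by fastforce
  then show "m = n" by (rule poly_mapping_eqI)
qed

lemma mon_cases: obtains a b c where "m = mon a b c"
  using that[of "Poly_Mapping.lookup m 1" "Poly_Mapping.lookup m 2" "Poly_Mapping.lookup m 3"]
  by (simp add: mon_eq_iff)

lemma mon_inject [simp]: "mon a b c = mon a' b' c' \<longleftrightarrow> a = a' \<and> b = b' \<and> c = c'"
  by (simp add: mon_eq_iff)

lemma mon_add: "mon a b c + mon a' b' c' = mon (a + a') (b + b') (c + c')"
  by (simp add: mon_eq_iff lookup_add)

lemma mdeg_mon [simp]: "mdeg (mon a b c) = a + b + c"
  by (simp add: mdeg_def sum_3)

lemma mdeg_add: "mdeg (m + n) = mdeg m + mdeg n"
  by (simp add: mdeg_def lookup_add sum.distrib)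

lemma mon_zero: "mon 0 0 0 = 0"
  by (simp add: mon_eq_iff)

lemma X_power: "X i ^ n = Poly_Mapping.single (Poly_Mapping.single i n) (1::'a::comm_ring_1)"
  by (induction n) (simp_all add: X_def mult_single flip: single_add)

lemma mono3_eq: "mono3 a b c = Poly_Mapping.single (mon a b c) 1"
  by (simp add: mono3_def X_power mult_single mon_def)

lemma X3_power_eq: "X 3 ^ n = Poly_Mapping.single (mon 0 0 n) (1::'a::comm_ring_1)"
  by (simp add: X_power mon_def)

lemma mon_eval_mon: "mon_eval s (mon a b c) = s 1 ^ a * s 2 ^ b * s 3 ^ c"
  by (simp add: mon_def mon_eval_add mon_eval_single)

lemma mons_of_degree: "{m. mdeg m = n} = (\<lambda>(a, b). mon a b (n - a - b)) ` (SIGMA a:{..n}. {..n - a})"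
proof -
  have "m \<in> (\<lambda>(a, b). mon a b (n - a - b)) ` (SIGMA a:{..n}. {..n - a})" if "mdeg m = n" for m
    using that by (cases m rule: mon_cases) (force simp: image_iff)
  then show ?thesis by force
qed

lemma finite_mons_of_degree [simp]: "finite {m. mdeg m = n}"
  unfolding mons_of_degree by blast

lemma card_mons_of_degree: "card {m. mdeg m = n} = (\<Sum>a\<le>n. Suc a)"
proof -
  have "card {m. mdeg m = n} = card (SIGMA a:{..n}. {..n - a})"
    unfolding mons_of_degree by (rule card_image) (auto simp: inj_on_def)
  also have "\<dots> = (\<Sum>a\<le>n. Suc (n - a))" by simp
  also have "\<dots> = (\<Sum>a\<le>n. Suc a)"
    by (rule sum.reindex_bij_witness[of _ "\<lambda>a. n - a" "\<lambda>a. n - a"]) auto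
  finally show ?thesis .
qed

definition forms :: "nat \<Rightarrow> 'a::zero poly3 set" where
  "forms n = {p. homogeneous n p}"

lemma forms_eq_supported: "forms n = supported {m. mdeg m = n}"
  by (auto simp: forms_def homogeneous_def supported_def)

lemma forms_iff: "p \<in> forms n \<longleftrightarrow> (\<forall>m. mdeg m \<noteq> n \<longrightarrow> Poly_Mapping.lookup p m = 0)"
  by (simp add: forms_eq_supported supported_iff)

lemma subspace_forms [simp]: "mp.subspace (forms n :: 'a::field poly3 set)"
  by (simp add: forms_eq_supported)

lemma dim_forms: "mp.dim (forms n :: 'a::field poly3 set) = (\<Sum>a\<le>n. Suc a)"
  by (simp add: forms_eq_supported dim_supported card_mons_of_degree)

lemma forms_zero [simp]: "0 \<in> forms n" 
  by (simp add: forms_iff)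

lemma forms_add: "p \<in> forms n \<Longrightarrow> q \<in> forms n \<Longrightarrow> p + q \<in> forms n"
  for p q :: "'a::comm_ring_1 poly3"
  by (simp add: forms_iff lookup_add)

lemma forms_diff: "p \<in> forms n \<Longrightarrow> q \<in> forms n \<Longrightarrow> p - q \<in> forms n"
  for p q :: "'a::comm_ring_1 poly3"
  by (simp add: forms_iff lookup_minus)

lemma forms_sum: "(\<And>i. i \<in> A \<Longrightarrow> f i \<in> forms n) \<Longrightarrow> sum f A \<in> forms n"
  for f :: "'i \<Rightarrow> 'a::comm_ring_1 poly3"
  by (induction A rule: infinite_finite_induct) (auto intro: forms_add)

lemma forms_mult:
  fixes p q :: "'a::comm_ring_1 poly3"
  assumes "p \<in> forms m" "q \<in> forms n"
  shows "p * q \<in> forms (m + n)"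
  using assms keys_mult[of p q] by (fastforce simp: forms_def homogeneous_def mdeg_add)

lemma forms_smul: "p \<in> forms n \<Longrightarrow> smul c p \<in> forms n"
  by (simp add: forms_iff)

lemma forms_single [simp]: "Poly_Mapping.single m c \<in> forms (mdeg m)"
  by (simp add: forms_iff lookup_single when_def)

lemma forms_one: "(1::'a::comm_ring_1 poly3) \<in> forms 0"
  using forms_single[of 0 "1::'a"] by (simp add: mdeg_def)

lemma forms_power: "p \<in> forms d \<Longrightarrow> p ^ k \<in> forms (k * d)"
  for p :: "'a::comm_ring_1 poly3"
  by (induction k) (auto simp: forms_one intro: forms_mult)

lemma X_in_forms [simp]: "X i \<in> forms 1"
proof -
  have "mdeg (Poly_Mapping.single i 1) = 1"
    using exhaust_3[of i] by (auto simp: mdeg_def sum_3 lookup_single)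
  then show ?thesis by (simp add: X_def forms_iff lookup_single when_def)
qed

definition hcomp :: "nat \<Rightarrow> 'a::comm_ring_1 poly3 \<Rightarrow> 'a poly3" where
  "hcomp n p = (\<Sum>m\<in>{m \<in> Poly_Mapping.keys p. mdeg m = n}. Poly_Mapping.single m (Poly_Mapping.lookup p m))"

lemma lookup_hcomp: "Poly_Mapping.lookup (hcomp n p) m = (if mdeg m = n then Poly_Mapping.lookup p m else 0)"
  by (auto simp: hcomp_def lookup_sum lookup_single when_def in_keys_iff intro!: sum.neutral)

lemma hcomp_in_forms [simp]: "hcomp n p \<in> forms n"
  by (simp add: forms_iff lookup_hcomp)

lemma hcomp_add: "hcomp n (p + q) = hcomp n p + hcomp n q"
  by (rule poly_mapping_eqI) (simp add: lookup_hcomp lookup_add)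

lemma hcomp_forms: "p \<in> forms k \<Longrightarrow> hcomp n p = (if k = n then p else 0)"
  by (rule poly_mapping_eqI) (auto simp: lookup_hcomp forms_iff)

lemma hcomp_mult:
  fixes f p :: "'a::comm_ring_1 poly3"
  assumes "f \<in> forms d"
  shows "hcomp n (f * p) = (if d \<le> n then f * hcomp (n - d) p else 0)"
proof (induction p rule: mpol_induct)
  case (single m c)
  have "f * Poly_Mapping.single m c \<in> forms (d + mdeg m)"
    using assms by (simp add: forms_mult)
  then have "hcomp n (f * Poly_Mapping.single m c) = (if d + mdeg m = n then f * Poly_Mapping.single m c else 0)"
    by (rule hcomp_forms)
  moreover have "hcomp (n - d) (Poly_Mapping.single m c) = (if mdeg m = n - d then Poly_Mapping.single m c else 0)"
    by (rule hcomp_forms) simp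
  ultimately show ?case by auto
qed (simp add: distrib_left hcomp_add)

subsection \<open>Ideals and Hilbert functions\<close>

definition ideal :: "'r::comm_ring_1 set \<Rightarrow> bool" where
  "ideal I \<longleftrightarrow> 0 \<in> I \<and> (\<forall>x\<in>I. \<forall>y\<in>I. x + y \<in> I) \<and> (\<forall>a. \<forall>x\<in>I. a * x \<in> I)"

lemma ideal_eq_subspace: "ideal I = module.subspace (*) I"
  by (auto simp: ideal_def module.subspace_def[OF module_times])

lemma ideal_zero: "ideal I \<Longrightarrow> 0 \<in> I"
  and ideal_add: "ideal I \<Longrightarrow> x \<in> I \<Longrightarrow> y \<in> I \<Longrightarrow> x + y \<in> I"
  and ideal_mult: "ideal I \<Longrightarrow> x \<in> I \<Longrightarrow> a * x \<in> I"
  by (auto simp: ideal_def)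

lemma ideal_uminus: "ideal I \<Longrightarrow> x \<in> I \<Longrightarrow> - x \<in> I"
  using ideal_mult[of I x "-1"] by simp

lemma ideal_diff: "ideal I \<Longrightarrow> x \<in> I \<Longrightarrow> y \<in> I \<Longrightarrow> x - y \<in> I"
  using ideal_add[of I x "- y"] ideal_uminus by fastforce

lemma ideal_ideal_gen [simp]: "ideal (ideal_gen G)"
  by (simp add: ideal_eq_subspace module.subspace_span[OF module_times])

lemma ideal_gen_superset: "x \<in> G \<Longrightarrow> x \<in> ideal_gen G"
  by (rule module.span_base[OF module_times])

lemma ideal_gen_minimal: "ideal I \<Longrightarrow> G \<subseteq> I \<Longrightarrow> ideal_gen G \<subseteq> I"
  by (simp add: ideal_eq_subspace module.span_minimal[OF module_times])

lemma ideal_gen_insert: "x \<in> ideal_gen (insert f G) \<longleftrightarrow> (\<exists>a. x - a * f \<in> ideal_gen G)"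
  by (simp add: module.span_insert[OF module_times])

lemma ideal_gen_empty: "ideal_gen {} = {0}"
  by (rule module.span_empty[OF module_times])

definition homogeneous_ideal :: "'a::comm_ring_1 poly3 set \<Rightarrow> bool" where
  "homogeneous_ideal I \<longleftrightarrow> ideal I \<and> (\<forall>p\<in>I. \<forall>n. hcomp n p \<in> I)"

lemma ideal_smul: "ideal I \<Longrightarrow> x \<in> I \<Longrightarrow> smul c x \<in> I"
  by (simp add: smul_def ideal_mult)

lemma subspace_ideal: "ideal I \<Longrightarrow> mp.subspace (I :: ('v, 'a::field) mpol set)"
  by (auto simp: mp.subspace_def intro: ideal_zero ideal_add ideal_smul)

lemma subspace_ideal_forms: "ideal I \<Longrightarrow> mp.subspace (I \<inter> forms n :: 'a::field poly3 set)"
  by (intro mp.subspace_inter subspace_ideal subspace_forms)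

definition monomials :: "nat \<Rightarrow> 'a::comm_ring_1 poly3 set" where
  "monomials n = (\<lambda>m. Poly_Mapping.single m 1) ` {m. mdeg m = n}"

lemma finite_monomials [simp]: "finite (monomials n)"
  by (simp add: monomials_def)

lemma forms_subset_span: "A \<subseteq> forms n \<Longrightarrow> A \<subseteq> mp.span (monomials n :: 'a::field poly3 set)"
  by (simp add: forms_eq_supported supported_eq_span monomials_def)

lemma module_hom_mult: "module_hom smul smul ((*) (f :: ('v, 'a::field) mpol))"
  by (simp add: module_hom_def mp.module_axioms module_hom_axioms_def smul_def algebra_simps)

text \<open>Integer arguments, with value 0 in negative degrees, let the shift by a generator degree
  and the reflection about the socle degree be written without side conditions.\<close>

definition hilbert :: "'a::field poly3 set \<Rightarrow> int \<Rightarrow> int" where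
  "hilbert I n = (if n < 0 then 0 else int (mp.dim (forms (nat n) :: 'a poly3 set)) - int (mp.dim (I \<inter> forms (nat n))))"

lemma dim_mult_forms:
  fixes f :: "'a::field poly3"
  assumes "ideal I" "f \<in> forms d"
  shows "mp.dim {f * v + b |v b. v \<in> forms n \<and> b \<in> I \<inter> forms (d + n)} + mp.dim {v \<in> forms n. f * v \<in> I}
    = mp.dim (forms n :: 'a poly3 set) + mp.dim (I \<inter> forms (d + n))"
proof -
  have "{v \<in> forms n. f * v \<in> I \<inter> forms (d + n)} = {v \<in> forms n. f * v \<in> I}"
    using assms(2) forms_mult by blast
  then show ?thesis
    using mp.dim_linear_image_sum[of "(*) f" "forms n" "monomials n" "I \<inter> forms (d + n)" "monomials (d + n)"]
    by (simp add: module_hom_mult forms_subset_span subspace_ideal_forms[OF assms(1)])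
qed

text \<open>Additivity of dimension along the exact sequence 0 -> (S/I)(-d) -> S/I -> S/I' -> 0,
  where the first map is multiplication by the nonzerodivisor \<open>f\<close>.\<close>

lemma hilbert_extend:
  fixes f :: "'a::field poly3"
  assumes I: "homogeneous_ideal I" and f: "f \<in> forms d" and reg: "\<And>g. f * g \<in> I \<Longrightarrow> g \<in> I"
    and I': "\<And>x. x \<in> I' \<longleftrightarrow> (\<exists>a. x - a * f \<in> I)"
  shows "hilbert I' n = hilbert I n - hilbert I (n - int d)"
proof -
  have idl: "ideal I" and hc: "\<And>p k. p \<in> I \<Longrightarrow> hcomp k p \<in> I" using I by (auto simp: homogeneous_ideal_def)
  \<comment> \<open>Taking the component of degree \<open>k\<close> makes the cofactor
    \<open>a\<close> homogeneous of degree \<open>k - d\<close>; below degree \<open>d\<close> it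
    disappears altogether.\<close>
  have comp: "x - (if d \<le> k then f * hcomp (k - d) a else 0) \<in> I" if "x - a * f \<in> I" "x \<in> forms k" for x a k
  proof -
    have "hcomp k (x - a * f + a * f) = hcomp k (x - a * f) + hcomp k (f * a)"
      by (simp only: hcomp_add mult.commute[of a f])
    then have "x = hcomp k (x - a * f) + (if d \<le> k then f * hcomp (k - d) a else 0)"
      using hcomp_forms[OF that(2), of k] hcomp_mult[OF f, of k a] by simp
    then show ?thesis using hc[OF that(1), of k] by (metis add_diff_cancel_right')
  qed
  show ?thesis
  proof (cases "n < int d")
    case True
    have "I' \<inter> forms (nat n) = I \<inter> forms (nat n)" if "n \<ge> 0"
    proof -
      have "x \<in> I" if "x \<in> I'" "x \<in> forms (nat n)" for x
      proof -
        have "\<not> d \<le> nat n" using True \<open>n \<ge> 0\<close> by linarith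
        then show ?thesis using that comp[of x _ "nat n"] I' by auto
      qed
      moreover have "x \<in> I'" if "x \<in> I" for x using that by (auto simp: I' intro!: exI[of _ 0])
      ultimately show ?thesis by blast
    qed
    then show ?thesis using True by (simp add: hilbert_def)
  next
    case False
    define k where "k = nat (n - int d)"
    have n: "nat n = d + k" "n \<ge> 0" using False by (auto simp: k_def)
    have "{f * v + b |v b. v \<in> forms k \<and> b \<in> I \<inter> forms (d + k)} = I' \<inter> forms (d + k)" (is "?L = ?R")
    proof
      show "?L \<subseteq> ?R"
      proof safe
        fix v b :: "'a poly3" assume vb: "v \<in> forms k" "b \<in> I" "b \<in> forms (d + k)"
        show "f * v + b \<in> I'" unfolding I' using vb by (intro exI[of _ v]) (simp add: mult.commute)
        show "f * v + b \<in> forms (d + k)" using vb by (intro forms_add forms_mult f)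
      qed
      show "?R \<subseteq> ?L"
      proof
        fix x assume x: "x \<in> ?R"
        then obtain a where "x - a * f \<in> I" using I' by blast
        then have *: "x - f * hcomp k a \<in> I" using comp[of x a "d + k"] x by simp
        moreover have "f * hcomp k a \<in> forms (d + k)" by (intro forms_mult f hcomp_in_forms)
        ultimately have "x - f * hcomp k a \<in> I \<inter> forms (d + k)" using x by (auto intro: forms_diff)
        moreover have "x = f * hcomp k a + (x - f * hcomp k a)" by simp
        ultimately show "x \<in> ?L" using hcomp_in_forms by blast
      qed
    qed
    moreover have "{v \<in> forms k. f * v \<in> I} = I \<inter> forms k"
      using reg ideal_mult[OF idl] by blast
    ultimately show ?thesis using dim_mult_forms[OF idl f, of k] n False
      by (simp add: hilbert_def k_def)
  qed
qed

lemma homogeneous_ideal_extend: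
  fixes f :: "'a::comm_ring_1 poly3"
  assumes I: "homogeneous_ideal I" and f: "f \<in> forms d" and idl': "ideal I'"
    and I': "\<And>x. x \<in> I' \<longleftrightarrow> (\<exists>a. x - a * f \<in> I)"
  shows "homogeneous_ideal I'"
  unfolding homogeneous_ideal_def
proof safe
  fix p n assume "p \<in> I'"
  then obtain a where a: "p - a * f \<in> I" using I' by blast
  have "hcomp n (p - a * f) \<in> I" using I a by (auto simp: homogeneous_ideal_def)
  moreover have "hcomp n p = hcomp n (p - a * f) + hcomp n (f * a)"
    by (simp flip: hcomp_add add: mult.commute)
  ultimately have "hcomp n p - (if d \<le> n then hcomp (n - d) a else 0) * f \<in> I"
    using hcomp_mult[OF f, of n a] by (simp add: mult.commute)
  then show "hcomp n p \<in> I'" using I' by blast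
qed (use idl' in simp)

lemma homogeneous_ideal_zero: "homogeneous_ideal {0 :: 'a::comm_ring_1 poly3}"
proof -
  have "hcomp n (0 :: 'a poly3) = 0" for n by (rule poly_mapping_eqI) (simp add: lookup_hcomp)
  then show ?thesis by (simp add: homogeneous_ideal_def ideal_def)
qed

text \<open>Twice the dimension of the space of forms of degree \<open>n\<close>, for negative \<open>n\<close> as well.\<close>

definition dbl_dim :: "int \<Rightarrow> int" where
  "dbl_dim n = (if n < 0 then 0 else (n + 1) * (n + 2))"

lemma hilbert_zero: "2 * hilbert {0 :: 'a::field poly3} n = dbl_dim n"
proof (cases "n < 0")
  case False
  then obtain k where n: "n = int k" by (metis nonneg_int_cases not_less)
  have "{0} \<inter> forms k = ({0} :: 'a poly3 set)" by simp
  moreover have "mp.dim ({0} :: 'a poly3 set) = 0"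
    using mp.dim_span_eq_card_independent[OF mp.independent_empty] by simp
  moreover have "2 * int (\<Sum>a\<le>k. Suc a) = (int k + 1) * (int k + 2)"
    by (induction k) (simp_all add: algebra_simps)
  ultimately show ?thesis by (simp add: hilbert_def n dbl_dim_def dim_forms)
qed (simp add: hilbert_def dbl_dim_def)

text \<open>Adjoining the generators one by one gives the coefficients of (1 - z^d1)(1 - z^d2)(1 -
  z^d3) / (1 - z)^3. Everything is doubled so that the binomial coefficients become products of
  integers.\<close>

lemma regular_sequence_3:
  fixes f1 f2 f3 :: "'a::field poly3"
  assumes "regular_sequence [f1, f2, f3]" "homogeneous d1 f1" "homogeneous d2 f2" "homogeneous d3 f3"
  defines "I \<equiv> ideal_gen {f1, f2, f3}"
  shows "homogeneous_ideal I" "1 \<notin> I"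
    "2 * hilbert I n = dbl_dim n - dbl_dim (n - d1) - dbl_dim (n - d2) - dbl_dim (n - d3) + dbl_dim (n - d1 - d2) + dbl_dim (n - d1 - d3)
        + dbl_dim (n - d2 - d3) - dbl_dim (n - d1 - d2 - d3)"
proof -
  have f: "f1 \<in> forms d1" "f2 \<in> forms d2" "f3 \<in> forms d3" using assms by (auto simp: forms_def)
  have "\<forall>i<3. \<forall>g. [f1, f2, f3] ! i * g \<in> ideal_gen (set (take i [f1, f2, f3])) \<longrightarrow>
        g \<in> ideal_gen (set (take i [f1, f2, f3]))"
    using assms(1) by (simp add: regular_sequence_def numeral_3_eq_3)
  note * = this[rule_format]
  have reg: "f1 * g \<in> {0} \<Longrightarrow> g \<in> {0}" "f2 * g \<in> ideal_gen {f1} \<Longrightarrow> g \<in> ideal_gen {f1}"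
      "f3 * g \<in> ideal_gen {f1, f2} \<Longrightarrow> g \<in> ideal_gen {f1, f2}" for g
    using *[of 0 g] *[of 1 g] *[of 2 g] by (simp_all add: ideal_gen_empty numeral_2_eq_2 del: mult_eq_0_iff)
  have ext: "x \<in> ideal_gen {f1} \<longleftrightarrow> (\<exists>a. x - a * f1 \<in> {0})"
      "x \<in> ideal_gen {f1, f2} \<longleftrightarrow> (\<exists>a. x - a * f2 \<in> ideal_gen {f1})"
      "x \<in> ideal_gen {f1, f2, f3} \<longleftrightarrow> (\<exists>a. x - a * f3 \<in> ideal_gen {f1, f2})" for x
    using ideal_gen_insert[of x f1 "{}"] ideal_gen_insert[of x f2 "{f1}"] ideal_gen_insert[of x f3 "{f1, f2}"]
    by (simp_all add: ideal_gen_empty insert_commute)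
  have h1: "homogeneous_ideal (ideal_gen {f1})"
    by (rule homogeneous_ideal_extend[OF homogeneous_ideal_zero f(1) _ ext(1)]) simp
  have h2: "homogeneous_ideal (ideal_gen {f1, f2})"
    by (rule homogeneous_ideal_extend[OF h1 f(2) _ ext(2)]) simp
  show "homogeneous_ideal I" unfolding I_def
    by (rule homogeneous_ideal_extend[OF h2 f(3) _ ext(3)]) simp
  have e1: "hilbert (ideal_gen {f1}) k = hilbert {0::'a poly3} k - hilbert {0::'a poly3} (k - d1)" for k
    by (rule hilbert_extend[OF homogeneous_ideal_zero f(1) reg(1) ext(1)])
  have e2: "hilbert (ideal_gen {f1, f2}) k = hilbert (ideal_gen {f1}) k - hilbert (ideal_gen {f1}) (k - d2)" for k
    by (rule hilbert_extend[OF h1 f(2) reg(2) ext(2)])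
  have e3: "hilbert I k = hilbert (ideal_gen {f1, f2}) k - hilbert (ideal_gen {f1, f2}) (k - d3)" for k
    unfolding I_def by (rule hilbert_extend[OF h2 f(3) reg(3) ext(3)])
  show "2 * hilbert I n = dbl_dim n - dbl_dim (n - d1) - dbl_dim (n - d2) - dbl_dim (n - d3) + dbl_dim (n - d1 - d2) + dbl_dim (n - d1 - d3)
        + dbl_dim (n - d2 - d3) - dbl_dim (n - d1 - d2 - d3)"
    by (simp add: e1 e2 e3 right_diff_distrib hilbert_zero algebra_simps)
  show "1 \<notin> I"
  proof
    assume "1 \<in> I"
    then have "I = UNIV" using ideal_mult[of I 1] by (auto simp: I_def)
    then show False using assms(1) by (simp add: regular_sequence_def I_def)
  qed
qed

text \<open>The difference \<open>h\<^sub>t - h\<^sub>t\<^sub>-\<^sub>1\<close> for a complete intersection up to half the socle degree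
  \<open>d1 + d2 + d3 - 3\<close>, and \<open>0\<close> above.\<close>

definition ci_diff :: "nat \<Rightarrow> nat \<Rightarrow> nat \<Rightarrow> nat \<Rightarrow> nat" where
  "ci_diff d1 d2 d3 t = (if d1 + d2 + d3 < 2 * t + 3 then 0 else if t < d1 then t + 1 else if t < d2 then d1
     else if t < d3 then d1 + d2 - 1 - t else d1 + d2 + d3 - 2 - 2 * t)"

text \<open>The quadratic is symmetric under the reflection and vanishes at -1 and -2, the only
  integers for which both arguments are negative; otherwise exactly one of the two is
  nonnegative.\<close>

lemma dbl_dim_reflect:
  assumes "m = - 3 - n"
  shows "dbl_dim n + dbl_dim m = (n + 1) * (n + 2)"
  unfolding assms by (cases "n = -1 \<or> n = -2") (auto simp: dbl_dim_def algebra_simps)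

lemma dbl_dim_diff: "m = n - 1 \<Longrightarrow> dbl_dim n - dbl_dim m = 2 * max 0 (n + 1)"
  by (cases "m = -1") (auto simp: dbl_dim_def algebra_simps max_def)

text \<open>Reflection pairs each subset of the three degrees with its complement, which carries the
  opposite sign. By \<open>dbl_dim_reflect\<close> the difference of the two sides becomes a
  third-order finite difference of a quadratic polynomial, hence 0.\<close>

lemma ci_hilbert_reflect:
  fixes h :: "int \<Rightarrow> int"
  assumes h: "\<And>n. 2 * h n = dbl_dim n - dbl_dim (n - d1) - dbl_dim (n - d2) - dbl_dim (n - d3) + dbl_dim (n - d1 - d2) + dbl_dim (n - d1 - d3)
        + dbl_dim (n - d2 - d3) - dbl_dim (n - d1 - d2 - d3)"
  shows "h (d1 + d2 + d3 - 3 - n) = h n"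
proof -
  have "dbl_dim (n) + dbl_dim (d1 + d2 + d3 - 3 - n - d1 - d2 - d3) = (n + 1) * (n + 2)"
    "dbl_dim (n - d1) + dbl_dim (d1 + d2 + d3 - 3 - n - d2 - d3) = (n - d1 + 1) * (n - d1 + 2)"
    "dbl_dim (n - d2) + dbl_dim (d1 + d2 + d3 - 3 - n - d1 - d3) = (n - d2 + 1) * (n - d2 + 2)"
    "dbl_dim (n - d3) + dbl_dim (d1 + d2 + d3 - 3 - n - d1 - d2) = (n - d3 + 1) * (n - d3 + 2)"
    "dbl_dim (n - d1 - d2) + dbl_dim (d1 + d2 + d3 - 3 - n - d3) = (n - d1 - d2 + 1) * (n - d1 - d2 + 2)"
    "dbl_dim (n - d1 - d3) + dbl_dim (d1 + d2 + d3 - 3 - n - d2) = (n - d1 - d3 + 1) * (n - d1 - d3 + 2)"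
    "dbl_dim (n - d2 - d3) + dbl_dim (d1 + d2 + d3 - 3 - n - d1) = (n - d2 - d3 + 1) * (n - d2 - d3 + 2)"
    "dbl_dim (n - d1 - d2 - d3) + dbl_dim (d1 + d2 + d3 - 3 - n) = (n - d1 - d2 - d3 + 1) * (n - d1 - d2 - d3 + 2)"
    by (rule dbl_dim_reflect, simp)+
  then have "2 * h n - 2 * h (d1 + d2 + d3 - 3 - n) = (n + 1) * (n + 2) - (n - d1 + 1) * (n - d1 + 2) - (n - d2 + 1) * (n - d2 + 2) - (n - d3 + 1) * (n - d3 + 2) + (n - d1 - d2 + 1) * (n - d1 - d2 + 2) + (n - d1 - d3 + 1) * (n - d1 - d3 + 2) + (n - d2 - d3 + 1) * (n - d2 - d3 + 2) - (n - d1 - d2 - d3 + 1) * (n - d1 - d2 - d3 + 2)"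
    unfolding h by linarith
  also have "\<dots> = 0" by (simp add: algebra_simps)
  finally show ?thesis by simp
qed

lemma ci_hilbert_diff_int:
  fixes h :: "int \<Rightarrow> int"
  assumes h: "\<And>n. 2 * h n = dbl_dim n - dbl_dim (n - d1) - dbl_dim (n - d2) - dbl_dim (n - d3) + dbl_dim (n - d1 - d2) + dbl_dim (n - d1 - d3)
        + dbl_dim (n - d2 - d3) - dbl_dim (n - d1 - d2 - d3)"
    and Y: "\<And>n. Y n = max 0 (n + 1)"
  shows "h t - h (t - 1) = Y t - Y (t - d1) - Y (t - d2) - Y (t - d3)
    + Y (t - d1 - d2) + Y (t - d1 - d3) + Y (t - d2 - d3) - Y (t - d1 - d2 - d3)"
proof -
  have *: "dbl_dim n - dbl_dim m = 2 * Y n" if "m = n - 1" for n m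
    using that by (simp add: Y dbl_dim_diff)
  have "dbl_dim (t) - dbl_dim (t - 1) = 2 * Y (t)"
    "dbl_dim (t - d1) - dbl_dim (t - 1 - d1) = 2 * Y (t - d1)"
    "dbl_dim (t - d2) - dbl_dim (t - 1 - d2) = 2 * Y (t - d2)"
    "dbl_dim (t - d3) - dbl_dim (t - 1 - d3) = 2 * Y (t - d3)"
    "dbl_dim (t - d1 - d2) - dbl_dim (t - 1 - d1 - d2) = 2 * Y (t - d1 - d2)"
    "dbl_dim (t - d1 - d3) - dbl_dim (t - 1 - d1 - d3) = 2 * Y (t - d1 - d3)"
    "dbl_dim (t - d2 - d3) - dbl_dim (t - 1 - d2 - d3) = 2 * Y (t - d2 - d3)"
    "dbl_dim (t - d1 - d2 - d3) - dbl_dim (t - 1 - d1 - d2 - d3) = 2 * Y (t - d1 - d2 - d3)"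
    by (rule *, simp)+
  then show ?thesis
    using h[of t] h[of "t - 1"] by linarith
qed

text \<open>Up to half the socle degree, \<open>d3 + 1 < d1 + d2\<close> forces
  \<open>t < d1 + d2\<close>, so all terms in which two or more degrees are subtracted vanish and
  only the four simplest survive.\<close>

lemma ci_hilbert_diff:
  fixes h :: "int \<Rightarrow> int" and d1 d2 d3 t :: nat
  assumes h: "\<And>n. 2 * h n = dbl_dim n - dbl_dim (n - d1) - dbl_dim (n - d2) - dbl_dim (n - d3) + dbl_dim (n - d1 - d2) + dbl_dim (n - d1 - d3)
        + dbl_dim (n - d2 - d3) - dbl_dim (n - d1 - d2 - d3)"
    and "d1 < d2" "d2 < d3" "d3 + 1 < d1 + d2" "2 * t + 3 \<le> d1 + d2 + d3"
  shows "h t - h (int t - 1) = ci_diff d1 d2 d3 t"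
proof -
  define Y where "Y n = max 0 (n + 1)" for n :: int
  have "h t - h (int t - 1) = Y (int t) - Y (int t - d1) - Y (int t - d2) - Y (int t - d3)
    + Y (int t - d1 - d2) + Y (int t - d1 - d3) + Y (int t - d2 - d3) - Y (int t - d1 - d2 - d3)"
    by (rule ci_hilbert_diff_int[OF h Y_def])
  moreover have "Y (int t - d1 - d2) = 0" "Y (int t - d1 - d3) = 0" "Y (int t - d2 - d3) = 0"
    "Y (int t - d1 - d2 - d3) = 0"
    using assms by (auto simp: Y_def)
  ultimately have "h t - h (int t - 1) = Y t - Y (int t - d1) - Y (int t - d2) - Y (int t - d3)" by simp
  also have "\<dots> = ci_diff d1 d2 d3 t"
    using assms by (auto simp: ci_diff_def Y_def max_def)
  finally show ?thesis .
qed

subsection \<open>Lefschetz elements\<close>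

lemma hilbert_of_nat:
  fixes A :: "'a::field poly3 set"
  shows "hilbert A (int n) = int (mp.dim (forms n :: 'a poly3 set)) - int (mp.dim (A \<inter> forms n))"
  by (simp add: hilbert_def)

lemma mult_smul: "q * smul c p = smul c (q * p)"
  by (simp add: smul_def mult.left_commute)

text \<open>Multiplication by \<open>q\<close> maps degree \<open>s\<close> to degree
  \<open>k + s\<close> of the quotient, and these have equal dimension. Both properties are phrased
  on representatives, with kernel \<open>?K\<close> and image \<open>?R\<close> taken as subspaces
  of forms containing the part of \<open>A\<close>.\<close>

lemma mult_inj_iff_surj:
  fixes A :: "'a::field poly3 set"
  assumes A: "ideal A" and q: "q \<in> forms k" and h: "hilbert A (int s) = hilbert A (int (k + s))"
  shows "(\<forall>f\<in>forms s. q * f \<in> A \<longrightarrow> f \<in> A) \<longleftrightarrow> (\<forall>p\<in>forms (k + s). \<exists>f\<in>forms s. p - q * f \<in> A)"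
proof -
  let ?K = "{v \<in> forms s. q * v \<in> A}" and ?R = "{q * v + b |v b. v \<in> forms s \<and> b \<in> A \<inter> forms (k + s)}"
  have dims: "mp.dim ?R + mp.dim ?K = mp.dim (forms s :: 'a poly3 set) + mp.dim (A \<inter> forms (k + s))"
    by (rule dim_mult_forms[OF A q])
  have eq: "int (mp.dim (forms s :: 'a poly3 set)) - mp.dim (A \<inter> forms s)
      = int (mp.dim (forms (k + s) :: 'a poly3 set)) - mp.dim (A \<inter> forms (k + s))"
    using h unfolding hilbert_of_nat .
  have subK: "mp.subspace ?K"
    using A by (auto simp: mp.subspace_def forms_add forms_smul ideal_zero distrib_left ideal_add mult_smul ideal_smul)
  have subR: "mp.subspace ?R"
  proof -
    have "mp.subspace {x + y |x y. x \<in> (*) q ` forms s \<and> y \<in> A \<inter> forms (k + s)}"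
      by (intro mp.subspace_sums subspace_ideal_forms[OF A] module_hom.subspace_image[OF module_hom_mult] subspace_forms)
    moreover have "{x + y |x y. x \<in> (*) q ` forms s \<and> y \<in> A \<inter> forms (k + s)} = ?R" by blast
    ultimately show ?thesis by simp
  qed
  have KA: "A \<inter> forms s \<subseteq> ?K" using A by (auto intro: ideal_mult)
  have RF: "?R \<subseteq> forms (k + s)" using q by (auto intro: forms_add forms_mult)
  have surj_iff: "(\<forall>p\<in>forms (k + s). \<exists>f\<in>forms s. p - q * f \<in> A) \<longleftrightarrow> forms (k + s) \<subseteq> ?R"
  proof safe
    fix p :: "'a poly3" assume p: "p \<in> forms (k + s)" "\<forall>p\<in>forms (k + s). \<exists>f\<in>forms s. p - q * f \<in> A"
    then obtain f where f: "f \<in> forms s" "p - q * f \<in> A" by blast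
    moreover have "p - q * f \<in> forms (k + s)" using f p q by (auto intro: forms_diff forms_mult)
    ultimately show "\<exists>v b. p = q * v + b \<and> v \<in> forms s \<and> b \<in> A \<inter> forms (k + s)"
      by (intro exI[of _ f] exI[of _ "p - q * f"]) simp
  next
    fix p :: "'a poly3" assume "forms (k + s) \<subseteq> ?R" "p \<in> forms (k + s)"
    then obtain v b where "p = q * v + b" "v \<in> forms s" "b \<in> A" by blast
    then show "\<exists>f\<in>forms s. p - q * f \<in> A" by (intro bexI[of _ v]) simp_all
  qed
  show ?thesis
  proof
    assume "\<forall>f\<in>forms s. q * f \<in> A \<longrightarrow> f \<in> A"
    then have "?K = A \<inter> forms s" using KA by blast
    then have "mp.dim (forms (k + s) :: 'a poly3 set) \<le> mp.dim ?R" using dims eq by simp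
    then have "?R = forms (k + s)"
      using mp.subspace_eq_of_dim_eq[OF RF forms_subset_span[OF order_refl] finite_monomials subR subspace_forms] by blast
    then show "\<forall>p\<in>forms (k + s). \<exists>f\<in>forms s. p - q * f \<in> A" using surj_iff by blast
  next
    assume "\<forall>p\<in>forms (k + s). \<exists>f\<in>forms s. p - q * f \<in> A"
    then have "?R = forms (k + s)" using surj_iff RF by blast
    then have "mp.dim ?K \<le> mp.dim (A \<inter> forms s)" using dims eq by simp
    then have "A \<inter> forms s = ?K"
      by (intro mp.subspace_eq_of_dim_eq[OF KA forms_subset_span finite_monomials subspace_ideal_forms[OF A] subK]) auto
    then show "\<forall>f\<in>forms s. q * f \<in> A \<longrightarrow> f \<in> A" by blast
  qed
qed

lemma hilbert_eq_zero:
  fixes A :: "'a::field poly3 set"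
  assumes "ideal A" "hilbert A (int n) = 0"
  shows "forms n \<subseteq> A"
proof -
  have "mp.dim (forms n :: 'a poly3 set) \<le> mp.dim (A \<inter> forms n)" using assms(2) by (simp add: hilbert_def)
  then have "A \<inter> forms n = forms n"
    by (intro mp.subspace_eq_of_dim_eq[OF _ forms_subset_span[OF order_refl] finite_monomials subspace_ideal_forms[OF assms(1)] subspace_forms]) auto
  then show ?thesis by blast
qed

text \<open>Only multiplications between degrees symmetric about half of \<open>\<sigma>\<close> are
  recorded. For a symmetric Hilbert function injectivity there is already bijectivity.\<close>

definition lefschetz_form :: "'a::comm_ring_1 poly3 set \<Rightarrow> nat \<Rightarrow> 'a poly3 \<Rightarrow> bool" where
  "lefschetz_form A \<sigma> l \<longleftrightarrow> (\<forall>s k f. 2 * s + k = \<sigma> \<longrightarrow> f \<in> forms s \<longrightarrow> l ^ k * f \<in> A \<longrightarrow> f \<in> A)"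

lemma coset_eq_iff: "ideal I \<Longrightarrow> coset I f = coset I g \<longleftrightarrow> f - g \<in> I"
proof
  assume I: "ideal I" and "coset I f = coset I g"
  moreover have "f \<in> coset I f" using I by (simp add: coset_def ideal_zero)
  ultimately show "f - g \<in> I" by (simp add: coset_def)
next
  assume I: "ideal I" and fg: "f - g \<in> I"
  have "x - f \<in> I \<longleftrightarrow> x - g \<in> I" for x
    using ideal_add[OF I, of "x - f" "f - g"] ideal_diff[OF I, of "x - g" "f - g"] fg by auto
  then show "coset I f = coset I g" by (simp add: coset_def)
qed

lemma quot_mult_coset:
  assumes I: "ideal I"
  shows "quot_mult I p (coset I f) = coset I (p * f)"
proof -
  have "coset I (p * g) = coset I (p * f)" if "g \<in> coset I f" for g
  proof -
    have "p * g - p * f \<in> I"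
      using that ideal_mult[OF I, of "g - f" p] by (simp add: right_diff_distrib coset_def)
    then show ?thesis by (simp only: coset_eq_iff[OF I])
  qed
  moreover have "coset I f \<noteq> {}" using I ideal_zero[OF I] by (auto simp: coset_def intro: exI[of _ f])
  ultimately show ?thesis by (simp add: quot_mult_def)
qed

text \<open>The strong Lefschetz property offers injectivity or surjectivity. In symmetric degrees
  the dimensions agree, so the second alternative implies the first.\<close>

lemma strong_lefschetz_imp_lefschetz_form:
  fixes I :: "'a::field poly3 set"
  assumes "strong_lefschetz I" and I: "ideal I" and sym: "\<And>n. hilbert I (int \<sigma> - n) = hilbert I n"
  obtains l where "l \<in> forms 1" "lefschetz_form I \<sigma> l"
proof -
  from assms(1)[unfolded strong_lefschetz_def] obtain l where *: "homogeneous 1 l \<and> (\<forall>b\<ge>1. \<forall>t.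
      inj_on (quot_mult I (l ^ b)) (quot_component I t) \<or>
          quot_mult I (l ^ b) ` quot_component I t = quot_component I (t + b))" ..
  note l = *[THEN conjunct1] and slp = *[THEN conjunct2, rule_format]
  have "f \<in> I" if "2 * s + k = \<sigma>" "f \<in> forms s" "l ^ k * f \<in> I" for s k f
  proof (cases "k = 0")
    case True
    then show ?thesis using that by simp
  next
    case False
    have lk: "l ^ k \<in> forms k" using forms_power[of l 1 k] l by (simp add: forms_def)
    have eq: "hilbert I (int s) = hilbert I (int (k + s))"
    proof -
      have "int \<sigma> - int s = int (k + s)" using that(1) by auto
      then show ?thesis using sym[of "int s"] by (simp add: add.commute)
    qed
    have "\<forall>f\<in>forms s. l ^ k * f \<in> I \<longrightarrow> f \<in> I"
      using slp[of k s]
    proof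
      assume inj: "inj_on (quot_mult I (l ^ k)) (quot_component I s)"
      show ?thesis
      proof safe
        fix f assume f: "f \<in> forms s" "l ^ k * f \<in> I"
        have "coset I f = coset I 0"
        proof (rule inj_onD[OF inj])
          show "quot_mult I (l ^ k) (coset I f) = quot_mult I (l ^ k) (coset I 0)"
            using f by (simp add: quot_mult_coset[OF I] coset_eq_iff[OF I])
          show "coset I f \<in> quot_component I s" "coset I 0 \<in> quot_component I s"
            using f forms_zero[of s] unfolding quot_component_def forms_def by blast+
        qed
        then show "f \<in> I" by (simp add: coset_eq_iff[OF I])
      qed
    next
      assume surj: "quot_mult I (l ^ k) ` quot_component I s = quot_component I (s + k)"
      have "\<forall>p\<in>forms (k + s). \<exists>f\<in>forms s. p - l ^ k * f \<in> I"
      proof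
        fix p :: "'a poly3" assume "p \<in> forms (k + s)"
        then have "coset I p \<in> quot_mult I (l ^ k) ` quot_component I s"
          unfolding surj by (auto simp: quot_component_def forms_def add.commute)
        then obtain f where "f \<in> forms s" "coset I p = coset I (l ^ k * f)"
          by (auto simp: quot_component_def forms_def quot_mult_coset[OF I])
        then show "\<exists>f\<in>forms s. p - l ^ k * f \<in> I" using coset_eq_iff[OF I] by blast
      qed
      then show ?thesis using mult_inj_iff_surj[OF I lk eq] by blast
    qed (use False in simp)
    then show ?thesis using that by blast
  qed
  then show thesis using that l by (auto simp: lefschetz_form_def forms_def)
qed

section \<open>Powers of x3 and leading monomials\<close>

lemma lookup_X3_power_mult:
  "Poly_Mapping.lookup (X 3 ^ c * p) (mon a b d) = (if c \<le> d then Poly_Mapping.lookup p (mon a b (d - c)) else 0)"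
  for p :: "'a::comm_ring_1 poly3"
proof (induction p rule: mpol_induct)
  case (single m k)
  obtain a' b' c' where "m = mon a' b' c'" by (rule mon_cases)
  then show ?case by (auto simp: X3_power_eq mult_single mon_add lookup_single when_def)
qed (simp add: distrib_left lookup_add)

text \<open>Division with remainder by a power of x3. The coefficients of quotient and remainder are
  exposed because reverse lexicographic comparison looks at the x3-exponent first.\<close>

lemma X3_split:
  fixes p :: "'a::comm_ring_1 poly3"
  assumes "p \<in> forms (c + n)"
  obtains q r where "p = X 3 ^ c * q + r" "q \<in> forms n" "r \<in> forms (c + n)"
    "\<And>a b d. Poly_Mapping.lookup q (mon a b d) = Poly_Mapping.lookup p (mon a b (c + d))"
    "\<And>a b d. Poly_Mapping.lookup r (mon a b d) = (if d < c then Poly_Mapping.lookup p (mon a b d) else 0)"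
proof -
  define q where "q = Poly_Mapping.map_key (\<lambda>m. m + mon 0 0 c) p"
  have "inj (\<lambda>m. m + mon 0 0 c)" by (simp add: inj_on_def)
  then have q: "Poly_Mapping.lookup q (mon a b d) = Poly_Mapping.lookup p (mon a b (c + d))" for a b d
    by (simp add: q_def map_key.rep_eq mon_add add.commute)
  have qf: "q \<in> forms n"
    unfolding forms_iff
  proof safe
    fix m assume m: "mdeg m \<noteq> n"
    obtain a b d where [simp]: "m = mon a b d" by (rule mon_cases)
    show "Poly_Mapping.lookup q m = 0" using assms m by (simp add: q forms_iff)
  qed
  moreover have "X 3 ^ c \<in> (forms c :: 'a poly3 set)" using forms_power[OF X_in_forms, of 3 c] by simp
  ultimately have "X 3 ^ c * q \<in> forms (c + n)" by (rule forms_mult[rotated])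
  then have "p - X 3 ^ c * q \<in> forms (c + n)" using assms by (rule forms_diff[rotated])
  then show thesis using that[of q "p - X 3 ^ c * q"] qf q
    by (simp add: lookup_minus lookup_X3_power_mult)
qed

lemma is_leading_monomial_mon:
  fixes f :: "'a::zero poly3"
  assumes "f \<in> forms (a + b + c)" 
  shows "is_leading_monomial (mon a b c) f \<longleftrightarrow> Poly_Mapping.lookup f (mon a b c) \<noteq> 0 \<and>
    (\<forall>a' b' c'. Poly_Mapping.lookup f (mon a' b' c') \<noteq> 0 \<longrightarrow> c' > c \<or> c' = c \<and> b' \<ge> b)" (is "?L \<longleftrightarrow> ?R")
proof
  assume L: ?L
  show ?R
  proof safe
    show "Poly_Mapping.lookup f (mon a b c) = 0 \<Longrightarrow> False"
      using L by (simp add: is_leading_monomial_def in_keys_iff)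
    fix a' b' c' assume *: "Poly_Mapping.lookup f (mon a' b' c') \<noteq> 0" "\<not> c' > c" 
    then have "mon a' b' c' = mon a b c \<or> revlex_less (mon a' b' c') (mon a b c)"
      using L[unfolded is_leading_monomial_def, THEN conjunct2, rule_format, of "mon a' b' c'"]
      by (auto simp only: in_keys_iff)
    moreover have "a' + b' + c' = a + b + c"
      using assms[unfolded forms_iff, rule_format, of "mon a' b' c'"] * by auto
    ultimately show "c' = c" "b' \<ge> b" using *(2) by (auto simp: revlex_less_def)
  qed
next
  assume R: ?R
  show ?L
    unfolding is_leading_monomial_def
  proof safe
    show "mon a b c \<in> Poly_Mapping.keys f" using R by (simp add: in_keys_iff)
    fix m assume m: "m \<in> Poly_Mapping.keys f" "m \<noteq> mon a b c"
    obtain a' b' c' where [simp]: "m = mon a' b' c'" by (rule mon_cases)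
    have "a' + b' + c' = a + b + c"
      using assms[unfolded forms_iff, rule_format, of m] m by (auto simp: in_keys_iff)
    moreover have "c' > c \<or> c' = c \<and> b' \<ge> b" using R m by (auto simp: in_keys_iff)
    ultimately show "revlex_less m (mon a b c)" using m by (auto simp: revlex_less_def)
  qed
qed

lemma is_leading_monomial_hcomp:
  fixes f :: "'a::comm_ring_1 poly3"
  assumes "is_leading_monomial m f"
  shows "is_leading_monomial m (hcomp (mdeg m) f)"
  using assms by (auto simp: is_leading_monomial_def in_keys_iff lookup_hcomp split: if_splits)

lemma is_leading_monomial_X3_mult:
  fixes f :: "'a::comm_ring_1 poly3"
  assumes "is_leading_monomial (mon a b c) f" "f \<in> forms (a + b + c)"
  shows "is_leading_monomial (mon a b (c + k)) (X 3 ^ k * f)"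
proof -
  have "X 3 ^ k \<in> (forms k :: 'a poly3 set)" using forms_power[OF X_in_forms, of 3 k] by simp
  then have "X 3 ^ k * f \<in> forms (a + b + (c + k))" using forms_mult[OF _ assms(2)]
    by (metis add.commute add.assoc)
  then show ?thesis
    using assms by (auto simp: is_leading_monomial_mon lookup_X3_power_mult split: if_splits) force+
qed

subsection \<open>The initial ideal in Lefschetz position\<close>

text \<open>The \<open>e\<close> smallest monomials of degree \<open>t\<close> free of x3: a small
  x1-exponent means a large x2-exponent. The subtraction \<open>t - a\<close> is exact as long as
  \<open>e \<le> t + 1\<close>.\<close>

definition low_monomials :: "nat \<Rightarrow> nat \<Rightarrow> (3 \<Rightarrow>\<^sub>0 nat) set" where
  "low_monomials e t = {mon a (t - a) 0 |a. a < e}"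

text \<open>Linear independence of the low monomials modulo \<open>A\<close> and x3, in degree
  \<open>t \<ge> 1\<close>.\<close>

definition avoids_low :: "'a::comm_ring_1 poly3 set \<Rightarrow> nat \<Rightarrow> nat \<Rightarrow> bool" where
  "avoids_low A e t \<longleftrightarrow> (\<forall>q\<in>forms (t - 1). \<forall>r\<in>supported (low_monomials e t). X 3 * q + r \<in> A \<longrightarrow> r = 0)"

lemma card_low_monomials: "card (low_monomials e t) = e" "finite (low_monomials e t)"
proof -
  have "low_monomials e t = (\<lambda>a. mon a (t - a) 0) ` {..<e}" by (auto simp: low_monomials_def)
  moreover have "inj_on (\<lambda>a. mon a (t - a) 0) {..<e}" by (auto simp: inj_on_def)
  ultimately show "card (low_monomials e t) = e" "finite (low_monomials e t)" by (simp_all add: card_image)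
qed

lemma low_monomials_forms: "e \<le> t + 1 \<Longrightarrow> supported (low_monomials e t) \<subseteq> forms t"
  by (auto simp: supported_def forms_eq_supported low_monomials_def)

text \<open>Of the assumptions on \<open>A\<close>, only \<open>lef\<close> and \<open>low\<close>
  depend on the coordinates; the others survive every invertible linear substitution.\<close>

locale lefschetz_ideal =
  fixes A :: "'a::field poly3 set" and e :: "nat \<Rightarrow> nat" and \<sigma> :: nat
  assumes A: "homogeneous_ideal A" and one: "1 \<notin> A"
    and sym: "\<And>n. hilbert A (int \<sigma> - n) = hilbert A n"
    and diff: "\<And>t. 2 * t \<le> \<sigma> \<Longrightarrow> hilbert A (int t) - hilbert A (int t - 1) = int (e t)"
    and e0: "e 0 = 1" and e_le: "\<And>t. e t \<le> t + 1"
    and lef: "lefschetz_form A \<sigma> (X 3)"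
    and low: "\<And>t. 1 \<le> t \<Longrightarrow> 2 * t \<le> \<sigma> \<Longrightarrow> avoids_low A (e t) t"
begin

lemma idl: "ideal A" and hcomp_closed: "p \<in> A \<Longrightarrow> hcomp n p \<in> A"
  using A by (auto simp: homogeneous_ideal_def)

lemma X3_power_forms: "X 3 ^ k \<in> (forms k :: 'a poly3 set)"
  using forms_power[OF X_in_forms, of 3 k] by simp

text \<open>Multiplying further, up to the exponent \<open>\<sigma> - 2 * s\<close>, reaches the
  case covered by \<open>lef\<close>.\<close>

lemma X3_power_inj:
  assumes "2 * s + k \<le> \<sigma>" "f \<in> forms s" "X 3 ^ k * f \<in> A"
  shows "f \<in> A"
proof -
  have "X 3 ^ (\<sigma> - 2 * s - k) * (X 3 ^ k * f) \<in> A" using assms(3) idl by (rule ideal_mult[rotated])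
  moreover have "X 3 ^ (\<sigma> - 2 * s - k) * (X 3 ^ k * f) = X 3 ^ (\<sigma> - 2 * s) * f"
    using assms(1) by (simp add: mult.assoc[symmetric] flip: power_add)
  ultimately show ?thesis
    using lef assms unfolding lefschetz_form_def by (metis add_leD1 le_add_diff_inverse)
qed

lemma hilbert_flip: "2 * s + k = \<sigma> \<Longrightarrow> hilbert A (int s) = hilbert A (int (k + s))"
proof -
  assume "2 * s + k = \<sigma>"
  then have "int \<sigma> - int s = int (k + s)" by auto
  then show ?thesis using sym[of "int s"] by (simp add: add.commute)
qed

lemma X3_power_surj:
  assumes "2 * s + k = \<sigma>" "p \<in> forms (k + s)"
  obtains q where "q \<in> forms s" "p - X 3 ^ k * q \<in> A"
proof -
  have "\<forall>f\<in>forms s. X 3 ^ k * f \<in> A \<longrightarrow> f \<in> A" using lef assms(1) by (auto simp: lefschetz_form_def)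
  then have "\<forall>p\<in>forms (k + s). \<exists>f\<in>forms s. p - X 3 ^ k * f \<in> A"
    using mult_inj_iff_surj[OF idl X3_power_forms hilbert_flip[OF assms(1)]] by blast
  then show thesis using that assms(2) by blast
qed

lemma forms_above_socle: "\<sigma> < n \<Longrightarrow> forms n \<subseteq> A"
proof -
  assume "\<sigma> < n"
  then have "hilbert A (int \<sigma> - int n) = 0" by (simp add: hilbert_def)
  then show ?thesis using sym[of "int n"] by (intro hilbert_eq_zero[OF idl]) simp
qed

text \<open>In degree \<open>t\<close> the sum of \<open>A\<close> and the multiples of x3 has
  codimension \<open>e t\<close>. The \<open>e t\<close> low monomials are independent modulo this
  sum, so they span a complement.\<close>

lemma low_decomposition:
  assumes t: "1 \<le> t" "2 * t \<le> \<sigma>" and p: "p \<in> forms t"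
  obtains q r where "q \<in> forms (t - 1)" "r \<in> supported (low_monomials (e t) t)" "p - X 3 * q - r \<in> A"
proof -
  obtain s where s: "t = Suc s" using t by (cases t) auto
  \<comment> \<open>\<open>?D\<close> is the degree \<open>t\<close> part of \<open>A\<close> plus
    the multiples of x3; its dimension follows because multiplication by x3 is injective on degree
    \<open>s\<close> of the quotient.\<close>
  let ?D = "{X 3 * v + b |v b. v \<in> forms s \<and> b \<in> A \<inter> forms (1 + s)}"
  let ?L = "supported (low_monomials (e t) t) :: 'a poly3 set"
  let ?E = "{id v + b |v b. v \<in> ?L \<and> b \<in> ?D}"
  have "{v \<in> forms s. X 3 * v \<in> A} = A \<inter> forms s"
    using X3_power_inj[of s 1] t s ideal_mult[OF idl] by auto
  then have "mp.dim ?D + mp.dim (A \<inter> forms s) = mp.dim (forms s :: 'a poly3 set) + mp.dim (A \<inter> forms (1 + s))"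
    using dim_mult_forms[OF idl X_in_forms, of 3 s] by simp
  moreover have "hilbert A (int t) - hilbert A (int s) = e t" using diff[OF t(2)] s by simp
  ultimately have dimD: "mp.dim ?D + e t = mp.dim (forms t :: 'a poly3 set)"
    unfolding hilbert_of_nat s by simp
  have subD: "mp.subspace ?D"
  proof -
    have "mp.subspace {x + y |x y. x \<in> (*) (X 3) ` forms s \<and> y \<in> A \<inter> forms (1 + s)}"
      by (intro mp.subspace_sums subspace_ideal_forms[OF idl] module_hom.subspace_image[OF module_hom_mult] subspace_forms)
    moreover have "{x + y |x y. x \<in> (*) (X 3) ` forms s \<and> y \<in> A \<inter> forms (1 + s)} = ?D" by blast
    ultimately show ?thesis by simp
  qed
  have X3: "X 3 * v \<in> forms t" if "v \<in> forms s" for v :: "'a poly3"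
    using forms_mult[OF X_in_forms that, of 3] s by simp
  have DF: "?D \<subseteq> forms t" using X3 s by (auto intro: forms_add)
  have LF: "?L \<subseteq> forms t" using low_monomials_forms[OF e_le] .
  have int0: "{v \<in> ?L. id v \<in> ?D} = {0}"
  proof -
    have "v = 0" if v: "v \<in> ?L" "v \<in> ?D" for v
    proof -
      obtain w b where wb: "v = X 3 * w + b" "w \<in> forms s" "b \<in> A" using v by blast
      have "- w \<in> forms s" using wb by (simp add: forms_iff)
      moreover have "X 3 * (- w) + v \<in> A" using wb by simp
      ultimately show "v = 0" using low[OF t] v(1) s by (auto simp: avoids_low_def)
    qed
    moreover have "0 \<in> ?L" "0 \<in> ?D" 
      using subspace_supported subD mp.subspace_0 by blast+
    ultimately show ?thesis unfolding id_apply by blast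
  qed
  have "module_hom smul smul (id :: 'a poly3 \<Rightarrow> 'a poly3)"
    by (simp add: module_hom_def module_hom_axioms_def mp.module_axioms)
  from mp.dim_linear_image_sum[OF this subspace_supported forms_subset_span[OF LF] finite_monomials subD
    forms_subset_span[OF DF] finite_monomials]
  have "mp.dim ?E + mp.dim {0 :: 'a poly3} = e t + mp.dim ?D"
    unfolding int0 by (simp add: dim_supported card_low_monomials)
  then have dimE: "mp.dim (forms t :: 'a poly3 set) \<le> mp.dim ?E"
    using dimD mp.dim_le_card[of "{0 :: 'a poly3}" "{}"] by simp
  have "mp.subspace {x + y |x y. x \<in> ?L \<and> y \<in> ?D}"
    by (rule mp.subspace_sums[OF subspace_supported subD])
  then have subE: "mp.subspace ?E" by simp
  have "?E \<subseteq> forms t" using X3 LF s by (auto intro!: forms_add)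
  then have "?E = forms t"
    using mp.subspace_eq_of_dim_eq[OF _ forms_subset_span[OF order_refl] finite_monomials subE subspace_forms dimE] by blast
  then obtain v w b where "p = v + (X 3 * w + b)" "v \<in> ?L" "w \<in> forms s" "b \<in> A" using p by auto blast
  then show thesis using that[of w v] s by simp
qed

text \<open>If both conditions fail, every term of \<open>f\<close> in the relevant degree is
  divisible by x3^c. This power can be cancelled inside \<open>A\<close>, and the x3-free part of
  what remains consists of low monomials only, contradicting \<open>low\<close>.\<close>

lemma leading_monomial_imp:
  assumes f: "f \<in> A" "is_leading_monomial (mon a b c) f"
  shows "e (a + b) \<le> a \<or> \<sigma> < 2 * (a + b) + c"
proof (rule ccontr)
  assume "\<not> ?thesis"
  then have a: "a < e (a + b)" and c: "2 * (a + b) + c \<le> \<sigma>" by auto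
  define t where "t = a + b"
  define g where "g = hcomp (a + b + c) f"
  have g: "g \<in> A" "g \<in> forms (c + t)" "g \<in> forms (a + b + c)"
    using f hcomp_in_forms[of "c + t" f] by (auto simp: g_def t_def hcomp_closed add_ac)
  have "is_leading_monomial (mon a b c) g"
    using is_leading_monomial_hcomp[OF f(2)] by (simp add: g_def)
  then have lead: "Poly_Mapping.lookup g (mon a b c) \<noteq> 0"
      "\<And>a' b' c'. Poly_Mapping.lookup g (mon a' b' c') \<noteq> 0 \<Longrightarrow> c' > c \<or> c' = c \<and> b' \<ge> b"
    using is_leading_monomial_mon[OF g(3)] by auto
  obtain q r where qr: "g = X 3 ^ c * q + r" "q \<in> forms t" "r \<in> forms (c + t)"
    "\<And>a b d. Poly_Mapping.lookup q (mon a b d) = Poly_Mapping.lookup g (mon a b (c + d))"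
    "\<And>a b d. Poly_Mapping.lookup r (mon a b d) = (if d < c then Poly_Mapping.lookup g (mon a b d) else 0)"
    using X3_split[OF g(2)] by metis
  have "Poly_Mapping.lookup r m = 0" for m
    by (cases m rule: mon_cases) (use lead(2) qr(5) in force)
  then have "r = 0" by (intro poly_mapping_eqI) simp
  then have qA: "q \<in> A" using X3_power_inj[of t c q] c qr g by (simp add: t_def)
  have q1: "Poly_Mapping.lookup q (mon a b 0) \<noteq> 0" using qr(4) lead(1) by simp
  have q2: "b' \<ge> b" if "Poly_Mapping.lookup q (mon a' b' 0) \<noteq> 0" for a' b'
    using qr(4)[of a' b' 0] lead(2)[of a' b' c] that by simp
  show False
  \<comment> \<open>\<open>low\<close> speaks of positive degrees only. In degree 0 the quotient
    \<open>q\<close> is a nonzero constant, which \<open>one\<close> forbids.\<close>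
  proof (cases "t = 0")
    case True
    define k where "k = Poly_Mapping.lookup q (mon 0 0 0)"
    have "q = Const k"
    proof (rule poly_mapping_eqI)
      fix m show "Poly_Mapping.lookup q m = Poly_Mapping.lookup (Const k) m"
        using qr(2) True by (cases m rule: mon_cases) (auto simp: forms_iff Const_def k_def lookup_single when_def simp flip: mon_zero)
    qed
    moreover have "k \<noteq> 0" using q1 True by (simp add: k_def t_def)
    ultimately have "Const (inverse k) * q = 1" by (simp flip: Const_hom)
    then show False using ideal_mult[OF idl qA, of "Const (inverse k)"] one by simp
  next
    case False
    then obtain s where s: "t = 1 + s" by (metis Suc_pred' not_gr_zero plus_1_eq_Suc)
    obtain q' r' where qr': "q = X 3 ^ 1 * q' + r'" "q' \<in> forms s" "r' \<in> forms (1 + s)"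
      "\<And>a b d. Poly_Mapping.lookup r' (mon a b d) = (if d < 1 then Poly_Mapping.lookup q (mon a b d) else 0)"
      using X3_split[of q 1 s] qr(2) s by metis
    have "Poly_Mapping.lookup r' m = 0" if "m \<notin> low_monomials (e t) t" for m
    proof (rule ccontr)
      assume m: "Poly_Mapping.lookup r' m \<noteq> 0"
      obtain a' b' c' where [simp]: "m = mon a' b' c'" by (rule mon_cases)
      have "c' = 0" "Poly_Mapping.lookup q (mon a' b' 0) \<noteq> 0" using m qr'(4)[of a' b' c'] by (auto split: if_splits)
      moreover have "a' + b' = t"
        using qr'(3)[unfolded forms_iff, rule_format, of m] m s \<open>c' = 0\<close> by auto
      ultimately show False using that q2[of a' b'] a by (auto simp: low_monomials_def t_def)
    qed
    then have "r' \<in> supported (low_monomials (e t) t)" by (simp add: supported_iff)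
    moreover have "X 3 * q' + r' \<in> A" using qA qr'(1) by simp
    ultimately have "r' = 0"
      using low[of t] False c qr'(2) s by (auto simp: avoids_low_def t_def)
    then show False using qr'(4)[of a b 0] q1 by simp
  qed
qed

text \<open>Each case rewrites the monomial modulo \<open>A\<close> by smaller terms: multiples of a
  higher power of x3, obtained from surjectivity, or low monomials, whose x1-exponent is below
  \<open>e (a + b) \<le> a\<close>. Multiplying by x3 then raises the x3-exponent to
  \<open>c\<close>.\<close>

lemma leading_monomial_exists:
  assumes "e (a + b) \<le> a \<or> \<sigma> < 2 * (a + b) + c"
  shows "\<exists>f\<in>A. is_leading_monomial (mon a b c) f"
proof -
  define t where "t = a + b"
  have shift: "\<exists>f\<in>A. is_leading_monomial (mon a b c) f"
    if "f \<in> A" "f \<in> forms (t + c')" "is_leading_monomial (mon a b c') f" "c' \<le> c" for f c'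
    using is_leading_monomial_X3_mult[OF that(3), of "c - c'"] that ideal_mult[OF idl that(1), of "X 3 ^ (c - c')"]
    by (auto simp: t_def)
  have shift2: "\<exists>f\<in>A. is_leading_monomial (mon a b c) f"
    if q: "Poly_Mapping.single (mon a b c') 1 - X 3 ^ k * q \<in> A" "q \<in> forms n" "k + n = t + c'" "c' < k" "c' \<le> c" for q k n c'
  proof -
    have "X 3 ^ k * q \<in> forms (t + c')" using forms_mult[OF X3_power_forms q(2), of k] q(3) by simp
    moreover have "Poly_Mapping.single (mon a b c') 1 \<in> (forms (t + c') :: 'a poly3 set)"
      using forms_single[of "mon a b c'" "1 :: 'a"] by (simp add: t_def)
    ultimately have F: "Poly_Mapping.single (mon a b c') 1 - X 3 ^ k * q \<in> forms (t + c')" by (rule forms_diff[rotated])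
    moreover have "is_leading_monomial (mon a b c') (Poly_Mapping.single (mon a b c') 1 - X 3 ^ k * q)"
      using F q(4) by (subst is_leading_monomial_mon)
        (auto simp: t_def lookup_minus lookup_X3_power_mult lookup_single when_def split: if_splits)
    ultimately show ?thesis using shift[OF q(1)] q(5) by blast
  qed
  have single: "Poly_Mapping.single (mon a b c') 1 \<in> (forms (a + b + c') :: 'a poly3 set)" for c'
    using forms_single[of "mon a b c'" "1 :: 'a"] by simp
  show ?thesis
  proof (cases "\<sigma> < t")
    case True
    then have "Poly_Mapping.single (mon a b 0) 1 - X 3 ^ t * 0 \<in> A"
      using forms_above_socle[OF True] single[of 0] by (auto simp: t_def)
    then show ?thesis using shift2[of 0 t 0 0] True by simp
  next
    case le: False
    show ?thesis
    \<comment> \<open>Here even the monomial without x3 is initial. The case is separate because the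
      exponent \<open>\<sigma> + 1 - 2 * t\<close> used below would be truncated.\<close>
    proof (cases "\<sigma> + 2 \<le> 2 * t")
      case True
      have ar: "2 * (\<sigma> - t) + (2 * t - \<sigma>) = \<sigma>" "(2 * t - \<sigma>) + (\<sigma> - t) = t" using le True by auto
      have "Poly_Mapping.single (mon a b 0) 1 \<in> (forms ((2 * t - \<sigma>) + (\<sigma> - t)) :: 'a poly3 set)"
        unfolding ar using single[of 0] by (simp add: t_def)
      then obtain q where "q \<in> forms (\<sigma> - t)" "Poly_Mapping.single (mon a b 0) 1 - X 3 ^ (2 * t - \<sigma>) * q \<in> A"
        using X3_power_surj[OF ar(1)] by blast
      then show ?thesis using shift2[of 0 "2 * t - \<sigma>" q "\<sigma> - t"] le True by simp
    next
      case le2: False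
      show ?thesis
      proof (cases "\<sigma> < 2 * t + c")
        case True
        \<comment> \<open>The least x3-exponent satisfying the second condition. The power
          \<open>c0 + 1\<close> of x3 links degree \<open>t - 1\<close> to the symmetric degree
          \<open>t + c0\<close>, so the rewritten form has strictly larger x3-exponent.\<close>
        define c0 where "c0 = \<sigma> + 1 - 2 * t"
        have c0: "2 * t + c0 = \<sigma> + 1" "c0 \<le> c" using le2 True by (auto simp: c0_def)
        show ?thesis
        proof (cases "t = 0")
          case True
          then have "forms (t + c0) \<subseteq> A" using c0 by (intro forms_above_socle) simp
          then have "Poly_Mapping.single (mon a b c0) 1 - X 3 ^ (c0 + 1) * 0 \<in> A"
            using single[of c0] by (auto simp: t_def)
          moreover have "is_leading_monomial (mon a b c0) (Poly_Mapping.single (mon a b c0) (1::'a))"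
            by (simp add: is_leading_monomial_def)
          ultimately show ?thesis using shift[of "Poly_Mapping.single (mon a b c0) 1" c0] c0 single[of c0] by (simp add: t_def)
        next
          case False
          have ar: "2 * (t - 1) + (c0 + 1) = \<sigma>" "(c0 + 1) + (t - 1) = t + c0" using c0 False by auto
          have "Poly_Mapping.single (mon a b c0) 1 \<in> (forms ((c0 + 1) + (t - 1)) :: 'a poly3 set)"
            unfolding ar using single[of c0] by (simp add: t_def)
          then obtain q where "q \<in> forms (t - 1)" "Poly_Mapping.single (mon a b c0) 1 - X 3 ^ (c0 + 1) * q \<in> A"
            using X3_power_surj[OF ar(1)] by blast
          then show ?thesis using shift2[of c0 "c0 + 1" q "t - 1"] c0 False by simp
        qed
      next
        case False
        then have ea: "e t \<le> a" "2 * t \<le> \<sigma>" using assms by (auto simp: t_def)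
        have "t \<noteq> 0" using ea e0 by (cases "t = 0") (auto simp: t_def)
        then have "1 \<le> t" by simp
        moreover have "Poly_Mapping.single (mon a b 0) 1 \<in> (forms t :: 'a poly3 set)" using single[of 0] by (simp add: t_def)
        ultimately obtain q r where qr: "q \<in> forms (t - 1)" "r \<in> supported (low_monomials (e t) t)"
            "Poly_Mapping.single (mon a b 0) 1 - X 3 * q - r \<in> A"
          using low_decomposition[of t "Poly_Mapping.single (mon a b 0) 1"] ea(2) by blast
        let ?f = "Poly_Mapping.single (mon a b 0) 1 - X 3 * q - r"
        have "X 3 * q \<in> forms t" using forms_mult[OF X_in_forms qr(1), of 3] \<open>t \<noteq> 0\<close> by simp
        moreover have "r \<in> forms t" using qr(2) low_monomials_forms[OF e_le] by blast
        ultimately have F: "?f \<in> forms (t + 0)" using single[of 0] by (auto simp: t_def intro: forms_diff)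
        have r: "b < b' \<and> c' = 0" if "Poly_Mapping.lookup r (mon a' b' c') \<noteq> 0" for a' b' c'
        proof -
          have "mon a' b' c' \<in> low_monomials (e t) t" using that qr(2) by (auto simp: supported_iff)
          then show ?thesis using ea by (auto simp: low_monomials_def t_def)
        qed
        have X: "c' > 0" if "Poly_Mapping.lookup (X 3 * q) (mon a' b' c') \<noteq> 0" for a' b' c'
          using that lookup_X3_power_mult[of 1 q a' b' c'] by (auto split: if_splits)
        have "is_leading_monomial (mon a b 0) ?f"
        proof (subst is_leading_monomial_mon)
          show "?f \<in> forms (a + b + 0)" using F by (simp add: t_def)
          have "Poly_Mapping.lookup r (mon a b 0) = 0" using r by force
          moreover have "Poly_Mapping.lookup (X 3 * q) (mon a b 0) = 0" using X by force
          ultimately have "Poly_Mapping.lookup ?f (mon a b 0) \<noteq> 0" by (simp add: lookup_minus)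
          moreover have "c' > 0 \<or> b' \<ge> b" if "Poly_Mapping.lookup ?f (mon a' b' c') \<noteq> 0" for a' b' c'
            using that r[of a' b' c'] X[of a' b' c']
            by (cases "Poly_Mapping.lookup r (mon a' b' c') = 0"; cases "Poly_Mapping.lookup (X 3 * q) (mon a' b' c') = 0")
              (auto simp: lookup_minus lookup_single when_def split: if_splits)
          ultimately show "Poly_Mapping.lookup ?f (mon a b 0) \<noteq> 0 \<and>
            (\<forall>a' b' c'. Poly_Mapping.lookup ?f (mon a' b' c') \<noteq> 0 \<longrightarrow> 0 < c' \<or> c' = 0 \<and> b \<le> b')" by auto
        qed
        then show ?thesis using shift[of ?f 0] qr(3) F by simp
      qed
    qed
  qed
qed

lemma initial_ideal_eq:
  "initial_ideal A = ideal_gen {mono3 a b c |a b c. e (a + b) \<le> a \<or> \<sigma> < 2 * (a + b) + c}"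
proof -
  have *: "(\<exists>f\<in>A. is_leading_monomial (mon a b c) f) \<longleftrightarrow> e (a + b) \<le> a \<or> \<sigma> < 2 * (a + b) + c" for a b c
    using leading_monomial_imp leading_monomial_exists by blast
  have "{Poly_Mapping.single m (1::'a) | m. \<exists>f\<in>A. is_leading_monomial m f}
    = {mono3 a b c |a b c. e (a + b) \<le> a \<or> \<sigma> < 2 * (a + b) + c}" (is "?L = ?R")
  proof
    show "?L \<subseteq> ?R"
    proof
      fix p assume "p \<in> ?L"
      then obtain m where m: "p = Poly_Mapping.single m 1" "\<exists>f\<in>A. is_leading_monomial m f" by blast
      obtain a b c where "m = mon a b c" by (rule mon_cases)
      then show "p \<in> ?R" using m * unfolding mono3_eq by auto
    qed
    show "?R \<subseteq> ?L" using * unfolding mono3_eq by auto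
  qed
  then show ?thesis by (simp add: initial_ideal_def)
qed

end

subsection \<open>Linear substitutions and uniqueness of the generic initial ideal\<close>

interpretation Const_eval: coeff_hom "Const :: 'a::comm_ring_1 \<Rightarrow> ('v, 'a) mpol"
  by standard simp_all

interpretation id_eval: coeff_hom "id :: 'a::comm_ring_1 \<Rightarrow> 'a"
  by standard simp_all

lemma (in coeff_hom) eval_mpol_prod: "eval_mpol h s (prod f A) = (\<Prod>i\<in>A. eval_mpol h s (f i))"
  by (induction A rule: infinite_finite_induct) (simp_all add: eval_mpol_mult)

lemma (in coeff_hom) eval_mpol_mon_eval: "eval_mpol h s (mon_eval u m) = mon_eval (\<lambda>i. eval_mpol h s (u i)) m"
  by (simp add: mon_eval_def eval_mpol_prod eval_mpol_power)

definition lin_form :: "'a::comm_ring_1 ^ 3 ^ 3 \<Rightarrow> 3 \<Rightarrow> 'a poly3" where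
  "lin_form g j = (\<Sum>i\<in>UNIV. Const (g $ i $ j) * X i)"

lemma lin_act_eq: "lin_act g = eval_mpol Const (lin_form g)"
  by (simp add: lin_act_def lin_form_def[abs_def])

lemma lin_act_hom:
  "lin_act g 0 = 0" "lin_act g 1 = 1" "lin_act g (Const c) = Const c" "lin_act g (X j) = lin_form g j"
  "lin_act g (p + q) = lin_act g p + lin_act g q" "lin_act g (p - q) = lin_act g p - lin_act g q"
  "lin_act g (- p) = - lin_act g p"
  "lin_act g (p * q) = lin_act g p * lin_act g q" "lin_act g (p ^ n) = lin_act g p ^ n"
  "lin_act g (smul c p) = smul c (lin_act g p)"
  by (simp_all add: lin_act_eq Const_eval.eval_mpol_add Const_eval.eval_mpol_diff Const_eval.eval_mpol_uminus
      Const_eval.eval_mpol_mult Const_eval.eval_mpol_power smul_def)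

lemma lin_act_sum: "lin_act g (sum f A) = (\<Sum>i\<in>A. lin_act g (f i))"
  by (simp add: lin_act_eq Const_eval.eval_mpol_sum)

lemma lin_act_single: "lin_act g (Poly_Mapping.single m c) = Const c * mon_eval (lin_form g) m"
  by (simp add: lin_act_eq Const_eval.eval_mpol_single)

text \<open>The columns of a matrix hold the images of the variables, so acting by \<open>h\<close>
  and then by \<open>g\<close> is acting by \<open>g ** h\<close>.\<close>

lemma lin_act_lin_form: "lin_act g (lin_form h j) = lin_form (g ** h) j"
  by (simp add: lin_form_def lin_act_hom sum_3 matrix_matrix_mult_def algebra_simps)

lemma lin_act_lin_act: "lin_act g (lin_act h p) = lin_act (g ** h) p"
proof (induction p rule: mpol_induct)
  case (single m c)
  have "lin_act g (mon_eval (lin_form h) m) = mon_eval (\<lambda>j. lin_act g (lin_form h j)) m"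
    by (simp add: lin_act_eq[of g] Const_eval.eval_mpol_mon_eval)
  then show ?case by (simp add: lin_act_single lin_act_hom lin_act_lin_form)
qed (simp add: lin_act_hom)

lemma lin_act_mat_1: "lin_act (mat 1) p = p"
proof (induction p rule: mpol_induct)
  case (single m c)
  have "lin_form (mat 1) j = (X j :: 'a poly3)" for j :: 3
    using exhaust_3[of j] by (auto simp: lin_form_def sum_3 mat_def)
  then have "mon_eval (lin_form (mat 1)) m = Poly_Mapping.single m (1::'a)"
    by (cases m rule: mon_cases) (simp add: mon_eval_mon mono3_eq flip: mono3_def)
  then show ?case by (simp add: lin_act_single Const_def mult_single)
qed (simp add: lin_act_hom)

lemma lin_form_forms: "lin_form g j \<in> forms 1"
proof -
  have "Const c * X i \<in> (forms 1 :: 'a poly3 set)" for c and i :: 3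
    using forms_smul[OF X_in_forms, of c i] by (simp add: smul_def)
  then show ?thesis unfolding lin_form_def by (intro forms_sum)
qed

lemma mon_eval_lin_form_forms: "mon_eval (lin_form g) m \<in> forms (mdeg m)"
proof -
  obtain a b c where [simp]: "m = mon a b c" by (rule mon_cases)
  have "lin_form g j ^ n \<in> forms n" for j n using forms_power[OF lin_form_forms, of g j n] by simp
  then have "lin_form g 1 ^ a * lin_form g 2 ^ b * lin_form g 3 ^ c \<in> forms (a + b + c)"
    by (intro forms_mult)
  then show ?thesis by (simp add: mon_eval_mon)
qed

lemma hcomp_lin_act: "hcomp n (lin_act g p) = lin_act g (hcomp n p)"
proof (induction p rule: mpol_induct)
  case (single m c)
  have "lin_act g (Poly_Mapping.single m c) \<in> forms (mdeg m)"
    using forms_smul[OF mon_eval_lin_form_forms, of c g m] by (simp add: lin_act_single smul_def)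
  then show ?case by (simp add: hcomp_forms[of _ "mdeg m"] lin_act_hom)
qed (simp add: lin_act_hom hcomp_add)

lemma forms_iff_hcomp: "p \<in> forms n \<longleftrightarrow> hcomp n p = p"
  by (metis hcomp_forms hcomp_in_forms)

lemma lin_act_forms: "p \<in> forms n \<Longrightarrow> lin_act g p \<in> forms n"
  by (simp add: forms_iff_hcomp hcomp_lin_act)

text \<open>Naming the inverse turns membership in an image under \<open>g\<close> into membership
  of the preimage under \<open>h\<close>, and nearly all transport of properties reduces to
  this.\<close>

locale inverse_pair =
  fixes g h :: "'a::field ^ 3 ^ 3"
  assumes gh: "g ** h = mat 1" and hg: "h ** g = mat 1"
begin

lemma lin_act_inverse [simp]: "lin_act g (lin_act h p) = p" "lin_act h (lin_act g p) = p"
  by (simp_all add: lin_act_lin_act gh hg lin_act_mat_1)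

lemma lin_act_image_iff: "p \<in> lin_act g ` I \<longleftrightarrow> lin_act h p \<in> I"
  by (metis image_iff lin_act_inverse)

lemma lin_act_forms_iff: "lin_act g p \<in> forms n \<longleftrightarrow> p \<in> forms n"
  using lin_act_forms[of p n g] lin_act_forms[of "lin_act g p" n h] by auto

lemma homogeneous_ideal_image:
  assumes "homogeneous_ideal I"
  shows "homogeneous_ideal (lin_act g ` I)"
  using assms unfolding homogeneous_ideal_def ideal_def lin_act_image_iff
  by (simp add: lin_act_hom hcomp_lin_act[symmetric] Ball_def lin_act_image_iff)

lemma one_image: "1 \<notin> I \<Longrightarrow> 1 \<notin> lin_act g ` I"
  by (simp add: lin_act_image_iff lin_act_hom)

lemma hilbert_image:
  assumes I: "ideal I"
  shows "hilbert (lin_act g ` I) n = hilbert I n"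
proof -
  have eq: "lin_act g ` I \<inter> forms k = {lin_act g v + b |v b. v \<in> I \<inter> forms k \<and> b \<in> {0}}" for k
    by (auto simp: lin_act_forms_iff image_iff)
  have zero: "{v \<in> I \<inter> forms k. lin_act g v \<in> {0}} = {0}" for k
  proof -
    have "v = 0" if "lin_act g v = 0" for v using lin_act_inverse(2)[of v] that by (simp add: lin_act_hom)
    then show ?thesis using ideal_zero[OF I] by (auto simp: lin_act_hom)
  qed
  have hom: "module_hom smul smul (lin_act g)"
    by (simp add: module_hom_def module_hom_axioms_def mp.module_axioms lin_act_hom)
  have "mp.dim (lin_act g ` I \<inter> forms k) = mp.dim (I \<inter> forms k)" for k
    using mp.dim_linear_image_sum[OF hom subspace_ideal_forms[OF I] forms_subset_span finite_monomials
        mp.subspace_single_0, of k k "{}"]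
    unfolding eq zero by simp
  then show ?thesis by (simp add: hilbert_def)
qed

end

section \<open>Polynomial functions on matrices and uniqueness\<close>

definition poly_fun :: "('a::field ^ 3 ^ 3 \<Rightarrow> 'a) \<Rightarrow> bool" where
  "poly_fun f \<longleftrightarrow> (\<exists>p. \<forall>g. f g = eval_mpol id (\<lambda>(i, j). g $ i $ j) p)"

lemma poly_fun_const [intro]: "poly_fun (\<lambda>g. c)"
  unfolding poly_fun_def by (rule exI[of _ "Const c"]) simp

lemma poly_fun_entry [intro]: "poly_fun (\<lambda>g. g $ i $ j)"
  unfolding poly_fun_def by (rule exI[of _ "X (i, j)"]) simp

lemma poly_fun_add [intro]: "poly_fun f \<Longrightarrow> poly_fun f' \<Longrightarrow> poly_fun (\<lambda>g. f g + f' g)"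
  unfolding poly_fun_def by (metis id_eval.eval_mpol_add)

lemma poly_fun_mult [intro]: "poly_fun f \<Longrightarrow> poly_fun f' \<Longrightarrow> poly_fun (\<lambda>g. f g * f' g)"
  unfolding poly_fun_def by (metis id_eval.eval_mpol_mult)

lemma poly_fun_diff [intro]: "poly_fun f \<Longrightarrow> poly_fun f' \<Longrightarrow> poly_fun (\<lambda>g. f g - f' g)"
  unfolding poly_fun_def by (metis id_eval.eval_mpol_diff)

lemma poly_fun_prod: "(\<And>i. i \<in> A \<Longrightarrow> poly_fun (f i)) \<Longrightarrow> poly_fun (\<lambda>g. \<Prod>i\<in>A. f i g)"
  by (induction A rule: infinite_finite_induct) (simp_all add: poly_fun_const poly_fun_mult)

lemma poly_fun_det: "poly_fun det"
  unfolding det_3[abs_def] by (intro poly_fun_add poly_fun_diff poly_fun_mult poly_fun_entry)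

interpretation poly_eval: coeff_hom "\<lambda>c::'a::comm_ring_1. [:c:]"
  by standard (simp_all add: one_pCons)

lemma poly_fun_line:
  assumes "poly_fun f"
  obtains P where "\<And>s. poly P s = f (\<chi> i j. g0 $ i $ j + s * (g1 $ i $ j - g0 $ i $ j))"
proof -
  obtain p where p: "\<And>g. f g = eval_mpol id (\<lambda>(i, j). g $ i $ j) p"
    using assms by (auto simp: poly_fun_def)
  define u where "u = (\<lambda>(i, j). [:g0 $ i $ j, g1 $ i $ j - g0 $ i $ j:])"
  have "poly (mon_eval u m) s = mon_eval (\<lambda>k. poly (u k) s) m" for m s
    by (simp add: mon_eval_def poly_prod)
  then have "poly (eval_mpol (\<lambda>c. [:c:]) u q) s = eval_mpol id (\<lambda>k. poly (u k) s) q" for q s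
    by (induction q rule: mpol_induct)
      (simp_all add: poly_eval.eval_mpol_single poly_eval.eval_mpol_add id_eval.eval_mpol_single id_eval.eval_mpol_add)
  moreover have "(\<lambda>k. poly (u k) s) = (\<lambda>(i, j). (\<chi> i j. g0 $ i $ j + s * (g1 $ i $ j - g0 $ i $ j)) $ i $ j)" for s
    by (auto simp: u_def)
  ultimately show thesis using that[of "eval_mpol (\<lambda>c. [:c:]) u p"] p by simp
qed

text \<open>Restricted to the line through \<open>g0\<close> and \<open>g1\<close>, both functions
  become nonzero univariate polynomials. Their product has finitely many roots, while the field is
  infinite.\<close>

lemma poly_fun_common_nonzero:
  fixes g0 g1 :: "'a::field_char_0 ^ 3 ^ 3"
  assumes "poly_fun f" "f g0 \<noteq> 0" "poly_fun f'" "f' g1 \<noteq> 0"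
  obtains g where "f g \<noteq> 0" "f' g \<noteq> 0"
proof -
  let ?l = "\<lambda>s. \<chi> i j. g0 $ i $ j + s * (g1 $ i $ j - g0 $ i $ j)"
  obtain P where P: "\<And>s. poly P s = f (?l s)" by (rule poly_fun_line[OF assms(1), of g0 g1]) blast
  obtain Q where Q: "\<And>s. poly Q s = f' (?l s)" by (rule poly_fun_line[OF assms(3), of g0 g1]) blast
  have "?l 0 = g0" "?l 1 = g1" by (simp_all add: vec_eq_iff)
  then have "poly P 0 \<noteq> 0" "poly Q 1 \<noteq> 0" using P[of 0] Q[of 1] assms by simp_all
  then have "P * Q \<noteq> 0" by auto
  then have "finite {s. poly (P * Q) s = 0}" by (rule poly_roots_finite)
  then obtain s where "poly (P * Q) s \<noteq> 0"
    using ex_new_if_finite[OF infinite_UNIV_char_0] by blast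
  then show thesis using that[of "?l s"] P Q by simp
qed

text \<open>Two nonempty open sets share a point. The determinant is multiplied into one of the two
  polynomials so that the common point is invertible.\<close>

lemma is_gin_unique:
  fixes I :: "'a::field_char_0 poly3 set"
  assumes "is_gin I J" "is_gin I J'"
  shows "J = J'"
proof -
  have *: "\<exists>p g0. poly_fun p \<and> p g0 \<noteq> 0 \<and> (\<forall>g. det g \<noteq> 0 \<longrightarrow> p g \<noteq> 0 \<longrightarrow> initial_ideal (lin_act g ` I) = K) \<and> det g0 \<noteq> 0"
    if K: "is_gin I K" for K
  proof -
    obtain P :: "(3 \<times> 3, 'a) mpol set" and U where P: "U = {g. invertible g \<and> (\<exists>p\<in>P. eval_mpol id (\<lambda>(i, j). g $ i $ j) p \<noteq> 0)}" 
      "U \<noteq> {}" "\<forall>g\<in>U. initial_ideal (lin_act g ` I) = K"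
      using K unfolding is_gin_def zariski_open_GL3_def by blast
    then obtain g0 p where g0: "invertible g0" "p \<in> P" "eval_mpol id (\<lambda>(i, j). g0 $ i $ j) p \<noteq> 0" by blast
    let ?p = "\<lambda>g. eval_mpol id (\<lambda>(i, j). g $ i $ j) p"
    have "poly_fun ?p" by (auto simp: poly_fun_def)
    moreover have "initial_ideal (lin_act g ` I) = K" if "det g \<noteq> 0" "?p g \<noteq> 0" for g
      using that P g0 by (auto simp: invertible_det_nz)
    ultimately show ?thesis using g0 by (intro exI[of _ ?p] exI[of _ g0]) (simp add: invertible_det_nz)
  qed
  obtain p g0 where p: "poly_fun p" "p g0 \<noteq> 0" "\<And>g. det g \<noteq> 0 \<Longrightarrow> p g \<noteq> 0 \<Longrightarrow> initial_ideal (lin_act g ` I) = J" "det g0 \<noteq> 0"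
    using *[OF assms(1)] by blast
  obtain q g1 where q: "poly_fun q" "q g1 \<noteq> 0" "\<And>g. det g \<noteq> 0 \<Longrightarrow> q g \<noteq> 0 \<Longrightarrow> initial_ideal (lin_act g ` I) = J'"
    using *[OF assms(2)] by blast
  have "poly_fun (\<lambda>g. det g * p g)" using poly_fun_det p(1) by blast
  then obtain g where "det g * p g \<noteq> 0" "q g \<noteq> 0"
    using poly_fun_common_nonzero[of "\<lambda>g. det g * p g" g0 q g1] p q by auto
  then show ?thesis using p(3)[of g] q(3)[of g] by simp
qed

subsection \<open>Openness\<close>

text \<open>The vectors \<open>v j g\<close> depend on a parameter \<open>g\<close> and are given by
  their coordinates \<open>i\<close>, which may range over an infinite type such as all
  monomials.\<close>

definition independent_at :: "'j set \<Rightarrow> ('j \<Rightarrow> 'z \<Rightarrow> 'i \<Rightarrow> 'a::field) \<Rightarrow> 'z \<Rightarrow> bool" where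
  "independent_at J v g \<longleftrightarrow> (\<forall>c. (\<forall>i. (\<Sum>j\<in>J. c j * v j g i) = 0) \<longrightarrow> (\<forall>j\<in>J. c j = 0))"

text \<open>Gaussian elimination, with all pivots chosen to be nonzero at the given point.\<close>

lemma independent_at_open:
  assumes "finite J" "\<And>j i. j \<in> J \<Longrightarrow> poly_fun (\<lambda>g. v j g i)" "independent_at J v g1"
  shows "\<exists>p. poly_fun p \<and> p g1 \<noteq> 0 \<and> (\<forall>g. p g \<noteq> 0 \<longrightarrow> independent_at J v g)"
  using assms
proof (induction J arbitrary: v rule: finite_induct)
  case empty
  show ?case by (rule exI[of _ "\<lambda>g. 1"]) (auto simp: independent_at_def)
next
  case (insert k J)
  have "\<exists>i. v k g1 i \<noteq> 0"
  proof (rule ccontr)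
    assume "\<not> ?thesis"
    then have "\<forall>i. (\<Sum>j\<in>insert k J. (if j = k then 1 else 0) * v j g1 i) = 0"
      by (auto intro!: sum.neutral)
    then show False
      using insert.prems(2)[unfolded independent_at_def, rule_format, of "\<lambda>j. if j = k then 1 else 0" k] by simp
  qed
  then obtain i0 where i0: "v k g1 i0 \<noteq> 0" by blast
  \<comment> \<open>Elimination of coordinate \<open>i0\<close> by cross-multiplication with the
    pivot instead of division, so that the entries remain polynomial in \<open>g\<close>.\<close>
  define w where "w = (\<lambda>j g i. v k g i0 * v j g i - v j g i0 * v k g i)"
  have sum_w: "(\<Sum>j\<in>J. c j * w j g i) = v k g i0 * (\<Sum>j\<in>J. c j * v j g i) - (\<Sum>j\<in>J. c j * v j g i0) * v k g i" for c g i
    by (simp add: w_def right_diff_distrib sum_subtractf sum_distrib_left sum_distrib_right mult_ac)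
  have "independent_at J w g1"
    unfolding independent_at_def
  proof (intro allI impI)
    fix c assume c: "\<forall>i. (\<Sum>j\<in>J. c j * w j g1 i) = 0"
    \<comment> \<open>A relation among the eliminated vectors, lifted to the original ones: the old
      coefficients are scaled by the pivot and the coefficient at \<open>k\<close> compensates
      coordinate \<open>i0\<close>.\<close>
    define c' where "c' j = (if j = k then - (\<Sum>j\<in>J. c j * v j g1 i0) else v k g1 i0 * c j)" for j
    have "(\<Sum>j\<in>J. c' j * v j g1 i) = v k g1 i0 * (\<Sum>j\<in>J. c j * v j g1 i)" for i
      using insert.hyps by (auto simp: c'_def sum_distrib_left mult_ac intro!: sum.cong)
    then have "(\<Sum>j\<in>insert k J. c' j * v j g1 i) = 0" for i
      using c sum_w[of c g1 i] insert.hyps by (simp add: c'_def)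
    then have "\<forall>j\<in>insert k J. c' j = 0"
      using insert.prems(2) unfolding independent_at_def by blast
    then show "\<forall>j\<in>J. c j = 0" using i0 insert.hyps by (auto simp: c'_def split: if_splits)
  qed
  moreover have "poly_fun (\<lambda>g. w j g i)" if "j \<in> J" for j i
    unfolding w_def using insert.prems(1) that by (intro poly_fun_diff poly_fun_mult) auto
  ultimately obtain p where p: "poly_fun p" "p g1 \<noteq> 0" "\<And>g. p g \<noteq> 0 \<Longrightarrow> independent_at J w g"
    using insert.IH[of w] by blast
  have "independent_at (insert k J) v g" if g: "p g * v k g i0 \<noteq> 0" for g
    unfolding independent_at_def
  proof (intro allI impI)
    fix c assume c: "\<forall>i. (\<Sum>j\<in>insert k J. c j * v j g i) = 0"
    have S: "(\<Sum>j\<in>J. c j * v j g i) = - (c k * v k g i)" for i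
      using c[rule_format, of i] insert.hyps by (simp add: eq_neg_iff_add_eq_0 add.commute)
    have "(\<Sum>j\<in>J. c j * w j g i) = 0" for i
      unfolding sum_w S by (simp add: mult_ac)
    then have J: "\<forall>j\<in>J. c j = 0" using p(3)[of g] g unfolding independent_at_def by auto
    then have "c k * v k g i0 = 0" using S[of i0] by simp
    then show "\<forall>j\<in>insert k J. c j = 0" using J g by auto
  qed
  moreover have "poly_fun (\<lambda>g. p g * v k g i0)"
    using p(1) insert.prems(1)[of k i0] by auto
  ultimately show ?case using p(2) i0 by (intro exI[of _ "\<lambda>g. p g * v k g i0"]) auto
qed

text \<open>Polynomials whose coefficients are polynomial functions of the matrix. The inductive
  form reduces closure under products to terms with a single monomial.\<close>

inductive poly_vec :: "('a::field ^ 3 ^ 3 \<Rightarrow> ('v, 'a) mpol) \<Rightarrow> bool" where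
  single: "poly_fun f \<Longrightarrow> poly_vec (\<lambda>g. Poly_Mapping.single m (f g))"
| add: "poly_vec u \<Longrightarrow> poly_vec w \<Longrightarrow> poly_vec (\<lambda>g. u g + w g)"

lemma poly_vec_mult:
  assumes "poly_vec u" "poly_vec w"
  shows "poly_vec (\<lambda>g. u g * w g)"
  using assms(1)
proof induction
  case u: (single f m)
  show ?case using assms(2)
  proof induction
    case (single f' n)
    then show ?case using u by (simp add: mult_single poly_vec.single poly_fun_mult)
  qed (simp add: distrib_left poly_vec.add)
qed (simp add: distrib_right poly_vec.add)

lemma poly_vec_const: "poly_vec (\<lambda>g. p)"
  by (induction p rule: mpol_induct) (auto intro: poly_vec.intros)

lemma poly_vec_power: "poly_vec u \<Longrightarrow> poly_vec (\<lambda>g. u g ^ n)"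
  by (induction n) (simp_all add: poly_vec_const poly_vec_mult)

lemma poly_vec_lookup: "poly_vec u \<Longrightarrow> poly_fun (\<lambda>g. Poly_Mapping.lookup (u g) m)"
proof (induction rule: poly_vec.induct)
  case (single f n)
  then show ?case by (cases "n = m") (auto simp: lookup_single poly_fun_const)
qed (simp add: lookup_add poly_fun_add)

lemma poly_vec_lin_act: "poly_vec (\<lambda>g. lin_act g p)"
proof (induction p rule: mpol_induct)
  case (single m c)
  obtain a b d where [simp]: "m = mon a b d" by (rule mon_cases)
  have "poly_vec (\<lambda>g. Const (g $ i $ j) * X i)" for i j :: 3
    by (simp add: Const_def X_def mult_single poly_vec.single poly_fun_entry)
  then have lf: "poly_vec (\<lambda>g. lin_form g j)" for j
    unfolding lin_form_def sum_3 by (intro poly_vec.add)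
  show ?case
    unfolding lin_act_single \<open>m = mon a b d\<close> mon_eval_mon
    by (intro poly_vec_mult poly_vec_power lf poly_vec_const)
qed (simp add: lin_act_hom poly_vec.add)

text \<open>One condition for two purposes: \<open>R = {}\<close> is the Lefschetz injectivity,
  while \<open>k = 1\<close> with the low monomials adds \<open>avoids_low\<close> to injectivity of
  x3.\<close>

definition separated :: "'a::comm_ring_1 poly3 set \<Rightarrow> nat \<Rightarrow> nat \<Rightarrow> (3 \<Rightarrow>\<^sub>0 nat) set \<Rightarrow> bool" where
  "separated A k s R \<longleftrightarrow> (\<forall>q\<in>forms s. \<forall>r\<in>supported R. X 3 ^ k * q + r \<in> A \<longrightarrow> q \<in> A \<and> r = 0)"

text \<open>The condition says that three groups of vectors are jointly independent: the images of a
  basis \<open>B\<close> of degree \<open>k + s\<close> of \<open>I\<close>, x3^k times the images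
  of a basis \<open>C\<close> of a complement of \<open>I\<close> in degree \<open>s\<close>, and
  the monomials in \<open>R\<close>. Since \<open>B\<close> and \<open>C\<close> are chosen before
  \<open>g\<close>, the index set is fixed and only the vectors move.\<close>

lemma separated_open:
  fixes I :: "'a::field poly3 set"
  assumes I: "ideal I" and R: "R \<subseteq> {m. mdeg m = k + s}"
    and g1: "invertible g1" and sep: "separated (lin_act g1 ` I) k s R"
  obtains p where "poly_fun p" "p g1 \<noteq> 0"
    "\<And>g. invertible g \<Longrightarrow> p g \<noteq> 0 \<Longrightarrow> separated (lin_act g ` I) k s R"
proof -
  have finR: "finite R" using R finite_mons_of_degree finite_subset by blast
  have RF: "(supported R :: 'a poly3 set) \<subseteq> forms (k + s)" using R by (auto simp: forms_eq_supported supported_def)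
  obtain B0 C where C: "finite B0" "finite C" "B0 \<inter> C = {}" "mp.independent (B0 \<union> C)"
      "mp.span B0 = I \<inter> forms s" "mp.span (B0 \<union> C) = forms s"
    by (rule mp.finite_basis_extend[OF forms_subset_span[OF order_refl] finite_monomials
          Int_lower2[of I "forms s"] subspace_ideal_forms[OF I] subspace_forms]) blast
  obtain B where B: "finite B" "mp.independent B" "mp.span B = I \<inter> forms (k + s)"
  proof -
    obtain B where B: "B \<subseteq> I \<inter> forms (k + s)" "finite B" "mp.independent B" "I \<inter> forms (k + s) \<subseteq> mp.span B"
      by (rule mp.finite_basis[OF forms_subset_span[OF Int_lower2[of I "forms (k + s)"]] finite_monomials]) blast
    moreover have "mp.span B \<subseteq> I \<inter> forms (k + s)"
      using B(1) subspace_ideal_forms[OF I] by (rule mp.span_minimal)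
    ultimately show thesis using that by blast
  qed
  define J where "J = B <+> (C <+> R)"
  define v where "v = (\<lambda>j (g :: 'a ^ 3 ^ 3). Poly_Mapping.lookup (case j of Inl b \<Rightarrow> lin_act g b
      | Inr (Inl c) \<Rightarrow> X 3 ^ k * lin_act g c | Inr (Inr r) \<Rightarrow> Poly_Mapping.single r 1))"
  have finJ: "finite J" by (simp add: J_def B C finR)
  have vsum: "(\<Sum>j\<in>J. c j * v j g i) = Poly_Mapping.lookup (lin_act g (\<Sum>b\<in>B. smul (c (Inl b)) b)
      + X 3 ^ k * lin_act g (\<Sum>b\<in>C. smul (c (Inr (Inl b))) b)
      + (\<Sum>r\<in>R. Poly_Mapping.single r (c (Inr (Inr r))))) i" for c g i
    by (simp add: J_def v_def sum.Plus B C finR lin_act_sum lin_act_hom lookup_add lookup_sum sum_distrib_left mult_smul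
        single_mult_eq_smul[of _ "c _"] add.assoc)
  have indep_C: "\<forall>b\<in>C. u b = 0" if "(\<Sum>b\<in>C. smul (u b) b) \<in> I" for u
  proof -
    have "(\<Sum>b\<in>C. smul (u b) b) \<in> mp.span (B0 \<union> C)"
      by (intro mp.span_sum mp.span_scale mp.span_base) auto
    then have "(\<Sum>b\<in>C. smul (u b) b) \<in> mp.span B0" using that C by auto
    then obtain u' where u': "(\<Sum>b\<in>C. smul (u b) b) = (\<Sum>b\<in>B0. smul (u' b) b)"
      using mp.span_finite[OF C(1)] by auto
    define w where "w b = (if b \<in> C then u b else - u' b)" for b
    have "(\<Sum>b\<in>B0 \<union> C. smul (w b) b) = (\<Sum>b\<in>B0. smul (w b) b) + (\<Sum>b\<in>C. smul (w b) b)"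
      using C by (intro sum.union_disjoint) auto
    also have "(\<Sum>b\<in>B0. smul (w b) b) = (\<Sum>b\<in>B0. - smul (u' b) b)"
      using C(3) by (intro sum.cong) (auto simp: w_def mp.scale_minus_left)
    also have "(\<Sum>b\<in>C. smul (w b) b) = (\<Sum>b\<in>C. smul (u b) b)"
      by (intro sum.cong) (auto simp: w_def)
    finally have "(\<Sum>b\<in>B0 \<union> C. smul (w b) b) = 0" by (simp add: u' sum_negf)
    then have "\<forall>b\<in>B0 \<union> C. w b = 0"
      using C by (intro ballI mp.independentD[OF C(4), of "B0 \<union> C"]) auto
    then have "w b = 0" if "b \<in> C" for b using that by blast
    then show ?thesis by (simp add: w_def)
  qed
  have R_single: "(\<Sum>r\<in>R. Poly_Mapping.single r (u r)) \<in> supported R" for u :: "_ \<Rightarrow> 'a"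
    using mp.subspace_sum[OF subspace_supported, of R "\<lambda>r. Poly_Mapping.single r (u r)" R] by (auto simp: supported_def split: if_splits)
  have R_zero: "\<forall>r\<in>R. u r = 0" if "(\<Sum>r\<in>R. Poly_Mapping.single r (u r)) = 0" for u :: "_ \<Rightarrow> 'a"
  proof
    fix m assume "m \<in> R"
    then have "Poly_Mapping.lookup (\<Sum>r\<in>R. Poly_Mapping.single r (u r)) m = u m"
      using finR by (simp add: lookup_sum lookup_single when_def)
    then show "u m = 0" using that by simp
  qed
  have "independent_at J v g1"
    unfolding independent_at_def
  proof (intro allI impI)
    fix c assume c: "\<forall>i. (\<Sum>j\<in>J. c j * v j g1 i) = 0"
    obtain h where h: "g1 ** h = mat 1" "h ** g1 = mat 1" using g1 by (auto simp: invertible_def)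
    interpret inverse_pair g1 h using h by unfold_locales
    let ?b = "\<Sum>b\<in>B. smul (c (Inl b)) b" and ?q = "\<Sum>b\<in>C. smul (c (Inr (Inl b))) b"
      and ?r = "\<Sum>r\<in>R. Poly_Mapping.single r (c (Inr (Inr r)))"
    have eq: "lin_act g1 ?b + X 3 ^ k * lin_act g1 ?q + ?r = 0"
      using c unfolding vsum by (intro poly_mapping_eqI) simp
    have "?b \<in> mp.span B" by (intro mp.span_sum mp.span_scale mp.span_base) auto
    then have b: "?b \<in> I" using B by auto
    have "?q \<in> mp.span (B0 \<union> C)" by (intro mp.span_sum mp.span_scale mp.span_base) auto
    then have qs: "lin_act g1 ?q \<in> forms s" using C by (auto intro: lin_act_forms)
    have "X 3 ^ k * lin_act g1 ?q + ?r \<in> lin_act g1 ` I"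
    proof -
      have "X 3 ^ k * lin_act g1 ?q + ?r = lin_act g1 (- ?b)"
        using eq by (simp add: lin_act_hom eq_neg_iff_add_eq_0 add_ac)
      then show ?thesis using ideal_uminus[OF I b] by blast
    qed
    note qr = sep[unfolded separated_def, rule_format, OF qs R_single this]
    have q: "lin_act g1 ?q \<in> lin_act g1 ` I" by (rule qr[THEN conjunct1])
    have r: "?r = 0" by (rule qr[THEN conjunct2])
    have "?q \<in> I" using q by (simp add: lin_act_image_iff)
    then have cC: "\<forall>b\<in>C. c (Inr (Inl b)) = 0" by (rule indep_C)
    then have "?q = 0" by (intro sum.neutral) auto
    then have "lin_act g1 ?b = 0" using eq r by (simp add: lin_act_hom)
    then have "?b = 0" using lin_act_inverse(2)[of ?b] by (simp add: lin_act_hom)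
    then have "\<forall>b\<in>B. c (Inl b) = 0"
      using B by (intro ballI mp.independentD[OF B(2), of B]) auto
    moreover have "\<forall>r\<in>R. c (Inr (Inr r)) = 0" using R_zero[OF r] .
    ultimately show "\<forall>j\<in>J. c j = 0" using cC by (auto simp: J_def)
  qed
  moreover have "poly_fun (\<lambda>g. v j g i)" for j i
    unfolding v_def
  proof (rule poly_vec_lookup, cases j)
    case (Inr j')
    then show "poly_vec (\<lambda>g. case j of Inl b \<Rightarrow> lin_act g b
      | Inr (Inl c) \<Rightarrow> X 3 ^ k * lin_act g c | Inr (Inr r) \<Rightarrow> Poly_Mapping.single r 1)"
      by (cases j') (simp_all add: poly_vec_lin_act poly_vec_mult poly_vec_const)
  qed (simp add: poly_vec_lin_act)
  ultimately obtain p where p: "poly_fun p" "p g1 \<noteq> 0" "\<And>g. p g \<noteq> 0 \<Longrightarrow> independent_at J v g"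
    using independent_at_open[OF finJ, of v g1] by blast
  have "separated (lin_act g ` I) k s R" if g: "invertible g" "p g \<noteq> 0" for g
    unfolding separated_def
  proof (intro ballI impI)
    fix q r assume q: "q \<in> forms s" and r: "r \<in> supported R" and qr: "X 3 ^ k * q + r \<in> lin_act g ` I"
    obtain h where h: "g ** h = mat 1" "h ** g = mat 1" using g by (auto simp: invertible_def)
    interpret inverse_pair g h using h by unfold_locales
    have "lin_act h q \<in> mp.span (B0 \<union> C)" using q C by (simp add: lin_act_forms)
    then obtain x y where xy: "lin_act h q = x + y" "x \<in> mp.span B0" "y \<in> mp.span C"
      unfolding mp.span_Un by blast
    then obtain u where u: "y = (\<Sum>b\<in>C. smul (u b) b)" using mp.span_finite[OF C(2)] by auto
    have x: "x \<in> I" "x \<in> forms s" using xy C by auto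
    have "mp.span C \<subseteq> mp.span (B0 \<union> C)" by (rule mp.span_mono) simp
    then have y: "y \<in> forms s" using xy C by auto
    have qxy: "q = lin_act g x + lin_act g y" using xy(1) by (metis lin_act_hom(5) lin_act_inverse(1))
    \<comment> \<open>The part \<open>x\<close> of the preimage of \<open>q\<close> lies in
      \<open>I\<close>, so discarding it leaves \<open>b\<close> in \<open>I\<close>. Expanding
      \<open>b\<close> in \<open>B\<close> gives a vanishing combination of the whole
      family.\<close>
    define b where "b = lin_act h (X 3 ^ k * lin_act g y + r)"
    have X3: "X 3 ^ k \<in> (forms k :: 'a poly3 set)" using forms_power[OF X_in_forms, of 3 k] by simp
    have "X 3 ^ k * lin_act g y \<in> forms (k + s)" using X3 lin_act_forms[OF y] by (rule forms_mult)
    then have "b \<in> forms (k + s)" unfolding b_def using r RF by (intro lin_act_forms forms_add) auto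
    moreover have "b \<in> I"
    proof -
      have "lin_act h (X 3 ^ k * q + r) \<in> I" using qr by (simp add: lin_act_image_iff)
      moreover have "lin_act h (X 3 ^ k * q + r) = b + lin_act h (X 3 ^ k) * x"
        by (simp add: b_def qxy lin_act_hom distrib_left)
      ultimately show ?thesis using ideal_diff[OF I _ ideal_mult[OF I x(1), of "lin_act h (X 3 ^ k)"]]
        by (metis add_diff_cancel_right')
    qed
    ultimately have "b \<in> mp.span B" using B by blast
    then obtain w where w: "b = (\<Sum>b\<in>B. smul (w b) b)" using mp.span_finite[OF B(1)] by auto
    define c where "c j = (case j of Inl b \<Rightarrow> - w b | Inr (Inl b) \<Rightarrow> u b | Inr (Inr m) \<Rightarrow> Poly_Mapping.lookup r m)" for j
    have rr: "(\<Sum>m\<in>R. Poly_Mapping.single m (Poly_Mapping.lookup r m)) = r"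
      using r finR by (intro poly_mapping_eqI) (auto simp: lookup_sum lookup_single when_def supported_iff)
    have "(\<Sum>b\<in>B. smul (c (Inl b)) b) = - b" "(\<Sum>b\<in>C. smul (c (Inr (Inl b))) b) = y"
      "(\<Sum>m\<in>R. Poly_Mapping.single m (c (Inr (Inr m)))) = r"
      using rr by (simp_all add: c_def u w mp.scale_minus_left sum_negf)
    moreover have "lin_act g b = X 3 ^ k * lin_act g y + r" by (simp add: b_def)
    ultimately have "(\<Sum>j\<in>J. c j * v j g i) = 0" for i
      unfolding vsum by (simp add: lin_act_hom(7))
    then have c0: "\<forall>j\<in>J. c j = 0" using p(3)[OF g(2)] unfolding independent_at_def by blast
    have "u b = 0" if "b \<in> C" for b
      using bspec[OF c0, of "Inr (Inl b)"] that by (auto simp: J_def c_def)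
    then have "y = 0" unfolding u by (intro sum.neutral) auto
    then have "q = lin_act g x" using qxy by (simp add: lin_act_hom)
    moreover have "r = 0"
    proof -
      have "Poly_Mapping.lookup r m = 0" if "m \<in> R" for m
        using bspec[OF c0, of "Inr (Inr m)"] that by (auto simp: J_def c_def)
      then have "(\<Sum>m\<in>R. Poly_Mapping.single m (Poly_Mapping.lookup r m)) = 0" by (intro sum.neutral) auto
      then show ?thesis using rr by simp
    qed
    ultimately show "q \<in> lin_act g ` I \<and> r = 0" using x by blast
  qed
  then show thesis using that p by blast
qed

subsection \<open>Vanishing orders in a space of polynomials\<close>

lemma coeff_mult_of_degree_le:
  fixes p q :: "'a::comm_semiring_1 poly"
  assumes "Polynomial.degree p \<le> m" "Polynomial.degree q \<le> n"
  shows "coeff (p * q) (m + n) = coeff p m * coeff q n"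
proof -
  have "coeff (p * q) (m + n) = (\<Sum>i\<le>m + n. coeff p i * coeff q (m + n - i))" by (rule coeff_mult)
  also have "\<dots> = (\<Sum>i\<in>{m}. coeff p i * coeff q (m + n - i))"
  proof (intro sum.mono_neutral_right ballI)
    fix i assume "i \<in> {..m + n} - {m}"
    then have "m < i \<or> n < m + n - i" by auto
    then show "coeff p i * coeff q (m + n - i) = 0" using assms by (auto simp: coeff_eq_0)
  qed auto
  finally show ?thesis by simp
qed

text \<open>A multiple of \<open>w\<close> is subtracted so that the coefficient in the degree of
  \<open>w\<close> vanishes. If a nonzero \<open>v\<close> were left, its degree would differ from
  that of \<open>w\<close>, and comparing leading coefficients would equate two distinct integers in
  characteristic zero.\<close>

lemma wronskian_zero_imp_multiple:
  fixes u w :: "'a::field_char_0 poly"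
  assumes "pderiv u * w = u * pderiv w" "w \<noteq> 0"
  shows "\<exists>c. u = smult c w"
proof -
  define n where "n = Polynomial.degree w"
  define c where "c = coeff u n / lead_coeff w"
  define v where "v = u - smult c w"
  have vn: "coeff v n = 0" using assms(2) by (simp add: v_def c_def n_def)
  have eq: "pderiv v * w = v * pderiv w"
    using assms(1) by (simp add: v_def pderiv_diff pderiv_smult algebra_simps)
  have "v = 0"
  proof (rule ccontr)
    assume v: "v \<noteq> 0"
    define m where "m = Polynomial.degree v"
    have mn: "m \<noteq> n" using vn v by (auto simp: m_def)
    \<comment> \<open>\<open>pCons 0 (pderiv p)\<close> is the Euler operator: it multiplies the
      coefficient of index \<open>i\<close> by \<open>i\<close> and does not lower the degree, so
      constants need no separate treatment.\<close>
    have "coeff (pCons 0 (pderiv p)) i = of_nat i * coeff p i" for p :: "'a poly" and i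
      by (cases i) (simp_all add: coeff_pderiv)
    then have lead: "coeff (pCons 0 (pderiv p)) (Polynomial.degree p) = of_nat (Polynomial.degree p) * lead_coeff p"
      and deg: "Polynomial.degree (pCons 0 (pderiv p)) \<le> Polynomial.degree p" for p :: "'a poly"
      by (simp, intro degree_le) (simp add: coeff_eq_0)
    have "coeff (pCons 0 (pderiv v) * w) (m + n) = of_nat m * lead_coeff v * lead_coeff w"
      using lead[of v] deg[of v] by (subst coeff_mult_of_degree_le) (simp_all add: m_def n_def)
    moreover have "coeff (v * pCons 0 (pderiv w)) (m + n) = lead_coeff v * (of_nat n * lead_coeff w)"
      using lead[of w] deg[of w] by (subst coeff_mult_of_degree_le) (simp_all add: m_def n_def)
    moreover have "pCons 0 (pderiv v) * w = v * pCons 0 (pderiv w)"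
      using eq by simp
    ultimately show False using v assms(2) mn by simp
  qed
  then show ?thesis by (auto simp: v_def)
qed

text \<open>A Wronskian argument without determinants: dividing by \<open>w r\<close> and differentiating removes one
  generator and lowers the order of vanishing by one. Characteristic zero makes the kernel of this
  operation consist of the multiples of \<open>w r\<close> only.\<close>

lemma finite_high_vanishing:
  fixes w :: "nat \<Rightarrow> 'a::field_char_0 poly"
  shows "\<exists>B. finite B \<and> (\<forall>s c. s \<notin> B \<longrightarrow> [:- s, 1:] ^ r dvd (\<Sum>j<r. smult (c j) (w j)) \<longrightarrow> (\<Sum>j<r. smult (c j) (w j)) = 0)"
proof (induction r arbitrary: w)
  case 0
  show ?case by auto
next
  case (Suc r)
  show ?case
  proof (cases "w r = 0")
    case True
    from Suc.IH[of w] obtain B where B: "finite B" "\<And>s c. s \<notin> B \<Longrightarrow> [:- s, 1:] ^ r dvd (\<Sum>j<r. smult (c j) (w j)) \<Longrightarrow> (\<Sum>j<r. smult (c j) (w j)) = 0"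
      by auto
    have "(\<Sum>j<Suc r. smult (c j) (w j)) = 0" if "s \<notin> B" "[:- s, 1:] ^ Suc r dvd (\<Sum>j<Suc r. smult (c j) (w j))" for s c
    proof -
      have "[:- s, 1:] ^ r dvd [:- s, 1:] ^ Suc r" by (intro le_imp_power_dvd) simp
      then have "[:- s, 1:] ^ r dvd (\<Sum>j<r. smult (c j) (w j))" using that(2) True by (simp add: dvd_trans del: power_Suc)
      then show ?thesis using B(2)[OF that(1)] True by simp
    qed
    then show ?thesis using B(1) by blast
  next
    case False
    \<comment> \<open>The numerator of the derivative of \<open>u / w r\<close>. It kills
      \<open>w r\<close>, which leaves \<open>r\<close> generators.\<close>
    define D where "D u = pderiv u * w r - u * pderiv (w r)" for u
    have D_sum: "D (\<Sum>j<Suc r. smult (c j) (w j)) = (\<Sum>j<r. smult (c j) (D (w j)))" for c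
    proof -
      have add: "D (u + v) = D u + D v" and smult: "D (smult a u) = smult a (D u)" and zero: "D 0 = 0" for u v a
        by (simp_all add: D_def pderiv_add pderiv_smult algebra_simps smult_diff_right)
      have *: "D (\<Sum>j<n. smult (c j) (w j)) = (\<Sum>j<n. smult (c j) (D (w j)))" for n
        by (induction n) (simp_all add: add smult zero)
      have "D (w r) = 0" by (simp add: D_def mult.commute)
      then show ?thesis using *[of "Suc r"] by simp
    qed
    obtain B where B: "finite B" "\<And>s c. s \<notin> B \<Longrightarrow> [:- s, 1:] ^ r dvd (\<Sum>j<r. smult (c j) (D (w j))) \<Longrightarrow> (\<Sum>j<r. smult (c j) (D (w j))) = 0"
      using Suc.IH[of "\<lambda>j. D (w j)"] by auto
    \<comment> \<open>Off the roots of \<open>w r\<close>, a multiple of \<open>w r\<close> that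
      vanishes at \<open>s\<close> is zero. The exceptional set is independent of the coefficients
      \<open>c\<close>.\<close>
    let ?B = "B \<union> {s. poly (w r) s = 0}"
    have "(\<Sum>j<Suc r. smult (c j) (w j)) = 0"
      if s: "s \<notin> ?B" and dvd: "[:- s, 1:] ^ Suc r dvd (\<Sum>j<Suc r. smult (c j) (w j))" for s c
    proof -
      define u where "u = (\<Sum>j<Suc r. smult (c j) (w j))"
      obtain v where v: "u = [:- s, 1:] ^ Suc r * v" using dvd by (auto simp: u_def dvd_def)
      have "pderiv u = [:- s, 1:] ^ r * (smult (of_nat (Suc r)) v + [:- s, 1:] * pderiv v)"
        unfolding v pderiv_mult pderiv_power_Suc by (simp add: pderiv_pCons algebra_simps)
      then have "[:- s, 1:] ^ r dvd pderiv u" by simp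
      moreover have "[:- s, 1:] ^ r dvd u" unfolding v by (intro dvd_mult2 le_imp_power_dvd) simp
      ultimately have "[:- s, 1:] ^ r dvd D u" by (simp add: D_def)
      then have "D u = 0" using B(2)[of s c] s D_sum[of c] by (simp add: u_def del: sum.lessThan_Suc)
      then obtain k where k: "u = smult k (w r)"
        using wronskian_zero_imp_multiple[of u "w r"] False by (auto simp: D_def)
      have "poly u s = 0" by (simp add: v)
      then have "k = 0" using k s by simp
      then show ?thesis using k by (simp add: u_def)
    qed
    moreover have "finite ?B" using B(1) poly_roots_finite[OF False] by simp
    ultimately show ?thesis by blast
  qed
qed

subsection \<open>The generic initial ideal\<close>

lemma lefschetz_form_image:
  assumes "inverse_pair g h" "lefschetz_form I \<sigma> l" "lin_act h (X 3) = l"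
  shows "lefschetz_form (lin_act g ` I) \<sigma> (X 3)"
proof -
  interpret inverse_pair g h by fact
  show ?thesis
    using assms(2,3) lin_act_forms[of _ _ h]
    by (auto simp: lefschetz_form_def lin_act_image_iff lin_act_hom)
qed

lemma linear_form_eq:
  fixes l :: "'a::comm_ring_1 poly3"
  assumes "l \<in> forms 1"
  shows "l = (\<Sum>i\<in>UNIV. Const (Poly_Mapping.lookup l (Poly_Mapping.single i 1)) * X i)"
proof (rule poly_mapping_eqI)
  fix m
  obtain a b c where m: "m = mon a b c" by (rule mon_cases)
  have s: "Poly_Mapping.single 1 1 = mon 1 0 0" "Poly_Mapping.single 2 1 = mon 0 1 0" "Poly_Mapping.single 3 1 = mon 0 0 1"
    by (simp_all add: mon_def)
  have *: "Poly_Mapping.lookup (Const k * X i) n = (if n = Poly_Mapping.single i 1 then k else 0)" for k :: 'a and i n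
    by (auto simp: Const_def X_def mult_single lookup_single when_def)
  show "Poly_Mapping.lookup l m = Poly_Mapping.lookup (\<Sum>i\<in>UNIV. Const (Poly_Mapping.lookup l (Poly_Mapping.single i 1)) * X i) m"
  proof (cases "a + b + c = 1")
    case True
    then consider "a = 1" "b = 0" "c = 0" | "a = 0" "b = 1" "c = 0" | "a = 0" "b = 0" "c = 1" by linarith
    then show ?thesis unfolding sum_3 lookup_add * s m by cases simp_all
  next
    case False
    then have "Poly_Mapping.lookup l m = 0" using assms by (simp add: forms_iff m)
    then show ?thesis using False unfolding sum_3 lookup_add * s m by auto
  qed
qed

lemma linear_form_to_X3:
  fixes l :: "'a::field poly3"
  assumes "l \<in> forms 1" "l \<noteq> 0"
  obtains g h where "inverse_pair g h" "lin_act h (X 3) = l"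
proof -
  define c where "c i = Poly_Mapping.lookup l (Poly_Mapping.single i 1)" for i
  have l: "l = (\<Sum>i\<in>UNIV. Const (c i) * X i)" unfolding c_def by (rule linear_form_eq[OF assms(1)])
  have "\<exists>i. c i \<noteq> 0"
  proof (rule ccontr)
    assume "\<not> ?thesis"
    then have "l = 0" using l by simp
    then show False using assms(2) by simp
  qed
  then obtain k where k: "c k \<noteq> 0" by blast
  \<comment> \<open>The third column holds the coefficients of \<open>l\<close>; the first two are
    the unit vectors other than the one at the pivot \<open>k\<close>, so the determinant is
    \<open>c k\<close> up to sign.\<close>
  define h :: "'a ^ 3 ^ 3" where
    "h = (\<chi> i j. if j = 3 then c i else if j = 1 then (if i = (if k = 1 then 2 else 1) then 1 else 0)
      else if i = (if k = 3 then 2 else 3) then 1 else 0)"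
  have "det h \<noteq> 0" using k exhaust_3[of k] by (auto simp: det_3 h_def)
  then have "invertible h" by (simp add: invertible_det_nz)
  then obtain g where "h ** g = mat 1" "g ** h = mat 1" by (auto simp: invertible_def)
  then have "inverse_pair g h" by unfold_locales
  moreover have "lin_act h (X 3) = l" by (simp add: lin_act_hom lin_form_def l h_def)
  ultimately show thesis using that by blast
qed

section \<open>Shears and binary forms\<close>

definition shear :: "'a::field \<Rightarrow> 'a ^ 3 ^ 3" where
  "shear s = (\<chi> i j. if i = j then 1 else if i = 1 \<and> j = 2 then s else 0)"

lemma inverse_pair_shear: "inverse_pair (shear s) (shear (- s))"
proof -
  have "shear s ** shear t = (\<chi> i j. if i = j then 1 else if i = 1 \<and> j = 2 then s + t else 0)" for s t :: 'a
    by (auto simp: vec_eq_iff forall_3 matrix_matrix_mult_def sum_3 shear_def)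
  then show ?thesis by unfold_locales (auto simp: vec_eq_iff forall_3 mat_def)
qed

lemma lin_form_shear: "lin_form (shear s) 1 = X 1" "lin_form (shear s) 2 = Const s * X 1 + X 2" "lin_form (shear s) 3 = X 3"
  by (simp_all add: lin_form_def sum_3 shear_def)

text \<open>Setting x1 = 1 and x3 = 0 identifies the binary forms of a fixed degree \<open>t\<close>
  with the univariate polynomials of degree at most \<open>t\<close>, so divisibility by x2 - u x1
  becomes vanishing at \<open>u\<close>.\<close>

definition dehom :: "'a::comm_ring_1 poly3 \<Rightarrow> 'a poly" where
  "dehom = eval_mpol (\<lambda>c. [:c:]) (\<lambda>i. if i = 1 then 1 else if i = 2 then [:0, 1:] else 0)"

lemma dehom_hom: "dehom (p + q) = dehom p + dehom q" "dehom (p * q) = dehom p * dehom q" "dehom (smul c p) = smult c (dehom p)"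
    "dehom (Const c) = [:c:]" "dehom (X 1) = 1" "dehom (X 2) = [:0, 1:]" "dehom (X 3) = 0"
  by (simp_all add: dehom_def poly_eval.eval_mpol_add poly_eval.eval_mpol_mult smul_def)

lemma dehom_sum: "dehom (sum f A) = (\<Sum>i\<in>A. dehom (f i))"
  by (simp add: dehom_def poly_eval.eval_mpol_sum)

lemma dehom_lin_act: "dehom (lin_act g p) = eval_mpol (\<lambda>c. [:c:]) (\<lambda>j. dehom (lin_form g j)) p"
proof (induction p rule: mpol_induct)
  case (single m c)
  show ?case
    by (simp add: lin_act_single dehom_hom poly_eval.eval_mpol_single)
      (simp add: dehom_def poly_eval.eval_mpol_mon_eval)
qed (simp add: lin_act_hom dehom_hom poly_eval.eval_mpol_add)

lemma coeff_dehom: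
  assumes "p \<in> forms t" "b \<le> t"
  shows "coeff (dehom p) b = Poly_Mapping.lookup p (mon (t - b) b 0)"
proof -
  let ?u = "\<lambda>i::3. if i = 1 then 1 else if i = 2 then [:0, 1:] else (0 :: 'a poly)"
  let ?M = "{m. mdeg m = t}"
  have sub: "Poly_Mapping.keys p \<subseteq> ?M" using assms(1) by (auto simp: forms_def homogeneous_def)
  have mon: "coeff (mon_eval ?u (mon a b' c)) b = (if b' = b \<and> c = 0 then 1 else 0)" for a b' c
    by (cases c) (simp_all add: mon_eval_mon flip: monom_altdef[of 1, simplified])
  have "coeff (dehom p) b = (\<Sum>m\<in>?M. Poly_Mapping.lookup p m * coeff (mon_eval ?u m) b)"
    unfolding dehom_def poly_eval.eval_mpol_superset[OF finite_mons_of_degree sub] by (simp add: coeff_sum)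
  also have "\<dots> = (\<Sum>m\<in>{mon (t - b) b 0}. Poly_Mapping.lookup p m * coeff (mon_eval ?u m) b)"
  proof (rule sum.mono_neutral_right)
    show "\<forall>m\<in>?M - {mon (t - b) b 0}. Poly_Mapping.lookup p m * coeff (mon_eval ?u m) b = 0"
    proof
      fix m assume m: "m \<in> ?M - {mon (t - b) b 0}"
      obtain a' b' c' where "m = mon a' b' c'" by (rule mon_cases)
      then show "Poly_Mapping.lookup p m * coeff (mon_eval ?u m) b = 0" using m by (auto simp: mon)
    qed
  qed (use assms(2) in auto)
  also have "\<dots> = Poly_Mapping.lookup p (mon (t - b) b 0)" by (simp add: mon)
  finally show ?thesis .
qed

lemma dehom_eq_zero:
  fixes p :: "'a::comm_ring_1 poly3"
  assumes "p \<in> forms (1 + s)" "dehom p = 0"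
  obtains q where "p = X 3 * q"
proof -
  obtain q r where qr: "p = X 3 ^ 1 * q + r" "r \<in> forms (1 + s)"
    "\<And>a b d. Poly_Mapping.lookup r (mon a b d) = (if d < 1 then Poly_Mapping.lookup p (mon a b d) else 0)"
    using X3_split[OF assms(1)] by metis
  have "Poly_Mapping.lookup r m = 0" for m
  proof (rule ccontr)
    assume m: "Poly_Mapping.lookup r m \<noteq> 0"
    obtain a b d where mm: "m = mon a b d" by (rule mon_cases)
    have d: "d = 0" "Poly_Mapping.lookup p (mon a b 0) \<noteq> 0" using m qr(3)[of a b d] by (auto simp: mm split: if_splits)
    have "a + b = 1 + s" using qr(2)[unfolded forms_iff, rule_format, of m] m by (auto simp: mm d)
    then have "b \<le> 1 + s" "1 + s - b = a" by auto
    then show False using coeff_dehom[OF assms(1), of b] d assms(2) by simp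
  qed
  then have "r = 0" by (intro poly_mapping_eqI) simp
  then show thesis using that[of q] qr(1) by simp
qed

lemma X3_mult_zero: "X 3 * p = 0 \<Longrightarrow> p = 0" for p :: "'a::comm_ring_1 poly3"
proof (rule poly_mapping_eqI)
  fix m assume "X 3 * p = 0"
  obtain a b d where m: "m = mon a b d" by (rule mon_cases)
  show "Poly_Mapping.lookup p m = Poly_Mapping.lookup 0 m"
    using lookup_X3_power_mult[of 1 p a b "Suc d"] \<open>X 3 * p = 0\<close> by (simp add: m)
qed

text \<open>Modulo \<open>x\<^sub>3\<close>, the forms of degree \<open>1 + s\<close> in \<open>A\<close> are binary forms making up a space of dimension
  \<open>s + 2 - e\<close>; after a general shear no nonzero one is divisible by \<open>x\<^sub>2\<close> to that power.\<close>

lemma avoids_low_shear: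
  fixes A :: "'a::field_char_0 poly3 set"
  assumes A: "ideal A" and inj: "\<And>f. f \<in> forms s \<Longrightarrow> X 3 * f \<in> A \<Longrightarrow> f \<in> A"
    and e: "hilbert A (int (1 + s)) - hilbert A (int s) = int e" "e \<le> s + 2"
  shows "\<exists>B. finite B \<and> (\<forall>u. u \<notin> B \<longrightarrow> avoids_low (lin_act (shear u) ` A) e (1 + s))"
proof -
  let ?V = "A \<inter> forms (1 + s)" and ?K = "(*) (X 3) ` (A \<inter> forms s)"
  have KV: "?K \<subseteq> ?V" using ideal_mult[OF A] forms_mult[OF X_in_forms, of _ s 3] by auto
  have subK: "mp.subspace ?K"
    by (intro module_hom.subspace_image[OF module_hom_mult] subspace_ideal_forms[OF A])
  have "?K = {X 3 * v + b |v b. v \<in> A \<inter> forms s \<and> b \<in> {0}}" by auto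
  moreover have "{v \<in> A \<inter> forms s. X 3 * v \<in> {0}} = {0}"
    using X3_mult_zero ideal_zero[OF A] by (auto simp del: mult_eq_0_iff)
  ultimately have dimK: "mp.dim ?K = mp.dim (A \<inter> forms s)"
    using mp.dim_linear_image_sum[OF module_hom_mult subspace_ideal_forms[OF A] forms_subset_span[OF Int_lower2] finite_monomials
        mp.subspace_single_0, of "{}" "X 3" s] by simp
  obtain B0 C where C: "finite B0" "finite C" "mp.span B0 = ?K" "mp.span (B0 \<union> C) = ?V" "card C = mp.dim ?V - mp.dim ?K" "mp.dim ?K \<le> mp.dim ?V"
    by (rule mp.finite_basis_extend[OF forms_subset_span[OF Int_lower2] finite_monomials KV subK subspace_ideal_forms[OF A]]) blast
  \<comment> \<open>\<open>?V\<close> modulo \<open>?K\<close> is the space of binary forms left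
    after setting x3 = 0. Its dimension is that of all binary forms of degree \<open>1 + s\<close>,
    namely \<open>s + 2\<close>, minus the jump \<open>e\<close> of the Hilbert function.\<close>
  have cardC: "card C = s + 2 - e"
  proof -
    have "mp.dim (forms (1 + s) :: 'a poly3 set) = mp.dim (forms s :: 'a poly3 set) + (s + 2)"
      by (simp add: dim_forms)
    then show ?thesis using e C(5,6) unfolding hilbert_of_nat dimK by linarith
  qed
  define r where "r = card C"
  obtain w where w: "bij_betw w {..<r} C"
    using ex_bij_betw_nat_finite[OF C(2)] unfolding r_def atLeast0LessThan by blast
  obtain B where B: "finite B" "\<And>u c. u \<notin> B \<Longrightarrow> [:- u, 1:] ^ r dvd (\<Sum>j<r. smult (c j) (dehom (w j))) \<Longrightarrow>
      (\<Sum>j<r. smult (c j) (dehom (w j))) = 0"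
    using finite_high_vanishing[of r "\<lambda>j. dehom (w j)"] by auto
  have V: "\<exists>c. dehom v = (\<Sum>j<r. smult (c j) (dehom (w j)))" if "v \<in> ?V" for v
  proof -
    have "v \<in> mp.span (B0 \<union> C)" using that C by simp
    then obtain x y where xy: "v = x + y" "x \<in> mp.span B0" "y \<in> mp.span C" unfolding mp.span_Un by blast
    then obtain z where "x = X 3 * z" using C by auto
    moreover obtain d where "y = (\<Sum>b\<in>C. smul (d b) b)" using xy(3) mp.span_finite[OF C(2)] by auto
    ultimately have "dehom v = (\<Sum>b\<in>C. smult (d b) (dehom b))" using xy(1) by (simp add: dehom_hom dehom_sum)
    also have "\<dots> = (\<Sum>j<r. smult (d (w j)) (dehom (w j)))"
      by (rule sum.reindex_bij_betw[OF w, symmetric])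
    finally show ?thesis by (intro exI[of _ "\<lambda>j. d (w j)"])
  qed
  have "avoids_low (lin_act (shear u) ` A) e (1 + s)" if u: "u \<notin> B" for u
    unfolding avoids_low_def
  proof (intro ballI impI)
    fix q r' assume q: "q \<in> forms (1 + s - 1)" and r': "r' \<in> supported (low_monomials e (1 + s))"
      and f: "X 3 * q + r' \<in> lin_act (shear u) ` A"
    interpret inverse_pair "shear u" "shear (- u)" by (rule inverse_pair_shear)
    define f where "f = X 3 * q + r'"
    define v where "v = lin_act (shear (- u)) f"
    have r'F: "r' \<in> forms (1 + s)" using r' low_monomials_forms[of e "1 + s"] e(2) by auto
    have "f \<in> forms (1 + s)"
      unfolding f_def using r'F forms_mult[OF X_in_forms, of q s 3] q by (intro forms_add) auto
    then have vF: "v \<in> forms (1 + s)" unfolding v_def by (rule lin_act_forms)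
    moreover have "v \<in> A" using f by (simp add: v_def f_def lin_act_image_iff)
    ultimately obtain c where c: "dehom v = (\<Sum>j<r. smult (c j) (dehom (w j)))" using V by blast
    \<comment> \<open>Undoing the shear sends x2 to x2 - u x1, so after dehomogenization a low
      monomial becomes a power of the linear polynomial with root \<open>u\<close>.\<close>
    let ?y = "\<lambda>j. dehom (lin_form (shear (- u)) j)"
    have y: "?y 1 = 1" "?y 2 = [:- u, 1:]" "?y 3 = 0"
      by (simp_all add: lin_form_shear dehom_hom)
    have "dehom v = eval_mpol (\<lambda>c. [:c:]) ?y r'"
      by (simp add: v_def f_def dehom_lin_act poly_eval.eval_mpol_add poly_eval.eval_mpol_mult y)
    also have "\<dots> = (\<Sum>m\<in>low_monomials e (1 + s). [:Poly_Mapping.lookup r' m:] * mon_eval ?y m)"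
      using r' by (intro poly_eval.eval_mpol_superset card_low_monomials) (simp add: supported_def)
    also have "[:- u, 1:] ^ r dvd \<dots>"
    proof (intro dvd_sum dvd_mult)
      fix m assume "m \<in> low_monomials e (1 + s)"
      then obtain a where a: "m = mon a (1 + s - a) 0" "a < e" by (auto simp: low_monomials_def)
      have "mon_eval ?y m = [:- u, 1:] ^ (1 + s - a)" by (simp add: a(1) mon_eval_mon y)
      \<comment> \<open>From \<open>a < e\<close> the exponent is at least \<open>s + 2 - e\<close>,
        which is the number \<open>r\<close> of generators, hence the order of vanishing that
        \<open>finite_high_vanishing\<close> forbids.\<close>
      moreover have "r \<le> 1 + s - a" using a(2) e(2) cardC by (simp add: r_def)
      ultimately show "[:- u, 1:] ^ r dvd mon_eval ?y m" by (simp add: le_imp_power_dvd)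
    qed
    finally have "dehom v = 0" using B(2)[OF u, of c] c by simp
    then obtain v' where "v = X 3 * v'" using dehom_eq_zero[OF vF] by blast
    then have "f = X 3 * lin_act (shear u) v'"
      using lin_act_inverse(1)[of f] by (simp add: v_def lin_act_hom lin_form_shear)
    \<comment> \<open>Now \<open>r'\<close> is a multiple of x3, yet all its monomials are free of
      x3; this leaves only 0.\<close>
    then have eq: "r' = X 3 ^ 1 * (lin_act (shear u) v' - q)" by (simp add: f_def algebra_simps)
    show "r' = 0"
    proof (rule poly_mapping_eqI)
      fix m
      obtain a b d where m: "m = mon a b d" by (rule mon_cases)
      have "Poly_Mapping.lookup r' m = 0" if "d = 0" using that lookup_X3_power_mult[of 1 _ a b d] by (simp add: eq m)
      moreover have "Poly_Mapping.lookup r' m = 0" if "d \<noteq> 0"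
        using r' that by (auto simp: supported_iff low_monomials_def m)
      ultimately show "Poly_Mapping.lookup r' m = Poly_Mapping.lookup 0 m" by auto
    qed
  qed
  then show ?thesis using B(1) by blast
qed

lemma lefschetz_form_X3_inj:
  assumes "ideal A" "lefschetz_form A \<sigma> (X 3)" "2 * s + 2 \<le> \<sigma>" "f \<in> forms s" "X 3 * f \<in> A"
  shows "f \<in> A"
proof -
  have "X 3 ^ (\<sigma> - 2 * s - 1) * (X 3 * f) \<in> A" using assms(1,5) by (rule ideal_mult)
  moreover have "X 3 ^ (\<sigma> - 2 * s - 1) * (X 3 * f) = X 3 ^ (\<sigma> - 2 * s) * f"
    using assms(3) power_Suc2[of "X 3 :: 'a poly3" "\<sigma> - 2 * s - 1"] by (simp add: mult.assoc[symmetric] Suc_diff_Suc)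
  ultimately show ?thesis
    using assms unfolding lefschetz_form_def by (metis add_leD1 le_add_diff_inverse)
qed

section \<open>From one good position to an open set of them\<close>

lemma is_gin_lefschetz:
  fixes I :: "'a::field_char_0 poly3 set"
  assumes I: "homogeneous_ideal I" and one: "1 \<notin> I"
    and sym: "\<And>n. hilbert I (int \<sigma> - n) = hilbert I n"
    and diff: "\<And>t. 2 * t \<le> \<sigma> \<Longrightarrow> hilbert I (int t) - hilbert I (int t - 1) = int (e t)"
    and e0: "e 0 = 1" and e_le: "\<And>t. e t \<le> t + 1"
    and l: "l \<in> forms 1" "lefschetz_form I \<sigma> l" and \<sigma>: "0 < \<sigma>"
  shows "is_gin I (ideal_gen {mono3 a b c |a b c. e (a + b) \<le> a \<or> \<sigma> < 2 * (a + b) + c})"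
proof -
  have idl: "ideal I" using I by (simp add: homogeneous_ideal_def)
  \<comment> \<open>With positive \<open>\<sigma>\<close>, a zero form would satisfy
    \<open>l ^ \<sigma> * 1 \<in> I\<close> and force 1 into \<open>I\<close>.\<close>
  have "l \<noteq> 0"
  proof
    assume "l = 0"
    then have "l ^ \<sigma> * 1 \<in> I" using \<sigma> ideal_zero[OF idl] by (simp add: power_0_left)
    then show False using l(2) one forms_one unfolding lefschetz_form_def by (metis add_0 mult_0_right)
  qed
  then obtain g0 h0 where gh0: "inverse_pair g0 h0" "lin_act h0 (X 3) = l"
    using linear_form_to_X3[OF l(1)] by blast
  interpret g0: inverse_pair g0 h0 by fact
  define A0 where "A0 = lin_act g0 ` I"
  have A0: "homogeneous_ideal A0" "1 \<notin> A0" "lefschetz_form A0 \<sigma> (X 3)" "hilbert A0 n = hilbert I n" for n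
    unfolding A0_def using g0.homogeneous_ideal_image[OF I] g0.one_image[OF one]
      lefschetz_form_image[OF gh0(1) l(2) gh0(2)] g0.hilbert_image[OF idl] by blast+
  have idl0: "ideal A0" using A0(1) by (simp add: homogeneous_ideal_def)
  have "\<exists>B. finite B \<and> (\<forall>u. u \<notin> B \<longrightarrow> avoids_low (lin_act (shear u) ` A0) (e t) t)" if t: "1 \<le> t" "2 * t \<le> \<sigma>" for t
  proof -
    obtain s where s: "t = 1 + s" using t(1) by (cases t) auto
    have h: "hilbert A0 (int (1 + s)) - hilbert A0 (int s) = int (e t)"
      using diff[OF t(2)] unfolding s A0(4) by simp
    have e2: "e t \<le> s + 2" using e_le[of t] s by simp
    show ?thesis
      using avoids_low_shear[OF idl0 lefschetz_form_X3_inj[OF idl0 A0(3)] h e2] t s by auto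
  qed
  then obtain B where B: "\<And>t. 1 \<le> t \<Longrightarrow> 2 * t \<le> \<sigma> \<Longrightarrow> finite (B t)"
    "\<And>t u. 1 \<le> t \<Longrightarrow> 2 * t \<le> \<sigma> \<Longrightarrow> u \<notin> B t \<Longrightarrow> avoids_low (lin_act (shear u) ` A0) (e t) t"
    by metis
  let ?T = "{t. 1 \<le> t \<and> 2 * t \<le> \<sigma>}"
  have finT: "finite ?T" by (rule finite_subset[of _ "{..\<sigma>}"]) auto
  then have "finite (\<Union>t\<in>?T. B t)" using B(1) by blast
  \<comment> \<open>Each relevant degree excludes finitely many shear parameters and there are
    finitely many such degrees, so an infinite field leaves one that works for all of them.\<close>
  then obtain u where u: "u \<notin> (\<Union>t\<in>?T. B t)" using ex_new_if_finite[OF infinite_UNIV_char_0] by blast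
  define g1 where "g1 = shear u ** g0"
  interpret u: inverse_pair "shear u" "shear (- u)" by (rule inverse_pair_shear)
  have A1: "lin_act g1 ` I = lin_act (shear u) ` A0"
    by (simp add: A0_def g1_def image_image lin_act_lin_act)
  have inv1: "invertible g1"
  proof -
    have "invertible (shear u)" "invertible g0" using u.gh u.hg g0.gh g0.hg by (auto simp: invertible_def)
    then show ?thesis by (simp add: g1_def invertible_mult)
  qed
  interpret A1: lefschetz_ideal "lin_act g1 ` I" e \<sigma>
  proof
    show "homogeneous_ideal (lin_act g1 ` I)" "1 \<notin> lin_act g1 ` I"
      unfolding A1 using u.homogeneous_ideal_image[OF A0(1)] u.one_image[OF A0(2)] by blast+
    have h: "hilbert (lin_act g1 ` I) n = hilbert I n" for n
      unfolding A1 by (simp add: u.hilbert_image[OF idl0] A0(4))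
    show "hilbert (lin_act g1 ` I) (int \<sigma> - n) = hilbert (lin_act g1 ` I) n" for n by (simp add: h sym)
    show "hilbert (lin_act g1 ` I) (int t) - hilbert (lin_act g1 ` I) (int t - 1) = int (e t)" if "2 * t \<le> \<sigma>" for t
      using diff[OF that] by (simp add: h)
    show "lefschetz_form (lin_act g1 ` I) \<sigma> (X 3)"
      unfolding A1 by (rule lefschetz_form_image[OF inverse_pair_shear A0(3)]) (simp add: lin_act_hom lin_form_shear)
    show "avoids_low (lin_act g1 ` I) (e t) t" if "1 \<le> t" "2 * t \<le> \<sigma>" for t
      unfolding A1 using B(2)[OF that] u that by blast
  qed (use e0 e_le in auto)
  have "\<exists>p. poly_fun p \<and> p g1 \<noteq> 0 \<and> (\<forall>g. invertible g \<longrightarrow> p g \<noteq> 0 \<longrightarrow> separated (lin_act g ` I) 1 (t - 1) (low_monomials (e t) t))"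
    if t: "t \<in> ?T" for t
  proof -
    have "separated (lin_act g1 ` I) 1 (t - 1) (low_monomials (e t) t)"
      unfolding separated_def
    proof (intro ballI impI)
      fix q r assume q: "q \<in> forms (t - 1)" and r: "r \<in> supported (low_monomials (e t) t)"
        and qr: "X 3 ^ 1 * q + r \<in> lin_act g1 ` I"
      have "r = 0" using A1.low[of t] t q r qr by (auto simp: avoids_low_def)
      then show "q \<in> lin_act g1 ` I \<and> r = 0" using A1.X3_power_inj[of "t - 1" 1 q] t q qr by auto
    qed
    moreover have "low_monomials (e t) t \<subseteq> {m. mdeg m = 1 + (t - 1)}"
      using e_le[of t] t by (auto simp: low_monomials_def)
    ultimately show ?thesis using separated_open[OF idl _ inv1, of "low_monomials (e t) t" 1 "t - 1"] by metis
  qed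
  then have "\<forall>t\<in>?T. \<exists>p. poly_fun p \<and> p g1 \<noteq> 0 \<and> (\<forall>g. invertible g \<longrightarrow> p g \<noteq> 0 \<longrightarrow> separated (lin_act g ` I) 1 (t - 1) (low_monomials (e t) t))"
    by (rule ballI)
  from bchoice[OF this] obtain P where "\<forall>t\<in>?T. poly_fun (P t) \<and> P t g1 \<noteq> 0 \<and>
    (\<forall>g. invertible g \<longrightarrow> P t g \<noteq> 0 \<longrightarrow> separated (lin_act g ` I) 1 (t - 1) (low_monomials (e t) t))" ..
  note P = bspec[OF this, THEN conjunct1] bspec[OF this, THEN conjunct2, THEN conjunct1]
    bspec[OF this, THEN conjunct2, THEN conjunct2, rule_format]
  let ?S = "{s. 2 * s \<le> \<sigma>}"
  have finS: "finite ?S" by (rule finite_subset[of _ "{..\<sigma>}"]) auto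
  have "\<exists>p. poly_fun p \<and> p g1 \<noteq> 0 \<and> (\<forall>g. invertible g \<longrightarrow> p g \<noteq> 0 \<longrightarrow> separated (lin_act g ` I) (\<sigma> - 2 * s) s {})"
    if s: "s \<in> ?S" for s
  proof -
    have "separated (lin_act g1 ` I) (\<sigma> - 2 * s) s {}"
      unfolding separated_def
    proof (intro ballI impI)
      fix q r :: "'a poly3" assume q: "q \<in> forms s" and r: "r \<in> supported {}"
        and qr: "X 3 ^ (\<sigma> - 2 * s) * q + r \<in> lin_act g1 ` I"
      have "r = 0" using r by (intro poly_mapping_eqI) (simp add: supported_iff)
      then show "q \<in> lin_act g1 ` I \<and> r = 0" using A1.X3_power_inj[of s "\<sigma> - 2 * s" q] s q qr by auto
    qed
    then show ?thesis using separated_open[OF idl _ inv1, of "{}" "\<sigma> - 2 * s" s] by (metis empty_subsetI)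
  qed
  then have "\<forall>s\<in>?S. \<exists>p. poly_fun p \<and> p g1 \<noteq> 0 \<and> (\<forall>g. invertible g \<longrightarrow> p g \<noteq> 0 \<longrightarrow> separated (lin_act g ` I) (\<sigma> - 2 * s) s {})"
    by (rule ballI)
  from bchoice[OF this] obtain Q where "\<forall>s\<in>?S. poly_fun (Q s) \<and> Q s g1 \<noteq> 0 \<and>
    (\<forall>g. invertible g \<longrightarrow> Q s g \<noteq> 0 \<longrightarrow> separated (lin_act g ` I) (\<sigma> - 2 * s) s {})" ..
  note Q = bspec[OF this, THEN conjunct1] bspec[OF this, THEN conjunct2, THEN conjunct1]
    bspec[OF this, THEN conjunct2, THEN conjunct2, rule_format]
  \<comment> \<open>One polynomial enforcing finitely many open conditions: low monomials in the
    degrees \<open>?T\<close> and Lefschetz injectivity in the degrees \<open>?S\<close>. It is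
    nonzero at \<open>g1\<close>, so its locus is nonempty.\<close>
  define F where "F g = (\<Prod>t\<in>?T. P t g) * (\<Prod>s\<in>?S. Q s g)" for g
  have "poly_fun F" unfolding F_def by (intro poly_fun_mult poly_fun_prod P(1) Q(1))
  then obtain p where p: "\<And>g. F g = eval_mpol id (\<lambda>(i, j). g $ i $ j) p" by (auto simp: poly_fun_def)
  have "F g1 \<noteq> 0" using P(2) Q(2) finT finS by (simp add: F_def)
  define U where "U = {g. invertible g \<and> (\<exists>p\<in>{p}. eval_mpol id (\<lambda>(i, j). g $ i $ j) p \<noteq> 0)}"
  have "zariski_open_GL3 U" unfolding zariski_open_GL3_def U_def by blast
  moreover have "g1 \<in> U" using inv1 \<open>F g1 \<noteq> 0\<close> by (simp add: U_def flip: p)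
  moreover have "initial_ideal (lin_act g ` I) = ideal_gen {mono3 a b c |a b c. e (a + b) \<le> a \<or> \<sigma> < 2 * (a + b) + c}"
    if "g \<in> U" for g
  proof -
    have inv: "invertible g" and F: "F g \<noteq> 0" using that by (simp_all add: U_def flip: p)
    obtain h where h: "g ** h = mat 1" "h ** g = mat 1" using inv by (auto simp: invertible_def)
    interpret inverse_pair g h using h by unfold_locales
    have sepT: "separated (lin_act g ` I) 1 (t - 1) (low_monomials (e t) t)" if "t \<in> ?T" for t
      using P(3)[OF that inv] F finT that by (auto simp: F_def)
    have sepS: "separated (lin_act g ` I) (\<sigma> - 2 * s) s {}" if "s \<in> ?S" for s
      using Q(3)[OF that inv] F finS that by (auto simp: F_def)
    interpret lefschetz_ideal "lin_act g ` I" e \<sigma>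
    proof
      show "homogeneous_ideal (lin_act g ` I)" "1 \<notin> lin_act g ` I"
        using homogeneous_ideal_image[OF I] one_image[OF one] by blast+
      show "hilbert (lin_act g ` I) (int \<sigma> - n) = hilbert (lin_act g ` I) n" for n by (simp add: hilbert_image[OF idl] sym)
      show "hilbert (lin_act g ` I) (int t) - hilbert (lin_act g ` I) (int t - 1) = int (e t)" if "2 * t \<le> \<sigma>" for t
        using diff[OF that] by (simp add: hilbert_image[OF idl])
      show "lefschetz_form (lin_act g ` I) \<sigma> (X 3)"
        unfolding lefschetz_form_def
      proof (intro allI impI)
        fix s k f assume k: "2 * s + k = \<sigma>" and f: "f \<in> forms s" "X 3 ^ k * f \<in> lin_act g ` I"
        have "0 \<in> supported {}" by (simp add: supported_iff)
        moreover have "\<sigma> - 2 * s = k" "s \<in> ?S" using k by auto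
        ultimately show "f \<in> lin_act g ` I" using sepS[of s] f unfolding separated_def by fastforce
      qed
      show "avoids_low (lin_act g ` I) (e t) t" if "1 \<le> t" "2 * t \<le> \<sigma>" for t
        using sepT[of t] that by (auto simp: avoids_low_def separated_def)
    qed (use e0 e_le in auto)
    show ?thesis by (rule initial_ideal_eq)
  qed
  ultimately show ?thesis unfolding is_gin_def by blast
qed

lemma gin_complete_intersection:
  fixes f1 f2 f3 :: "'a::field_char_0 poly3"
  assumes d: "2 \<le> d1" "d1 < d2" "d2 < d3" "d3 + 1 < d1 + d2"
    and f: "homogeneous d1 f1" "homogeneous d2 f2" "homogeneous d3 f3"
    and reg: "regular_sequence [f1, f2, f3]" and slp: "strong_lefschetz (ideal_gen {f1, f2, f3})"
  shows "gin (ideal_gen {f1, f2, f3}) = ideal_gen {mono3 a b c |a b c.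
    ci_diff d1 d2 d3 (a + b) \<le> a \<or> d1 + d2 + d3 < 2 * (a + b) + c + 3}"
proof -
  let ?I = "ideal_gen {f1, f2, f3}"
  note rs = regular_sequence_3[OF reg f]
  define \<sigma> where "\<sigma> = d1 + d2 + d3 - 3"
  have \<sigma>: "int \<sigma> = int d1 + int d2 + int d3 - 3" "d1 + d2 + d3 = \<sigma> + 3" using d by (auto simp: \<sigma>_def)
  have sym: "hilbert ?I (int \<sigma> - n) = hilbert ?I n" for n
    unfolding \<sigma>(1) using rs(3) by (rule ci_hilbert_reflect)
  obtain l where l: "l \<in> forms 1" "lefschetz_form ?I \<sigma> l"
    using strong_lefschetz_imp_lefschetz_form[OF slp ideal_ideal_gen sym] by blast
  have "is_gin ?I (ideal_gen {mono3 a b c |a b c. ci_diff d1 d2 d3 (a + b) \<le> a \<or> \<sigma> < 2 * (a + b) + c})"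
  proof (rule is_gin_lefschetz[OF rs(1,2) sym _ _ _ l])
    show "hilbert ?I (int t) - hilbert ?I (int t - 1) = int (ci_diff d1 d2 d3 t)" if "2 * t \<le> \<sigma>" for t
      using that \<sigma>(2) by (intro ci_hilbert_diff[OF rs(3) d(2-4)]) simp
  qed (use d in \<open>auto simp: ci_diff_def \<sigma>_def\<close>)
  then have "gin ?I = ideal_gen {mono3 a b c |a b c. ci_diff d1 d2 d3 (a + b) \<le> a \<or> \<sigma> < 2 * (a + b) + c}"
    unfolding gin_def using is_gin_unique by (intro the_equality) auto
  moreover have "\<sigma> < 2 * (a + b) + c \<longleftrightarrow> d1 + d2 + d3 < 2 * (a + b) + c + 3" for a b c
    using \<sigma>(2) by auto
  ultimately show ?thesis by simp
qed

subsection \<open>Monomial generators\<close>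

lemma mono3_mult: "mono3 a b c * mono3 a' b' c' = mono3 (a + a') (b + b') (c + c')"
  by (simp add: mono3_def power_add mult_ac)

text \<open>Equality of monomial ideals by divisibility: every listed monomial satisfies
  \<open>P\<close>, and every monomial satisfying \<open>P\<close> is divisible by a listed
  one.\<close>

lemma ideal_gen_mono3_eq:
  fixes G :: "'a::comm_ring_1 poly3 set"
  assumes "\<And>x. x \<in> G \<Longrightarrow> \<exists>a b c. x = mono3 a b c \<and> P a b c"
    and "\<And>a b c. P a b c \<Longrightarrow> \<exists>a'\<le>a. \<exists>b'\<le>b. \<exists>c'\<le>c. mono3 a' b' c' \<in> G"
  shows "ideal_gen {mono3 a b c |a b c. P a b c} = ideal_gen G"
proof
  show "ideal_gen G \<subseteq> ideal_gen {mono3 a b c |a b c. P a b c}"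
    using assms(1) by (intro ideal_gen_minimal) (auto intro!: ideal_gen_superset)
  show "ideal_gen {mono3 a b c |a b c. P a b c} \<subseteq> ideal_gen G"
  proof (intro ideal_gen_minimal ideal_ideal_gen subsetI)
    fix x :: "'a poly3" assume "x \<in> {mono3 a b c |a b c. P a b c}"
    then obtain a b c where x: "x = mono3 a b c" "P a b c" by blast
    then obtain a' b' c' where le: "a' \<le> a" "b' \<le> b" "c' \<le> c" and G: "mono3 a' b' c' \<in> G"
      using assms(2) by blast
    have "x = mono3 (a - a') (b - b') (c - c') * mono3 a' b' c'" using le by (simp add: x mono3_mult)
    then show "x \<in> ideal_gen G" using ideal_mult[OF ideal_ideal_gen ideal_gen_superset[OF G]] by simp
  qed
qed

lemma mono_list_eq: "mono_list a b c = {mono3 a' b' c |a' b'. a' \<le> a \<and> a' + b' = a + b}"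
proof -
  have "\<exists>i\<le>a. a' = a - i \<and> b' = b + i" if "a' \<le> a" "a' + b' = a + b" for a' b'
    using that by (intro exI[of _ "a - a'"]) auto
  then show ?thesis unfolding mono_list_def by fastforce
qed

lemma mono12_times_eq: "mono12_times (mono3 0 b c) j = {mono3 a' b' c |a' b'. b \<le> b' \<and> a' + b' = j + b}"
proof -
  have "\<exists>b''. b' = b + b'' \<and> a' + b'' = j" if "b \<le> b'" "a' + b' = j + b" for a' b'
    using that by (intro exI[of _ "b' - b"]) auto
  then show ?thesis unfolding mono12_times_def mono3_mult by fastforce
qed

text \<open>Here \<open>p\<close> and \<open>q\<close> stand for \<open>d2 - d1\<close> and
  \<open>d3 - d2\<close>. In terms of \<open>p\<close>, \<open>q\<close> and \<open>\<alpha>\<close>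
  the three degrees are sums, and the order hypotheses become lower bounds on the
  parameters.\<close>

context
  fixes p q \<alpha> :: nat
  assumes pq: "1 \<le> p" "1 \<le> q" "2 \<le> \<alpha>"
begin

abbreviation (input) gap :: "nat \<Rightarrow> nat" where
  "gap \<equiv> ci_diff (\<alpha> + q) (\<alpha> + q + p) (\<alpha> + 2 * q + p)"

text \<open>\<open>2 * M\<close> is the sum of the three degrees. \<open>?G1\<close> to
  \<open>?G4\<close> take, for each x1-exponent \<open>a\<close> up to \<open>d1\<close>, the least
  \<open>b\<close> with \<open>gap (a + b) \<le> a\<close>. The gap falls by 1 per degree between
  \<open>d2\<close> and \<open>d3\<close> and then by 2, so as \<open>a\<close> decreases
  \<open>b\<close> grows by 2 and afterwards alternately by 2 and 1. \<open>?G5\<close> to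
  \<open>?G8\<close> take the other x1-x2 monomials with the least x3-exponent
  \<open>2 * M - 2 - 2 * (a + b)\<close>, one family for each branch of
  \<open>ci_diff\<close>.\<close>

lemma even_generators:
  assumes k: "\<alpha> = 2 * k"
  defines "M \<equiv> 3 * k + 2 * q + p"
  shows "ideal_gen {mono3 a b c :: 'a::comm_ring_1 poly3 |a b c. gap (a + b) \<le> a \<or> 2 * M < 2 * (a + b) + c + 3} = ideal_gen
       ({mono3 (\<alpha> + q) 0 0}
        \<union> {mono3 (\<alpha> + q - j) (p + 2 * j - 1) 0 | j. j \<in> {1..q}}
        \<union> (\<Union>j\<in>{1..k - 1}. {mono3 (\<alpha> - 2 * j) (2 * q + p + 3 * j - 1) 0, mono3 (\<alpha> - 2 * j + 1) (2 * q + p + 3 * j - 2) 0})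
        \<union> {mono3 0 (M - 1) 0, mono3 1 (M - 2) 0}
        \<union> (\<Union>j\<in>{1..k - 1}. mono12_times (mono3 0 (M - 3 * j) (2 * j)) (2 * j - 1))
        \<union> (\<Union>j\<in>{1..q}. mono_list (\<alpha> + j - 2) (2 * q + p + 2 - 2 * j) (\<alpha> + 2 * j - 2))
        \<union> (\<Union>j\<in>{1..p}. mono_list (\<alpha> + q - 1) (p + 1 - j) (\<alpha> + 2 * q + 2 * j - 2))
        \<union> (\<Union>j\<in>{1..\<alpha> + q}. mono12_times (mono3 0 0 (\<alpha> + 2 * q + 2 * p + 2 * j - 2)) (\<alpha> + q - j)))"
    (is "_ = ideal_gen (?G1 \<union> ?G2 \<union> ?G3 \<union> ?G4 \<union> ?G5 \<union> ?G6 \<union> ?G7 \<union> ?G8)")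
proof (rule ideal_gen_mono3_eq)
  let ?P = "\<lambda>a b c. gap (a + b) \<le> a \<or> 2 * M < 2 * (a + b) + c + 3"
  fix x :: "'a poly3"
  assume "x \<in> ?G1 \<union> ?G2 \<union> ?G3 \<union> ?G4 \<union> ?G5 \<union> ?G6 \<union> ?G7 \<union> ?G8"
  then consider "x \<in> ?G1" | "x \<in> ?G2" | "x \<in> ?G3" | "x \<in> ?G4" | "x \<in> ?G5" | "x \<in> ?G6" | "x \<in> ?G7" | "x \<in> ?G8"
    by blast
  then obtain a b c where "x = mono3 a b c" "?P a b c"
  proof cases
    case 1
    then show thesis using pq k by (intro that[of "\<alpha> + q" 0 0]) (auto simp: ci_diff_def M_def)
  next
    case 2
    then obtain j where "j \<in> {1..q}" "x = mono3 (\<alpha> + q - j) (p + 2 * j - 1) 0" by blast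
    then show thesis using pq k by (intro that[of "\<alpha> + q - j" "p + 2 * j - 1" 0]) (auto simp: ci_diff_def M_def)
  next
    case 3
    then obtain j where j: "j \<in> {1..k - 1}" and "x = mono3 (\<alpha> - 2 * j) (2 * q + p + 3 * j - 1) 0
        \<or> x = mono3 (\<alpha> - 2 * j + 1) (2 * q + p + 3 * j - 2) 0" by blast
    moreover have "?P (\<alpha> - 2 * j) (2 * q + p + 3 * j - 1) 0" "?P (\<alpha> - 2 * j + 1) (2 * q + p + 3 * j - 2) 0"
      using pq k j by (auto simp: ci_diff_def M_def)
    ultimately show thesis using that by blast
  next
    case 4
    moreover have "?P 0 (M - 1) 0" "?P 1 (M - 2) 0" using pq k by (auto simp: ci_diff_def M_def)
    ultimately show thesis using that by blast
  next
    case 5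
    then obtain j a b where "j \<in> {1..k - 1}" "x = mono3 a b (2 * j)" "a + b = 2 * j - 1 + (M - 3 * j)"
      unfolding mono12_times_eq by blast
    then show thesis using pq k by (intro that[of a b "2 * j"]) (auto simp: ci_diff_def M_def)
  next
    case 6
    then obtain j a b where "j \<in> {1..q}" "x = mono3 a b (\<alpha> + 2 * j - 2)" "a + b = \<alpha> + j - 2 + (2 * q + p + 2 - 2 * j)"
      unfolding mono_list_eq by blast
    then show thesis using pq k by (intro that[of a b "\<alpha> + 2 * j - 2"]) (auto simp: ci_diff_def M_def)
  next
    case 7
    then obtain j a b where "j \<in> {1..p}" "x = mono3 a b (\<alpha> + 2 * q + 2 * j - 2)" "a + b = \<alpha> + q - 1 + (p + 1 - j)"
      unfolding mono_list_eq by blast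
    then show thesis using pq k by (intro that[of a b "\<alpha> + 2 * q + 2 * j - 2"]) (auto simp: ci_diff_def M_def)
  next
    case 8
    then obtain j a b where "j \<in> {1..\<alpha> + q}" "x = mono3 a b (\<alpha> + 2 * q + 2 * p + 2 * j - 2)" "a + b = \<alpha> + q - j + 0"
      unfolding mono12_times_eq by blast
    then show thesis using pq k by (intro that[of a b "\<alpha> + 2 * q + 2 * p + 2 * j - 2"]) (auto simp: ci_diff_def M_def)
  qed
  then show "\<exists>a b c. x = mono3 a b c \<and> ?P a b c" by blast
next
  fix a b c :: nat
  assume P: "gap (a + b) \<le> a \<or> 2 * M < 2 * (a + b) + c + 3"
  let ?G = "?G1 \<union> ?G2 \<union> ?G3 \<union> ?G4 \<union> ?G5 \<union> ?G6 \<union> ?G7 \<union> ?G8 :: 'a poly3 set"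
  show "\<exists>a'\<le>a. \<exists>b'\<le>b. \<exists>c'\<le>c. (mono3 a' b' c' :: 'a poly3) \<in> ?G"
  proof (cases "gap (a + b) \<le> a")
    case True
    \<comment> \<open>The parity of \<open>a\<close> decides which of the two monomials of
      \<open>?G3\<close> divides; the exponents 1 and 0 are left to \<open>?G4\<close>, where the
      gap has reached 0 in degree \<open>M - 1\<close>.\<close>
    consider "\<alpha> + q \<le> a" | "\<alpha> \<le> a" "a < \<alpha> + q" | "2 \<le> a" "a < \<alpha>" "even a" | "2 \<le> a" "a < \<alpha>" "odd a" | "a = 1" | "a = 0"
      by linarith
    then obtain a' b' where "a' \<le> a" "b' \<le> b" "(mono3 a' b' 0 :: 'a poly3) \<in> ?G1 \<union> ?G2 \<union> ?G3 \<union> ?G4"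
    proof cases
      case 1
      then show thesis using that[of "\<alpha> + q" 0] by simp
    next
      case 2
      define j where "j = \<alpha> + q - a"
      have j: "j \<in> {1..q}" "a = \<alpha> + q - j" using 2 by (auto simp: j_def)
      have "p + 2 * j - 1 \<le> b" using True 2 pq k by (auto simp: ci_diff_def j_def split: if_splits)
      then show thesis using that[of a "p + 2 * j - 1"] j by blast
    next
      case 3
      then obtain i where i: "a = 2 * i" by blast
      define j where "j = k - i"
      have j: "j \<in> {1..k - 1}" "a = \<alpha> - 2 * j" using 3 k by (auto simp: j_def i)
      have "2 * q + p + 3 * j - 1 \<le> b" using True 3 pq k by (auto simp: ci_diff_def j_def i split: if_splits)
      then show thesis using that[of a "2 * q + p + 3 * j - 1"] j by blast
    next
      case 4
      then obtain i where i: "a = 2 * i + 1" using oddE by blast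
      define j where "j = k - i"
      have j: "j \<in> {1..k - 1}" "a = \<alpha> - 2 * j + 1" using 4 k by (auto simp: j_def i)
      have "2 * q + p + 3 * j - 2 \<le> b" using True 4 pq k by (auto simp: ci_diff_def j_def i split: if_splits)
      then show thesis using that[of a "2 * q + p + 3 * j - 2"] j by blast
    next
      case 5
      have "M - 2 \<le> b" using True 5 pq k by (auto simp: ci_diff_def M_def split: if_splits)
      then show thesis using that[of 1 "M - 2"] 5 by simp
    next
      case 6
      have "M - 1 \<le> b" using True 6 pq k by (auto simp: ci_diff_def M_def split: if_splits)
      then show thesis using that[of 0 "M - 1"] 6 by simp
    qed
    then show ?thesis by blast
  next
    case False
    then have P2: "2 * M < 2 * (a + b) + c + 3" using P by blast
    have lt: "a < gap (a + b)" using False by simp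
    consider "\<alpha> + 2 * q + p \<le> a + b" | "\<alpha> + q + p \<le> a + b" "a + b < \<alpha> + 2 * q + p"
      | "\<alpha> + q \<le> a + b" "a + b < \<alpha> + q + p" | "a + b < \<alpha> + q"
      by linarith
    then obtain c' where "c' \<le> c" "(mono3 a b c' :: 'a poly3) \<in> ?G5 \<union> ?G6 \<union> ?G7 \<union> ?G8"
    proof cases
      case 1
      define j where "j = M - 1 - (a + b)"
      have j: "j \<in> {1..k - 1}" "2 * j \<le> c" "M - 3 * j \<le> b" "a + b = 2 * j - 1 + (M - 3 * j)"
        using 1 lt P2 pq k by (auto simp: ci_diff_def j_def M_def split: if_splits)
      then have "(mono3 a b (2 * j) :: 'a poly3) \<in> ?G5" unfolding mono12_times_eq by blast
      then show thesis using that j(2) by blast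
    next
      case 2
      define j where "j = \<alpha> + 2 * q + p - (a + b)"
      have j: "j \<in> {1..q}" "\<alpha> + 2 * j - 2 \<le> c" "a \<le> \<alpha> + j - 2" "a + b = \<alpha> + j - 2 + (2 * q + p + 2 - 2 * j)"
        using 2 lt P2 pq k by (auto simp: ci_diff_def j_def M_def split: if_splits)
      then have "(mono3 a b (\<alpha> + 2 * j - 2) :: 'a poly3) \<in> ?G6" unfolding mono_list_eq by blast
      then show thesis using that j(2) by blast
    next
      case 3
      define j where "j = \<alpha> + q + p - (a + b)"
      have j: "j \<in> {1..p}" "\<alpha> + 2 * q + 2 * j - 2 \<le> c" "a \<le> \<alpha> + q - 1" "a + b = \<alpha> + q - 1 + (p + 1 - j)"
        using 3 lt P2 pq k by (auto simp: ci_diff_def j_def M_def split: if_splits)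
      then have "(mono3 a b (\<alpha> + 2 * q + 2 * j - 2) :: 'a poly3) \<in> ?G7" unfolding mono_list_eq by blast
      then show thesis using that j(2) by blast
    next
      case 4
      define j where "j = \<alpha> + q - (a + b)"
      have j: "j \<in> {1..\<alpha> + q}" "\<alpha> + 2 * q + 2 * p + 2 * j - 2 \<le> c" "0 \<le> b" "a + b = \<alpha> + q - j + 0"
        using 4 lt P2 pq k by (auto simp: ci_diff_def j_def M_def split: if_splits)
      then have "(mono3 a b (\<alpha> + 2 * q + 2 * p + 2 * j - 2) :: 'a poly3) \<in> ?G8" unfolding mono12_times_eq by blast
      then show thesis using that j(2) by blast
    qed
    then have "c' \<le> c" "(mono3 a b c' :: 'a poly3) \<in> ?G" by (simp, blast)
    then show ?thesis by (intro exI[of _ a] exI[of _ b] exI[of _ c'] conjI order_refl)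
  qed
qed

text \<open>The same minimal choice, now with degree sum \<open>2 * M + 1\<close>. The gap is odd
  from degree \<open>d3\<close> to degree \<open>M - 1\<close>, where it equals 1, so one monomial
  of that degree still needs a factor x3.\<close>

lemma odd_generators:
  assumes k: "\<alpha> = 2 * k + 1"
  defines "M \<equiv> 3 * k + 1 + 2 * q + p"
  shows "ideal_gen {mono3 a b c :: 'a::comm_ring_1 poly3 |a b c. gap (a + b) \<le> a \<or> 2 * M + 1 < 2 * (a + b) + c + 3} = ideal_gen
       ({mono3 (\<alpha> + q) 0 0}
        \<union> {mono3 (\<alpha> + q - j) (p + 2 * j - 1) 0 | j. j \<in> {1..q}}
        \<union> (\<Union>j\<in>{1..k}. {mono3 (\<alpha> - 2 * j) (2 * q + p + 3 * j - 1) 0, mono3 (\<alpha> - 2 * j + 1) (2 * q + p + 3 * j - 2) 0})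
        \<union> {mono3 0 M 0, mono3 0 (M - 1) 1}
        \<union> (\<Union>j\<in>{1..k - 1}. mono_list (2 * j) (M - 1 - 3 * j) (2 * j + 1))
        \<union> (\<Union>j\<in>{1..q}. mono_list (\<alpha> + j - 2) (2 * q + p + 2 - 2 * j) (\<alpha> + 2 * j - 2))
        \<union> (\<Union>j\<in>{1..p}. mono_list (\<alpha> + q - 1) (p + 1 - j) (\<alpha> + 2 * q + 2 * j - 2))
        \<union> (\<Union>j\<in>{1..\<alpha> + q}. mono12_times (mono3 0 0 (\<alpha> + 2 * q + 2 * p + 2 * j - 2)) (\<alpha> + q - j)))"
    (is "_ = ideal_gen (?G1 \<union> ?G2 \<union> ?G3 \<union> ?G4 \<union> ?G5 \<union> ?G6 \<union> ?G7 \<union> ?G8)")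
proof (rule ideal_gen_mono3_eq)
  let ?P = "\<lambda>a b c. gap (a + b) \<le> a \<or> 2 * M + 1 < 2 * (a + b) + c + 3"
  fix x :: "'a poly3"
  assume "x \<in> ?G1 \<union> ?G2 \<union> ?G3 \<union> ?G4 \<union> ?G5 \<union> ?G6 \<union> ?G7 \<union> ?G8"
  then consider "x \<in> ?G1" | "x \<in> ?G2" | "x \<in> ?G3" | "x \<in> ?G4" | "x \<in> ?G5" | "x \<in> ?G6" | "x \<in> ?G7" | "x \<in> ?G8"
    by blast
  then obtain a b c where "x = mono3 a b c" "?P a b c"
  proof cases
    case 1
    then show thesis using pq k by (intro that[of "\<alpha> + q" 0 0]) (auto simp: ci_diff_def M_def)
  next
    case 2
    then obtain j where "j \<in> {1..q}" "x = mono3 (\<alpha> + q - j) (p + 2 * j - 1) 0" by blast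
    then show thesis using pq k by (intro that[of "\<alpha> + q - j" "p + 2 * j - 1" 0]) (auto simp: ci_diff_def M_def)
  next
    case 3
    then obtain j where j: "j \<in> {1..k}" and "x = mono3 (\<alpha> - 2 * j) (2 * q + p + 3 * j - 1) 0
        \<or> x = mono3 (\<alpha> - 2 * j + 1) (2 * q + p + 3 * j - 2) 0" by blast
    moreover have "?P (\<alpha> - 2 * j) (2 * q + p + 3 * j - 1) 0" "?P (\<alpha> - 2 * j + 1) (2 * q + p + 3 * j - 2) 0"
      using pq k j by (auto simp: ci_diff_def M_def)
    ultimately show thesis using that by blast
  next
    case 4
    moreover have "?P 0 M 0" "?P 0 (M - 1) 1" using pq k by (auto simp: ci_diff_def M_def)
    ultimately show thesis using that by blast
  next
    case 5
    then obtain j a b where "j \<in> {1..k - 1}" "x = mono3 a b (2 * j + 1)" "a + b = 2 * j + (M - 1 - 3 * j)"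
      unfolding mono_list_eq by blast
    then show thesis using pq k by (intro that[of a b "2 * j + 1"]) (auto simp: ci_diff_def M_def)
  next
    case 6
    then obtain j a b where "j \<in> {1..q}" "x = mono3 a b (\<alpha> + 2 * j - 2)" "a + b = \<alpha> + j - 2 + (2 * q + p + 2 - 2 * j)"
      unfolding mono_list_eq by blast
    then show thesis using pq k by (intro that[of a b "\<alpha> + 2 * j - 2"]) (auto simp: ci_diff_def M_def)
  next
    case 7
    then obtain j a b where "j \<in> {1..p}" "x = mono3 a b (\<alpha> + 2 * q + 2 * j - 2)" "a + b = \<alpha> + q - 1 + (p + 1 - j)"
      unfolding mono_list_eq by blast
    then show thesis using pq k by (intro that[of a b "\<alpha> + 2 * q + 2 * j - 2"]) (auto simp: ci_diff_def M_def)
  next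
    case 8
    then obtain j a b where "j \<in> {1..\<alpha> + q}" "x = mono3 a b (\<alpha> + 2 * q + 2 * p + 2 * j - 2)" "a + b = \<alpha> + q - j + 0"
      unfolding mono12_times_eq by blast
    then show thesis using pq k by (intro that[of a b "\<alpha> + 2 * q + 2 * p + 2 * j - 2"]) (auto simp: ci_diff_def M_def)
  qed
  then show "\<exists>a b c. x = mono3 a b c \<and> ?P a b c" by blast
next
  fix a b c :: nat
  assume P: "gap (a + b) \<le> a \<or> 2 * M + 1 < 2 * (a + b) + c + 3"
  let ?G = "?G1 \<union> ?G2 \<union> ?G3 \<union> ?G4 \<union> ?G5 \<union> ?G6 \<union> ?G7 \<union> ?G8 :: 'a poly3 set"
  show "\<exists>a'\<le>a. \<exists>b'\<le>b. \<exists>c'\<le>c. (mono3 a' b' c' :: 'a poly3) \<in> ?G"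
  proof (cases "gap (a + b) \<le> a")
    case True
    consider "\<alpha> + q \<le> a" | "\<alpha> \<le> a" "a < \<alpha> + q" | "a < \<alpha>" "odd a" | "2 \<le> a" "a < \<alpha>" "even a" | "a = 0"
      by (metis even_zero linorder_not_le less_2_cases odd_one One_nat_def)
    then obtain a' b' where "a' \<le> a" "b' \<le> b" "(mono3 a' b' 0 :: 'a poly3) \<in> ?G1 \<union> ?G2 \<union> ?G3 \<union> ?G4"
    proof cases
      case 1
      then show thesis using that[of "\<alpha> + q" 0] by simp
    next
      case 2
      define j where "j = \<alpha> + q - a"
      have j: "j \<in> {1..q}" "a = \<alpha> + q - j" using 2 by (auto simp: j_def)
      have "p + 2 * j - 1 \<le> b" using True 2 pq k by (auto simp: ci_diff_def j_def split: if_splits)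
      then show thesis using that[of a "p + 2 * j - 1"] j by blast
    next
      case 3
      then obtain i where i: "a = 2 * i + 1" using oddE by blast
      define j where "j = k - i"
      have j: "j \<in> {1..k}" "a = \<alpha> - 2 * j" using 3 k by (auto simp: j_def i)
      have "2 * q + p + 3 * j - 1 \<le> b" using True 3 pq k by (auto simp: ci_diff_def j_def i split: if_splits)
      then show thesis using that[of a "2 * q + p + 3 * j - 1"] j by blast
    next
      case 4
      then obtain i where i: "a = 2 * i" by blast
      define j where "j = k + 1 - i"
      have j: "j \<in> {1..k}" "a = \<alpha> - 2 * j + 1" using 4 k by (auto simp: j_def i)
      have "2 * q + p + 3 * j - 2 \<le> b" using True 4 pq k by (auto simp: ci_diff_def j_def i split: if_splits)
      then show thesis using that[of a "2 * q + p + 3 * j - 2"] j by blast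
    next
      case 5
      have "M \<le> b" using True 5 pq k by (auto simp: ci_diff_def M_def split: if_splits)
      then show thesis using that[of 0 M] 5 by simp
    qed
    then show ?thesis by blast
  next
    case False
    then have P2: "2 * M + 1 < 2 * (a + b) + c + 3" using P by blast
    have lt: "a < gap (a + b)" using False by simp
    consider "\<alpha> + 2 * q + p \<le> a + b" | "\<alpha> + q + p \<le> a + b" "a + b < \<alpha> + 2 * q + p"
      | "\<alpha> + q \<le> a + b" "a + b < \<alpha> + q + p" | "a + b < \<alpha> + q"
      by linarith
    then obtain c' where "c' \<le> c" "(mono3 a b c' :: 'a poly3) \<in> ?G4 \<union> ?G5 \<union> ?G6 \<union> ?G7 \<union> ?G8"
    proof cases
      case 1
      define j where "j = M - 1 - (a + b)"
      show thesis
      \<comment> \<open>In degree \<open>M - 1\<close> only x2^(M-1) is left, with least x3-exponent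
        1. It is the \<open>j = 0\<close> member of the family \<open>?G5\<close> and is listed in
        \<open>?G4\<close>.\<close>
      proof (cases "j = 0")
        case True
        have "a = 0" "b = M - 1" "1 \<le> c"
          using True 1 lt P2 pq k by (auto simp: ci_diff_def j_def M_def split: if_splits)
        then show thesis using that[of 1] by simp
      next
        case False
        have j: "j \<in> {1..k - 1}" "2 * j + 1 \<le> c" "a \<le> 2 * j" "a + b = 2 * j + (M - 1 - 3 * j)"
          using False 1 lt P2 pq k by (auto simp: ci_diff_def j_def M_def split: if_splits)
        then have "(mono3 a b (2 * j + 1) :: 'a poly3) \<in> ?G5" unfolding mono_list_eq by blast
        then show thesis using that j(2) by blast
      qed
    next
      case 2
      define j where "j = \<alpha> + 2 * q + p - (a + b)"
      have j: "j \<in> {1..q}" "\<alpha> + 2 * j - 2 \<le> c" "a \<le> \<alpha> + j - 2" "a + b = \<alpha> + j - 2 + (2 * q + p + 2 - 2 * j)"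
        using 2 lt P2 pq k by (auto simp: ci_diff_def j_def M_def split: if_splits)
      then have "(mono3 a b (\<alpha> + 2 * j - 2) :: 'a poly3) \<in> ?G6" unfolding mono_list_eq by blast
      then show thesis using that j(2) by blast
    next
      case 3
      define j where "j = \<alpha> + q + p - (a + b)"
      have j: "j \<in> {1..p}" "\<alpha> + 2 * q + 2 * j - 2 \<le> c" "a \<le> \<alpha> + q - 1" "a + b = \<alpha> + q - 1 + (p + 1 - j)"
        using 3 lt P2 pq k by (auto simp: ci_diff_def j_def M_def split: if_splits)
      then have "(mono3 a b (\<alpha> + 2 * q + 2 * j - 2) :: 'a poly3) \<in> ?G7" unfolding mono_list_eq by blast
      then show thesis using that j(2) by blast
    next
      case 4
      define j where "j = \<alpha> + q - (a + b)"
      have j: "j \<in> {1..\<alpha> + q}" "\<alpha> + 2 * q + 2 * p + 2 * j - 2 \<le> c" "0 \<le> b" "a + b = \<alpha> + q - j + 0"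
        using 4 lt P2 pq k by (auto simp: ci_diff_def j_def M_def split: if_splits)
      then have "(mono3 a b (\<alpha> + 2 * q + 2 * p + 2 * j - 2) :: 'a poly3) \<in> ?G8" unfolding mono12_times_eq by blast
      then show thesis using that j(2) by blast
    qed
    then have "c' \<le> c" "(mono3 a b c' :: 'a poly3) \<in> ?G" by (simp, blast)
    then show ?thesis by (intro exI[of _ a] exI[of _ b] exI[of _ c'] conjI order_refl)
  qed
qed

end

theorem proposition2p3p18:
  fixes d1 d2 d3 \<alpha> :: nat
    and f1 f2 f3 :: "'a::field_char_0 poly3"
    and I J :: "'a poly3 set"
  assumes "2 \<le> d1" and "d1 < d2" and "d2 < d3" and "d1 + d2 > d3 + 1"
    and "\<alpha> = d1 + d2 - d3"
    and "homogeneous d1 f1" and "homogeneous d2 f2" and "homogeneous d3 f3"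
    and "regular_sequence [f1, f2, f3]"
    and "I = ideal_gen {f1, f2, f3}"
    and "J = gin I"
    and "strong_lefschetz I"
  shows
    "(even \<alpha> \<longrightarrow> J = ideal_gen
       ({mono3 d1 0 0}
        \<union> {mono3 (d1 - j) (d2 - d1 + 2 * j - 1) 0 | j. j \<in> {1..d3 - d2}}
        \<union> (\<Union>j\<in>{1..(\<alpha> - 2) div 2}.
             {mono3 (d1 + d2 - d3 - 2 * j) (2 * d3 - d1 - d2 + 3 * j - 1) 0,
              mono3 (d1 + d2 - d3 - 2 * j + 1) (2 * d3 - d1 - d2 + 3 * j - 2) 0})
        \<union> {mono3 0 ((d1 + d2 + d3 - 2) div 2) 0, mono3 1 ((d1 + d2 + d3 - 4) div 2) 0}
        \<union> (\<Union>j\<in>{1..(\<alpha> - 2) div 2}.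
             mono12_times (mono3 0 ((d1 + d2 + d3) div 2 - 3 * j) (2 * j)) (2 * j - 1))
        \<union> (\<Union>j\<in>{1..d3 - d2}.
             mono_list (d1 + d2 - d3 + j - 2) (2 * d3 - d1 - d2 + 2 - 2 * j) (d1 + d2 - d3 + 2 * j - 2))
        \<union> (\<Union>j\<in>{1..d2 - d1}.
             mono_list (d1 - 1) (d2 - d1 + 1 - j) (d1 + d3 - d2 + 2 * j - 2))
        \<union> (\<Union>j\<in>{1..d1}.
             mono12_times (mono3 0 0 (d2 + d3 - d1 + 2 * j - 2)) (d1 - j))))
     \<and>
     (odd \<alpha> \<longrightarrow> J = ideal_gen
       ({mono3 d1 0 0}
        \<union> {mono3 (d1 - j) (d2 - d1 + 2 * j - 1) 0 | j. j \<in> {1..d3 - d2}}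
        \<union> (\<Union>j\<in>{1..(\<alpha> - 1) div 2}.
             {mono3 (d1 + d2 - d3 - 2 * j) (2 * d3 - d1 - d2 + 3 * j - 1) 0,
              mono3 (d1 + d2 - d3 - 2 * j + 1) (2 * d3 - d1 - d2 + 3 * j - 2) 0})
        \<union> {mono3 0 ((d1 + d2 + d3 - 1) div 2) 0, mono3 0 ((d1 + d2 + d3 - 3) div 2) 1}
        \<union> (\<Union>j\<in>{1..(\<alpha> - 3) div 2}.
             mono_list (2 * j) ((d1 + d2 + d3 - 3) div 2 - 3 * j) (2 * j + 1))
        \<union> (\<Union>j\<in>{1..d3 - d2}.
             mono_list (d1 + d2 - d3 + j - 2) (2 * d3 - d1 - d2 + 2 - 2 * j) (d1 + d2 - d3 + 2 * j - 2))
        \<union> (\<Union>j\<in>{1..d2 - d1}.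
             mono_list (d1 - 1) (d2 - d1 + 1 - j) (d1 + d3 - d2 + 2 * j - 2))
        \<union> (\<Union>j\<in>{1..d1}.
             mono12_times (mono3 0 0 (d2 + d3 - d1 + 2 * j - 2)) (d1 - j))))"
proof -
  define p where "p = d2 - d1"
  define q where "q = d3 - d2"
  have pq: "1 \<le> p" "1 \<le> q" "2 \<le> \<alpha>" using assms(1-5) by (auto simp: p_def q_def)
  have d: "\<alpha> + q = d1" "\<alpha> + q + p = d2" "\<alpha> + 2 * q + p = d3" using assms(1-5) by (auto simp: p_def q_def)
  have diffs: "d1 + d2 - d3 = \<alpha>" "d3 - d2 = q" "d2 - d1 = p" "2 * d3 - d1 - d2 = 2 * q + p"
    "d1 + d3 - d2 = \<alpha> + 2 * q" "d2 + d3 - d1 = \<alpha> + 2 * q + 2 * p"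
    by (auto simp flip: d)
  have J: "J = ideal_gen {mono3 a b c |a b c. ci_diff d1 d2 d3 (a + b) \<le> a \<or> d1 + d2 + d3 < 2 * (a + b) + c + 3}"
    using gin_complete_intersection[of d1 d2 d3 f1 f2 f3] assms by simp
  show ?thesis
  proof (intro conjI impI, goal_cases)
    case 1
    then obtain k where k: "\<alpha> = 2 * k" by blast
    define M where "M = 3 * k + 2 * q + p"
    have M: "d1 + d2 + d3 = 2 * M" "(\<alpha> - 2) div 2 = k - 1" "(2 * M - 2) div 2 = M - 1" "(2 * M - 4) div 2 = M - 2"
      "2 * M div 2 = M"
      using k by (auto simp: M_def simp flip: d)
    \<comment> \<open>The rewriting order matters: \<open>\<alpha> + q + p\<close> contains
      \<open>\<alpha> + q\<close>, so \<open>d(2)\<close> has to be applied before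
      \<open>d(1)\<close>.\<close>
    show ?case
      unfolding J M diffs by (rule even_generators[OF pq k, folded M_def, unfolded d(2), unfolded d(3), unfolded d(1)])
  next
    case 2
    then obtain k where k: "\<alpha> = 2 * k + 1" using oddE by blast
    define M where "M = 3 * k + 1 + 2 * q + p"
    have M: "d1 + d2 + d3 = 2 * M + 1" "(\<alpha> - 1) div 2 = k" "(\<alpha> - 3) div 2 = k - 1" "(2 * M + 1 - 1) div 2 = M"
      "(2 * M + 1 - 3) div 2 = M - 1"
      using k by (auto simp: M_def simp flip: d)
    show ?case
      unfolding J M diffs by (rule odd_generators[OF pq k, folded M_def, unfolded d(2), unfolded d(3), unfolded d(1)])
  qed
qed

end
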